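(* Let $r\geq 2$ be an integer and let $p\geq r$ be a prime number. For any $r$-uniform hypergraph $\mathcal H$ the following hold. (i) If $p\leq\omega(\mathcal H)$, then $$\mathrm{Xind}_{\mathbb Z_p}(\mathrm{Hom}(K^r_p,\mathcal H))+p\ \geq\ \mathrm{ind}_{\mathbb Z_p}(B_0(\mathcal H,\mathbb Z_p))+1.$$ (ii) If $\mathcal H=\mathrm{KG}^r(\mathcal F)$ for some hypergraph $\mathcal F$, then $$\mathrm{ind}_{\mathbb Z_p}(B_0(\mathcal H,\mathbb Z_p))+1\ \geq\ |V(\mathcal F)|-\mathrm{alt}_p(\mathcal F)\ \geq\ \mathrm{cd}_p(\mathcal F).$$
   Context: Hypergraphs. A hypergraph $\mathcal H$ has a finite vertex set $V(\mathcal H)$ and an edge set $E(\mathcal H)$ which is a family of nonempty subsets of $V(\mathcal H)$; it is $r$-uniform if all edges have size $r$. For $U\subseteq V(\mathcal H)$, $\mathcal H[U]$ is the hypergraph on $U$ whose edges are the edges of $\mathcal H$ contained in $U$. For pairwise disjoint $U_1,\dots,U_q\subseteq V(\mathcal H)$, $\mathcal H[U_1,\dots,U_q]$ is the hypergraph with vertex set $\bigcup_i U_i$ and edge set $\{e\in E(\mathcal H): e\subseteq\bigcup_iU_i,\ |e\cap U_i|\leq 1\ \forall i\in[q]\}$; for $\mathcal H$ $r$-uniform it is a complete $r$-uniform $q$-partite hypergraph if it contains every $r$-subset of $\bigcup_iU_i$ meeting each $U_i$ in at most one vertex. $K^r_n=([n],\binom{[n]}{r})$, and $\omega(\mathcal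 H)$ is the largest $n$ such that $\mathcal H$ contains $K^r_n$ as a subhypergraph. A hypergraph is $k$-colorable if its vertices can be colored with $k$ colors with no monochromatic edge. Kneser hypergraph. $\mathrm{KG}^r(\mathcal F)$ is the $r$-uniform hypergraph with vertex set $E(\mathcal F)$ whose edges are the sets $\{e_1,\dots,e_r\}$ of $r$ pairwise disjoint edges of $\mathcal F$. $\mathrm{cd}_p(\mathcal F)=\min\{|U|: U\subseteq V(\mathcal F),\ \mathcal F[V(\mathcal F)\setminus U]\text{ is }p\text{-colorable}\}$. $\mathbb Z_p=\{\omega^1,\dots,\omega^p\}$ is the cyclic group of order $p$ with generator $\omega$. For $X=(x_1,\dots,x_n)\in(\mathbb Z_p\cup\{0\})^n$, $\mathrm{alt}(X)$ is the maximum length $m$ of a sequence $x_{i_1},\dots,x_{i_m}$ of nonzero terms with $i_1<\dots<i_m$ and $x_{i_j}\neq x_{i_{j+1}}$ for $j\in[m-1]$; and $X^\epsilon=\{i\in[n]:x_i=\epsilon\}$ for $\epsilon\in\mathbb Z_p$. With $n=|V(\mathcal F)|$ and a bijection $\sigma:[n]\to V(\mathcal F)$, $\mathrm{alt}_p(\mathcal F,\sigma)=\max\{\mathrm{alt}(X): X\in(\mathbb Z_p\cup\{0\})^n,\ E(\mathcal F[\sigma(X^\epsilon)])=\varnothing\ \forall\epsilon\in\mathbb Z_p\}$, and $\mathrm{alt}_p(\mathcal F)=\min_\sigma\mathrm{alt}_p(\mathcal F,\sigma)$ over all bijections $\sigma$. Index. A simplicial $\mathbb Z_p$-complex is a simplicial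 complex with a $\mathbb Z_p$-action on its vertices by simplicial maps; it is free if no non-identity element fixes a simplex. $E_n\mathbb Z_p$ denotes any free $(n-1)$-connected $n$-dimensional simplicial $\mathbb Z_p$-complex, e.g. the $(n+1)$-fold join $\mathbb Z_p^{*(n+1)}$. For a $\mathbb Z_p$-space $X$, $\mathrm{ind}_{\mathbb Z_p}(X)$ is the least $n$ such that there is a continuous $\mathbb Z_p$-equivariant map $X\to E_n\mathbb Z_p$ (independent of the choice of $E_n\mathbb Z_p$); for a simplicial complex $K$, $\mathrm{ind}_{\mathbb Z_p}(K)$ means $\mathrm{ind}_{\mathbb Z_p}(\|K\|)$, with $\|K\|$ the geometric realization. Box complex. $B_0(\mathcal H,\mathbb Z_p)$ is the simplicial complex with vertex set $\mathbb Z_p\times V(\mathcal H)$ whose simplices are all sets $\{\omega^1\}\times U_1\cup\dots\cup\{\omega^p\}\times U_p$ with $U_1,\dots,U_p$ pairwise disjoint subsets of $V(\mathcal H)$, $\bigcup_iU_i\neq\varnothing$, and $\mathcal H[U_1,\dots,U_p]$ a complete $r$-uniform $p$-partite hypergraph (some $U_i$ may be empty; if fewer than $r$ of the $U_i$ are nonempty, completeness holds vacuously). $\mathbb Z_p$ acts freely by $\epsilon\cdot(\epsilon',v)=(\epsilon\epsilon',v)$. Cross-index. A $\mathbb Z_p$-poset is a poset on which $\mathbb Z_p$ acts by order automorphisms; it is free if non-identity elements have no fixed points. $Q_{n,p}$ is the free $\mathbb Z_p$-poset on $\mathbb Z_p\times[n+1]$ with $(\epsilon,i)<(\epsilon',j)$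 iff $i<j$ and action $\epsilon\cdot(\epsilon',j)=(\epsilon\epsilon',j)$. $\mathrm{Xind}_{\mathbb Z_p}(P)$ is the least $n$ such that there is an order-preserving $\mathbb Z_p$-equivariant map $P\to Q_{n,p}$. Hom complex. $\mathrm{Hom}(K^r_p,\mathcal H)$ is the free $\mathbb Z_p$-poset of all ordered $p$-tuples $(U_1,\dots,U_p)$ of nonempty pairwise disjoint subsets of $V(\mathcal H)$ such that $\mathcal H[U_1,\dots,U_p]$ is a complete $r$-uniform $p$-partite hypergraph, ordered by $(U_1,\dots,U_p)\preceq(U'_1,\dots,U'_p)$ iff $U_i\subseteq U'_i$ for all $i$, with action $\omega^i\cdot(U_1,\dots,U_p)=(U_{1+i},\dots,U_{p+i})$, where $U_j=U_{j-p}$ for $j>p$. *)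

theory Defs
  imports
    "HOL-Analysis.Analysis"
    "HOL-Algebra.Elementary_Groups"
    "HOL-Computational_Algebra.Primes"
    "HOL-Library.Disjoint_Sets"
    "HOL-Library.FuncSet"
    "HOL-Library.Sublist"
begin

section \<open>Hypergraphs\<close>

record 'a hypergraph =
  verts :: "'a set"
  edges :: "'a set set"

definition hypergraph :: "'a hypergraph \<Rightarrow> bool" where
  "hypergraph H \<longleftrightarrow> finite (verts H) \<and> edges H \<subseteq> Pow (verts H) - {{}}"

definition uniform :: "nat \<Rightarrow> 'a hypergraph \<Rightarrow> bool" where
  "uniform r H \<longleftrightarrow> (\<forall>e\<in>edges H. card e = r)"

definition induced_sub :: "'a hypergraph \<Rightarrow> 'a set \<Rightarrow> 'a hypergraph" where
  "induced_sub H U = \<lparr>verts = U, edges = {e \<in> edges H. e \<subseteq> U}\<rparr>"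

definition partite_sub :: "'a hypergraph \<Rightarrow> 'i set \<Rightarrow> ('i \<Rightarrow> 'a set) \<Rightarrow> 'a hypergraph" where
  "partite_sub H I U =
     \<lparr>verts = (\<Union>i\<in>I. U i),
      edges = {e \<in> edges H. e \<subseteq> (\<Union>i\<in>I. U i) \<and> (\<forall>i\<in>I. card (e \<inter> U i) \<le> 1)}\<rparr>"

definition complete_partite :: "nat \<Rightarrow> 'i set \<Rightarrow> ('i \<Rightarrow> 'a set) \<Rightarrow> 'a hypergraph \<Rightarrow> bool" where
  "complete_partite r I U H \<longleftrightarrow>
     (\<forall>e. e \<subseteq> (\<Union>i\<in>I. U i) \<and> card e = r \<and> (\<forall>i\<in>I. card (e \<inter> U i) \<le> 1) \<longrightarrow> e \<in> edges H)"

definition complete_hypergraph :: "nat \<Rightarrow> nat \<Rightarrow> nat hypergraph" where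
  "complete_hypergraph r n = \<lparr>verts = {1..n}, edges = {e. e \<subseteq> {1..n} \<and> card e = r}\<rparr>"

definition contains_copy :: "'b hypergraph \<Rightarrow> 'a hypergraph \<Rightarrow> bool" where
  "contains_copy G H \<longleftrightarrow>
     (\<exists>f. inj_on f (verts G) \<and> f ` verts G \<subseteq> verts H \<and> (\<forall>e\<in>edges G. f ` e \<in> edges H))"

text \<open>The uniformity is a parameter because a hypergraph without edges does not determine it.\<close>

definition clique_number :: "nat \<Rightarrow> 'a hypergraph \<Rightarrow> nat" where
  "clique_number r H = Max {n. contains_copy (complete_hypergraph r n) H}"

definition colorable :: "nat \<Rightarrow> 'a hypergraph \<Rightarrow> bool" where
  "colorable k H \<longleftrightarrow>
     (\<exists>c \<in> verts H \<rightarrow> {1..k}. \<forall>e\<in>edges H. \<not> (\<exists>i. \<forall>v\<in>e. c v = i))"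

definition colorability_defect :: "nat \<Rightarrow> 'a hypergraph \<Rightarrow> nat" where
  "colorability_defect p F =
     Min {card U |U. U \<subseteq> verts F \<and> colorable p (induced_sub F (verts F - U))}"

definition kneser :: "nat \<Rightarrow> 'a hypergraph \<Rightarrow> 'a set hypergraph" where
  "kneser r F =
     \<lparr>verts = edges F, edges = {A. A \<subseteq> edges F \<and> card A = r \<and> pairwise disjnt A}\<rparr>"

section \<open>The cyclic group and the alternation number\<close>

text \<open>
  For \<open>p > 0\<close> the group \<open>integer_mod_group p\<close> is \<open>{0..<p}\<close> with addition modulo \<open>p\<close>; the element
  \<open>\<omega>\<close> to the power \<open>i\<close> is represented by the residue of the exponent \<open>i\<close>. In particular the
  neutral element (the \<open>p\<close>-th power of \<open>\<omega>\<close>) is \<open>0\<close>, and families indexed by \<open>1, ..., p\<close> become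
  families indexed by residues.
\<close>

abbreviation Zp :: "nat \<Rightarrow> int set" where
  "Zp p \<equiv> carrier (integer_mod_group p)"

abbreviation Zp_mult :: "nat \<Rightarrow> int \<Rightarrow> int \<Rightarrow> int" where
  "Zp_mult p \<equiv> mult (integer_mod_group p)"

text \<open>
  A vector over the cyclic group with an additional zero is a list of options: \<open>None\<close> is the added
  zero, which is not to be confused with the neutral element \<open>Some 0\<close>. Positions are counted
  from \<open>0\<close>.
\<close>

definition alt :: "int option list \<Rightarrow> nat" where
  "alt X = Max {length ys |ys. subseq ys X \<and> None \<notin> set ys \<and> distinct_adj ys}"

definition sign_class :: "int option list \<Rightarrow> int \<Rightarrow> nat set" where
  "sign_class X \<epsilon> = {i. i < length X \<and> X ! i = Some \<epsilon>}"

definition alt_wrt :: "nat \<Rightarrow> 'a hypergraph \<Rightarrow> (nat \<Rightarrow> 'a) \<Rightarrow> nat" where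
  "alt_wrt p F \<sigma> =
     Max {alt X |X. length X = card (verts F) \<and> set X \<subseteq> insert None (Some ` Zp p) \<and>
                    (\<forall>\<epsilon>\<in>Zp p. edges (induced_sub F (\<sigma> ` sign_class X \<epsilon>)) = {})}"

definition alt_number :: "nat \<Rightarrow> 'a hypergraph \<Rightarrow> nat" where
  "alt_number p F = Min {alt_wrt p F \<sigma> |\<sigma>. bij_betw \<sigma> {..<card (verts F)} (verts F)}"

section \<open>Index and cross-index\<close>

definition equivariant_on ::
  "nat \<Rightarrow> 'a set \<Rightarrow> (int \<Rightarrow> 'a \<Rightarrow> 'a) \<Rightarrow> (int \<Rightarrow> 'b \<Rightarrow> 'b) \<Rightarrow> ('a \<Rightarrow> 'b) \<Rightarrow> bool" where
  "equivariant_on p S a b f \<longleftrightarrow> (\<forall>\<epsilon>\<in>Zp p. \<forall>x\<in>S. f (a \<epsilon> x) = b \<epsilon> (f x))"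

definition translate :: "nat \<Rightarrow> int \<Rightarrow> int \<times> 'v \<Rightarrow> int \<times> 'v" where
  "translate p \<epsilon> = (\<lambda>(\<epsilon>', v). (Zp_mult p \<epsilon> \<epsilon>', v))"

text \<open>
  An abstract simplicial complex is given by the set of its nonempty simplices. Points of the
  realization are given by barycentric coordinates. The topology is that of pointwise convergence of
  the coordinates, which is the usual topology for finite complexes; only these are used.
\<close>

definition realization :: "'v set set \<Rightarrow> ('v \<Rightarrow> real) topology" where
  "realization K =
     subtopology (powertop_real UNIV)
       {x. (\<forall>v. 0 \<le> x v) \<and> {v. x v \<noteq> 0} \<in> K \<and> (\<Sum>v | x v \<noteq> 0. x v) = 1}"

text \<open>The affine extension of a vertex map.\<close>

definition realization_map :: "('v \<Rightarrow> 'w) \<Rightarrow> ('v \<Rightarrow> real) \<Rightarrow> ('w \<Rightarrow> real)" where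
  "realization_map f x = (\<lambda>w. \<Sum>v | x v \<noteq> 0 \<and> f v = w. x v)"

text \<open>
  The \<open>(n + 1)\<close>-fold join of \<open>Zp p\<close>, regarded as a discrete space. It is the standard free
  \<open>(n - 1)\<close>-connected \<open>n\<close>-dimensional simplicial complex; for \<open>n = - 1\<close> it is empty.
\<close>

definition EZp :: "nat \<Rightarrow> int \<Rightarrow> (int \<times> int) set set" where
  "EZp p n = {S. S \<subseteq> Zp p \<times> {1..n + 1} \<and> S \<noteq> {} \<and> inj_on snd S}"

definition ind :: "nat \<Rightarrow> 'x topology \<Rightarrow> (int \<Rightarrow> 'x \<Rightarrow> 'x) \<Rightarrow> int" where
  "ind p X a =
     (LEAST n. - 1 \<le> n \<and>
        (\<exists>f. continuous_map X (realization (EZp p n)) f \<and>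
             equivariant_on p (topspace X) a (\<lambda>\<epsilon>. realization_map (translate p \<epsilon>)) f))"

text \<open>The index of a simplicial complex with a simplicial action \<open>a\<close> on its vertices.\<close>

definition ind_complex :: "nat \<Rightarrow> 'v set set \<Rightarrow> (int \<Rightarrow> 'v \<Rightarrow> 'v) \<Rightarrow> int" where
  "ind_complex p K a = ind p (realization K) (\<lambda>\<epsilon>. realization_map (a \<epsilon>))"

definition Q_set :: "nat \<Rightarrow> int \<Rightarrow> (int \<times> int) set" where
  "Q_set p n = Zp p \<times> {1..n + 1}"

definition Q_le :: "int \<times> int \<Rightarrow> int \<times> int \<Rightarrow> bool" where
  "Q_le x y \<longleftrightarrow> x = y \<or> snd x < snd y"

definition Xind :: "nat \<Rightarrow> 'x set \<Rightarrow> ('x \<Rightarrow> 'x \<Rightarrow> bool) \<Rightarrow> (int \<Rightarrow> 'x \<Rightarrow> 'x) \<Rightarrow> int" where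
  "Xind p P leP a =
     (LEAST n. - 1 \<le> n \<and>
        (\<exists>f \<in> P \<rightarrow> Q_set p n. monotone_on P leP Q_le f \<and> equivariant_on p P a (translate p) f))"

section \<open>Box complex and Hom complex\<close>

definition box_complex :: "nat \<Rightarrow> nat \<Rightarrow> 'a hypergraph \<Rightarrow> (int \<times> 'a) set set" where
  "box_complex r p H =
     {Sigma (Zp p) U |U.
        (\<forall>i\<in>Zp p. U i \<subseteq> verts H) \<and> disjoint_family_on U (Zp p) \<and> (\<Union>i\<in>Zp p. U i) \<noteq> {} \<and>
        complete_partite r (Zp p) U (partite_sub H (Zp p) U)}"

definition hom_set :: "nat \<Rightarrow> nat \<Rightarrow> 'a hypergraph \<Rightarrow> (int \<Rightarrow> 'a set) set" where
  "hom_set r p H =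
     {U \<in> Zp p \<rightarrow>\<^sub>E Pow (verts H) - {{}}.
        disjoint_family_on U (Zp p) \<and>
        complete_partite r (Zp p) U (partite_sub H (Zp p) U)}"

definition hom_le :: "nat \<Rightarrow> (int \<Rightarrow> 'a set) \<Rightarrow> (int \<Rightarrow> 'a set) \<Rightarrow> bool" where
  "hom_le p U U' \<longleftrightarrow> (\<forall>i\<in>Zp p. U i \<subseteq> U' i)"

definition hom_action :: "nat \<Rightarrow> int \<Rightarrow> (int \<Rightarrow> 'a set) \<Rightarrow> (int \<Rightarrow> 'a set)" where
  "hom_action p \<epsilon> U = (\<lambda>j\<in>Zp p. U (Zp_mult p j \<epsilon>))"

abbreviation ind_box :: "nat \<Rightarrow> nat \<Rightarrow> 'a hypergraph \<Rightarrow> int" where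
  "ind_box r p H \<equiv> ind_complex p (box_complex r p H) (translate p)"

abbreviation Xind_hom :: "nat \<Rightarrow> nat \<Rightarrow> 'a hypergraph \<Rightarrow> int" where
  "Xind_hom r p H \<equiv> Xind p (hom_set r p H) (hom_le p) (hom_action p)"

end

theory Submission
  imports Defs "HOL-Library.Poly_Mapping"
begin

text \<open>
  Both parts compare a complex having a free action of the cyclic group of order \<open>p\<close> with the joins
  \<open>EZp p n\<close>. A point of a complex is a weighted chain of faces, by barycentric subdivision. Hence an
  order-preserving equivariant map from the face poset to \<open>n + 1\<close> levels yields a continuous
  equivariant map to \<open>EZp p n\<close> (\<open>index_witness_of_poset_map\<close>).

  The bound of the index of the box complex by the cross-index (\<open>ind_box_le_Xind_hom\<close>) needs such a
  map on the face poset of the box complex. A simplex with \<open>p\<close> nonempty parts is an element of the Hom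
  complex and is mapped as the cross-index prescribes. Any other simplex is mapped according to the
  set of indices of its nonempty parts. This is a proper nonempty subset of the cyclic group. Its
  cardinality selects one of \<open>p - 1\<close> further levels, and its mean modulo \<open>p\<close>, which exists as \<open>p\<close> is
  prime, is an equivariant choice of a colour.

  For the Kneser hypergraph of \<open>F\<close> (\<open>ind_box_kneser_ge\<close>), let \<open>N\<close> be the number of vertices of \<open>F\<close>. The
  faces of the join of \<open>N\<close> copies of the group are the nonzero sign vectors of length \<open>N\<close>. The vectors
  of alternation at most \<open>alt_number p F\<close> are mapped to as many levels, by their first sign and their
  alternation. If the alternation is larger, then some sign class contains an edge of \<open>F\<close>, and the edges
  inside the sign classes form a simplex of the box complex, which its index maps to
  \<open>ind_box r p (kneser r F) + 1\<close> more levels. So the join of \<open>N\<close> copies maps equivariantly to the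
  join of \<open>alt_number p F + ind_box r p (kneser r F) + 1\<close> copies, and the latter number is
  at least \<open>N\<close> by a theorem of Dold.

  That theorem (\<open>no_coherent_labelling\<close>) is proved for labellings of points whose labels span a simplex
  near every point. This form suffices because a continuous map to a join yields such a
  labelling by the dominant coordinates (\<open>coherent_point_label\<close>), and it allows to put the labels of
  the two kinds of sign vectors together without forming joins of maps. The proof is a count of traces:
  a labelling with \<open>n\<close> levels of a join with \<open>n + 1\<close> levels induces, through a fine subdivision, a
  chain map on a cone over the join with \<open>n\<close> levels. Its values are chains of the base of the cone, and
  it is equivariant on the base. Its alternating trace, with the empty simplex included, vanishes as
  the cone is contractible (\<open>supertrace_cone\<close>), but is \<open>1\<close> modulo \<open>p\<close> as the group acts freely on
  the nonempty simplices of the base.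

  Finally, the colorability defect is bounded by colouring the vertices at the nonzero positions of an
  optimal sign vector (\<open>colorability_defect_le\<close>).
\<close>

section \<open>Formal sums\<close>

abbreviation terms :: "('a \<Rightarrow>\<^sub>0 int) \<Rightarrow> 'a set" where
  "terms \<equiv> Poly_Mapping.keys"

lemma frag_extend_frag_extend:
  "frag_extend f (frag_extend g c) = frag_extend (\<lambda>x. frag_extend f (g x)) c"
proof -
  have "terms c \<subseteq> UNIV" by simp
  then show ?thesis
    by (induction c rule: frag_induction) (auto simp: frag_extend_diff)
qed

lemma frag_extend_diff_fun:
  "frag_extend (\<lambda>x. f x - g x) c = frag_extend f c - frag_extend g c"
proof -
  have "terms c \<subseteq> UNIV" by simp
  then show ?thesis
    by (induction c rule: frag_induction) (auto simp: frag_extend_diff)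
qed

lemma frag_extend_id [simp]: "frag_extend frag_of c = c"
  using frag_expansion by metis

lemma lookup_frag_extend:
  assumes "finite D" "terms c \<subseteq> D"
  shows "Poly_Mapping.lookup (frag_extend f c) s =
    (\<Sum>t\<in>D. Poly_Mapping.lookup c t * Poly_Mapping.lookup (f t) s)"
proof -
  have "Poly_Mapping.lookup (frag_extend f c) s =
    (\<Sum>t\<in>terms c. Poly_Mapping.lookup c t * Poly_Mapping.lookup (f t) s)"
    unfolding frag_extend_def by (simp add: lookup_sum)
  also have "\<dots> = (\<Sum>t\<in>D. Poly_Mapping.lookup c t * Poly_Mapping.lookup (f t) s)"
    using assms by (intro sum.mono_neutral_left) (auto simp: in_keys_iff)
  finally show ?thesis .
qed

abbreviation chain_image :: "('a \<Rightarrow> 'b) \<Rightarrow> ('a \<Rightarrow>\<^sub>0 int) \<Rightarrow> ('b \<Rightarrow>\<^sub>0 int)" where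
  "chain_image f \<equiv> frag_extend (\<lambda>x. frag_of (f x))"

lemma lookup_chain_image_inj:
  assumes "inj_on g D" "terms c \<subseteq> D" "s \<in> D"
  shows "Poly_Mapping.lookup (chain_image g c) (g s) = Poly_Mapping.lookup c s"
  using assms(2)
proof (induction c rule: frag_induction)
  case (one x)
  then show ?case using assms by (auto simp: inj_on_def)
next
  case (diff a b)
  then show ?case by (simp add: frag_extend_diff lookup_minus)
qed simp

section \<open>Ordered chains and their subdivision\<close>

definition prepend :: "'a \<Rightarrow> ('a list \<Rightarrow>\<^sub>0 int) \<Rightarrow> ('a list \<Rightarrow>\<^sub>0 int)" where
  "prepend a = chain_image (Cons a)"

lemma keys_frag_extendE:
  assumes "s \<in> terms (frag_extend f c)"
  obtains t where "t \<in> terms c" "s \<in> terms (f t)"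
  using subsetD[OF keys_frag_extend assms] by blast

lemma keys_prependE:
  assumes "l \<in> terms (prepend a c)"
  obtains k where "k \<in> terms c" "l = a # k"
  using assms unfolding prepend_def by (elim keys_frag_extendE) auto

text \<open>
  Lists are ordered simplices. The empty list is a generator too, in dimension \<open>-1\<close>, so the chain
  complex is augmented and coning from a point is a contraction in all dimensions.
\<close>

fun list_boundary :: "'a list \<Rightarrow> ('a list \<Rightarrow>\<^sub>0 int)" where
  "list_boundary [] = 0"
| "list_boundary (x # xs) = frag_of xs - prepend x (list_boundary xs)"

lemma boundary_prepend:
  "frag_extend list_boundary (prepend a c) = c - prepend a (frag_extend list_boundary c)"
  by (simp add: prepend_def frag_extend_frag_extend frag_extend_diff_fun)

lemma list_boundary_boundary: "frag_extend list_boundary (list_boundary l) = 0"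
  by (induction l) (auto simp: frag_extend_diff boundary_prepend, simp add: prepend_def)

lemma keys_list_boundary:
  "k \<in> terms (list_boundary l) \<Longrightarrow> set k \<subseteq> set l \<and> length l = Suc (length k)"
proof (induction l arbitrary: k)
  case (Cons x xs)
  have "k = xs \<or> k \<in> terms (prepend x (list_boundary xs))"
    using Cons.prems keys_diff[of "frag_of xs" "prepend x (list_boundary xs)"] by auto
  then show ?case
  proof
    assume "k \<in> terms (prepend x (list_boundary xs))"
    then obtain k' where "k = x # k'" "k' \<in> terms (list_boundary xs)"
      by (rule keys_prependE)
    then show ?case using Cons.IH[of k'] by auto
  qed auto
qed simp

lemma list_boundary_map: "list_boundary (map f l) = chain_image (map f) (list_boundary l)"
  by (induction l) (auto simp: frag_extend_diff prepend_def frag_extend_frag_extend)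

text \<open>
  Barycentric subdivision: the subdivided boundary is coned from an apex \<open>b s\<close>. The complex that is
  subdivided enters through its boundary operator \<open>B\<close> and its dimension \<open>d\<close> only, since it
  consists of sets of vertices at the first subdivision and of lists of points at the later ones.
\<close>

primrec subdivide_dim ::
  "('s \<Rightarrow> 'a) \<Rightarrow> ('s \<Rightarrow> ('s \<Rightarrow>\<^sub>0 int)) \<Rightarrow> nat \<Rightarrow> 's \<Rightarrow> ('a list \<Rightarrow>\<^sub>0 int)" where
  "subdivide_dim b B 0 s = frag_of []"
| "subdivide_dim b B (Suc k) s = prepend (b s) (frag_extend (subdivide_dim b B k) (B s))"

definition subdivide ::
  "('s \<Rightarrow> 'a) \<Rightarrow> ('s \<Rightarrow> ('s \<Rightarrow>\<^sub>0 int)) \<Rightarrow> ('s \<Rightarrow> nat) \<Rightarrow> 's \<Rightarrow> ('a list \<Rightarrow>\<^sub>0 int)" where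
  "subdivide b B d s = subdivide_dim b B (d s) s"

lemma subdivide_step:
  assumes "d s > 0" and "\<And>t. t \<in> terms (B s) \<Longrightarrow> d s = Suc (d t)"
  shows "subdivide b B d s = prepend (b s) (frag_extend (subdivide b B d) (B s))"
proof -
  obtain k where k: "d s = Suc k" using assms(1) gr0_implies_Suc by blast
  have "frag_extend (subdivide_dim b B k) (B s) = frag_extend (subdivide b B d) (B s)"
    using assms(2) k by (intro frag_extend_eq) (auto simp: subdivide_def)
  then show ?thesis by (simp add: subdivide_def k)
qed

text \<open>
  The cone over a chain \<open>c\<close> has boundary \<open>c\<close> minus the cone over the boundary of \<open>c\<close>. Here \<open>c\<close> is
  the subdivided boundary of \<open>s\<close>, which is a cycle by induction because \<open>B\<close> squares to zero.
\<close>

lemma boundary_subdivide: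
  assumes "\<And>s t. s \<in> S \<Longrightarrow> t \<in> terms (B s) \<Longrightarrow> t \<in> S \<and> d s = Suc (d t)"
    and "\<And>s. s \<in> S \<Longrightarrow> frag_extend B (B s) = 0"
    and "s \<in> S"
  shows "frag_extend list_boundary (subdivide b B d s) = frag_extend (subdivide b B d) (B s)"
  using assms(3)
proof (induction "d s" arbitrary: s)
  case 0
  then have "terms (B s) = {}" using assms(1) by fastforce
  then show ?case using 0 by (simp add: subdivide_def)
next
  case (Suc k)
  have "frag_extend list_boundary (frag_extend (subdivide b B d) (B s))
      = frag_extend (\<lambda>t. frag_extend (subdivide b B d) (B t)) (B s)"
    unfolding frag_extend_frag_extend
    using Suc assms(1) by (intro frag_extend_eq) auto
  also have "\<dots> = frag_extend (subdivide b B d) (frag_extend B (B s))"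
    by (simp add: frag_extend_frag_extend)
  also have "\<dots> = 0" using assms(2) Suc.prems by simp
  finally have "frag_extend list_boundary (frag_extend (subdivide b B d) (B s)) = 0" .
  moreover have "subdivide b B d s = prepend (b s) (frag_extend (subdivide b B d) (B s))"
    using Suc(2) assms(1)[OF Suc.prems] by (intro subdivide_step) auto
  ultimately show ?case by (simp add: boundary_prepend) (simp add: prepend_def)
qed

lemma keys_subdivide:
  assumes "\<And>s t. s \<in> S \<Longrightarrow> t \<in> terms (B s) \<Longrightarrow> t \<in> S \<and> d s = Suc (d t) \<and> P t \<subseteq> P s"
    and "\<And>s. s \<in> S \<Longrightarrow> d s > 0 \<Longrightarrow> b s \<in> P s"
    and "s \<in> S" and "l \<in> terms (subdivide b B d s)"
  shows "set l \<subseteq> P s \<and> length l = d s"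
  using assms(3,4)
proof (induction "d s" arbitrary: s l)
  case 0
  then show ?case by (simp add: subdivide_def)
next
  case (Suc k)
  have "l \<in> terms (prepend (b s) (frag_extend (subdivide b B d) (B s)))"
    using Suc(2,4) assms(1)[OF Suc.prems(1)] subdivide_step[of d s B b] by auto
  then obtain l' where l': "l = b s # l'" "l' \<in> terms (frag_extend (subdivide b B d) (B s))"
    by (rule keys_prependE)
  from this(2) obtain t where t: "t \<in> terms (B s)" "l' \<in> terms (subdivide b B d t)"
    by (rule keys_frag_extendE)
  then have "t \<in> S" "d s = Suc (d t)" "P t \<subseteq> P s" using assms(1) Suc.prems by blast+
  then show ?case using Suc t l' assms(2)[OF Suc.prems(1)] by force
qed

lemma subdivide_map:
  assumes "\<And>s t. s \<in> S \<Longrightarrow> t \<in> terms (B s) \<Longrightarrow> t \<in> S \<and> d s = Suc (d t)"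
    and "\<And>s. s \<in> S \<Longrightarrow> b (g s) = h (b s)"
    and "\<And>s. s \<in> S \<Longrightarrow> B (g s) = chain_image g (B s)"
    and "\<And>s. s \<in> S \<Longrightarrow> d (g s) = d s"
    and "s \<in> S"
  shows "subdivide b B d (g s) = chain_image (map h) (subdivide b B d s)"
proof -
  have "subdivide_dim b B (d s) (g s) = chain_image (map h) (subdivide_dim b B (d s) s)"
    using assms(5)
  proof (induction "d s" arbitrary: s)
    case 0
    then show ?case by simp
  next
    case (Suc k)
    have "frag_extend (\<lambda>t. subdivide_dim b B k (g t)) (B s)
        = frag_extend (\<lambda>t. chain_image (map h) (subdivide_dim b B k t)) (B s)"
    proof (rule frag_extend_eq)
      fix t assume "t \<in> terms (B s)"
      then have "t \<in> S" "k = d t" using assms(1)[OF Suc.prems] Suc(2) by auto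
      then show "subdivide_dim b B k (g t) = chain_image (map h) (subdivide_dim b B k t)"
        using Suc(1) by blast
    qed
    then show ?case
      unfolding Suc(2)[symmetric]
      by (simp add: assms(2,3)[OF Suc.prems] prepend_def frag_extend_frag_extend)
  qed
  then show ?thesis by (simp add: subdivide_def assms(4)[OF assms(5)])
qed

section \<open>Oriented chains of simplices with levels\<close>

text \<open>
  A simplex is a finite set of pairs whose second components, the levels, are distinct. It is
  oriented by increasing level. As translations preserve levels, they act on oriented chains without
  any signs.
\<close>

definition level_sign :: "'e \<times> int \<Rightarrow> ('e \<times> int) set \<Rightarrow> int" where
  "level_sign x S = (-1) ^ card {y \<in> S. snd y < snd x}"

definition face_boundary :: "('e \<times> int) set \<Rightarrow> (('e \<times> int) set \<Rightarrow>\<^sub>0 int)" where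
  "face_boundary S = (\<Sum>y\<in>S. frag_cmul (level_sign y S) (frag_of (S - {y})))"

text \<open>
  Left multiplication by \<open>x\<close> in the exterior algebra on the vertices.
\<close>

definition wedge :: "'e \<times> int \<Rightarrow> ('e \<times> int) set \<Rightarrow> (('e \<times> int) set \<Rightarrow>\<^sub>0 int)" where
  "wedge x S = (if x \<in> S then 0 else frag_cmul (level_sign x S) (frag_of (insert x S)))"

lemma level_sign_square [simp]: "level_sign x S * level_sign x S = 1"
  by (simp add: level_sign_def flip: power_add mult_2)

lemma level_sign_nonzero [simp]: "level_sign x S \<noteq> 0"
  by (simp add: level_sign_def)

lemma level_sign_insert:
  assumes "finite S" "x \<notin> S"
  shows "level_sign y (insert x S) = (if snd x < snd y then - level_sign y S else level_sign y S)"
proof -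
  have "{z \<in> insert x S. snd z < snd y} =
      (if snd x < snd y then insert x {z \<in> S. snd z < snd y} else {z \<in> S. snd z < snd y})"
    by auto
  then show ?thesis using assms by (simp add: level_sign_def)
qed

lemma keys_face_boundary:
  assumes "finite S" "T \<in> terms (face_boundary S)"
  shows "\<exists>y\<in>S. T = S - {y}"
proof -
  have "terms (face_boundary S) \<subseteq>
      (\<Union>y\<in>S. terms (frag_cmul (level_sign y S) (frag_of (S - {y}))))"
    unfolding face_boundary_def by (rule Poly_Mapping.keys_sum)
  also have "\<dots> \<subseteq> (\<lambda>y. S - {y}) ` S" by (auto split: if_splits)
  finally show ?thesis using assms by auto
qed

text \<open>
  The boundary is an antiderivation of the exterior algebra. In terms of signs: removing \<open>y\<close> and
  inserting \<open>x\<close> in the two possible orders gives opposite signs, as either \<open>x\<close> lies below \<open>y\<close> or \<open>y\<close>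
  below \<open>x\<close>. This one identity yields that the boundary squares to zero, that \<open>orient\<close> is a chain map
  and that a cone is contractible.
\<close>

lemma face_boundary_wedge:
  assumes "finite S" "inj_on snd (insert x S)"
  shows "frag_extend face_boundary (wedge x S) + frag_extend (wedge x) (face_boundary S) = frag_of S"
proof (cases "x \<in> S")
  case True
  have "frag_extend (wedge x) (face_boundary S)
      = (\<Sum>y\<in>S. frag_cmul (level_sign y S) (wedge x (S - {y})))"
    unfolding face_boundary_def
    using assms by (simp add: frag_extend_sum frag_extend_cmul o_def)
  also have "\<dots> = (\<Sum>y\<in>S. if y = x then frag_of S else 0)"
  proof (rule sum.cong)
    fix y assume "y \<in> S"
    have "{z \<in> S - {x}. snd z < snd x} = {z \<in> S. snd z < snd x}" by auto
    then have "level_sign x (S - {x}) = level_sign x S" by (simp add: level_sign_def)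
    then show "frag_cmul (level_sign y S) (wedge x (S - {y})) = (if y = x then frag_of S else 0)"
      using True by (auto simp: wedge_def insert_absorb)
  qed simp
  also have "\<dots> = frag_of S" using True assms by simp
  finally show ?thesis using True by (simp add: wedge_def)
next
  case False
  have 1: "frag_extend (wedge x) (face_boundary S)
      = (\<Sum>y\<in>S. frag_cmul (level_sign y S * level_sign x (S - {y})) (frag_of (insert x (S - {y}))))"
    unfolding face_boundary_def wedge_def
    using assms False by (simp add: frag_extend_sum frag_extend_cmul o_def)
  have "frag_extend face_boundary (wedge x S) = frag_cmul (level_sign x S) (face_boundary (insert x S))"
    using False by (simp add: wedge_def frag_extend_cmul)
  also have "\<dots> = frag_cmul (level_sign x S * level_sign x (insert x S)) (frag_of S)
     + (\<Sum>y\<in>S. frag_cmul (level_sign x S * level_sign y (insert x S)) (frag_of (insert x S - {y})))"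
    unfolding face_boundary_def using assms False
    by (simp add: frag_cmul_distrib2 frag_cmul_sum)
  also have "level_sign x S * level_sign x (insert x S) = 1"
    using assms False by (simp add: level_sign_insert)
  also have "(\<Sum>y\<in>S. frag_cmul (level_sign x S * level_sign y (insert x S)) (frag_of (insert x S - {y})))
     = - (\<Sum>y\<in>S. frag_cmul (level_sign y S * level_sign x (S - {y})) (frag_of (insert x (S - {y}))))"
    unfolding sum_negf[symmetric]
  proof (rule sum.cong)
    fix y assume y: "y \<in> S"
    then have "x \<noteq> y" and ne: "snd x \<noteq> snd y" using False assms by (auto simp: inj_on_def)
    have "level_sign x S = level_sign x (insert y (S - {y}))" using y by (simp add: insert_absorb)
    also have "\<dots> = (if snd y < snd x then - level_sign x (S - {y}) else level_sign x (S - {y}))"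
      using assms by (intro level_sign_insert) auto
    finally have "level_sign x S * level_sign y (insert x S) = - (level_sign y S * level_sign x (S - {y}))"
      using ne assms False by (auto simp: level_sign_insert)
    moreover have "insert x S - {y} = insert x (S - {y})" using \<open>x \<noteq> y\<close> by auto
    ultimately show "frag_cmul (level_sign x S * level_sign y (insert x S)) (frag_of (insert x S - {y}))
      = - frag_cmul (level_sign y S * level_sign x (S - {y})) (frag_of (insert x (S - {y})))"
      by simp
  qed simp
  finally show ?thesis by (simp add: 1)
qed

lemma face_boundary_boundary:
  assumes "finite S" "inj_on snd S"
  shows "frag_extend face_boundary (face_boundary S) = 0"
  using assms
proof (induction S rule: finite_induct)
  case empty
  then show ?case by (simp add: face_boundary_def)
next
  case (insert x S)
  have inj: "inj_on snd (insert x U)" if "U \<subseteq> S" for U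
    using insert.prems that by (meson inj_on_subset insert_mono)
  have *: "frag_extend face_boundary (wedge x U) = frag_of U - frag_extend (wedge x) (face_boundary U)"
    if "U \<subseteq> S" for U
    using face_boundary_wedge[of U x] inj[OF that] insert.hyps that
    by (metis add_diff_cancel_right' rev_finite_subset)
  have "frag_extend face_boundary (frag_extend face_boundary (wedge x S))
     = face_boundary S - frag_extend (\<lambda>U. frag_extend face_boundary (wedge x U)) (face_boundary S)"
    using *[of S] by (simp add: frag_extend_diff frag_extend_frag_extend)
  also have "frag_extend (\<lambda>U. frag_extend face_boundary (wedge x U)) (face_boundary S)
     = frag_extend (\<lambda>U. frag_of U - frag_extend (wedge x) (face_boundary U)) (face_boundary S)"
    using keys_face_boundary[of S] insert.hyps by (intro frag_extend_eq *) blast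
  also have "\<dots> = face_boundary S - frag_extend (wedge x) (frag_extend face_boundary (face_boundary S))"
    by (simp add: frag_extend_diff_fun frag_extend_frag_extend)
  also have "\<dots> = face_boundary S"
    using insert by simp
  finally have "frag_cmul (level_sign x S) (frag_extend face_boundary (face_boundary (insert x S))) = 0"
    using insert.hyps by (simp add: wedge_def frag_extend_cmul)
  then show ?case by simp
qed

text \<open>
  The exterior product of the vertices of a list, i.e. the passage from ordered to oriented
  simplices. A list with a repeated vertex is sent to zero.
\<close>

primrec orient :: "('e \<times> int) list \<Rightarrow> (('e \<times> int) set \<Rightarrow>\<^sub>0 int)" where
  "orient [] = frag_of {}"
| "orient (x # xs) = frag_extend (wedge x) (orient xs)"

lemma keys_wedge: "T \<in> terms (wedge x S) \<Longrightarrow> T = insert x S \<and> x \<notin> S"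
  by (auto simp: wedge_def split: if_splits)

lemma keys_orient: "S \<in> terms (orient l) \<Longrightarrow> S = set l \<and> card S = length l"
proof (induction l arbitrary: S)
  case (Cons x l)
  then obtain T where "T \<in> terms (orient l)" "S \<in> terms (wedge x T)"
    by (auto elim: keys_frag_extendE)
  from keys_wedge[OF this(2)] Cons.IH[OF this(1)] show ?case by auto
qed simp

lemma face_boundary_orient:
  assumes "inj_on snd (set l)"
  shows "frag_extend face_boundary (orient l) = frag_extend orient (list_boundary l)"
  using assms
proof (induction l)
  case Nil
  then show ?case by (simp add: face_boundary_def)
next
  case (Cons x l)
  have "frag_extend face_boundary (orient (x # l))
     = frag_extend (\<lambda>S. frag_of S - frag_extend (wedge x) (face_boundary S)) (orient l)"
    unfolding orient.simps frag_extend_frag_extend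
  proof (rule frag_extend_eq)
    fix S assume "S \<in> terms (orient l)"
    then have "S = set l" using keys_orient by blast
    then show "frag_extend face_boundary (wedge x S) = frag_of S - frag_extend (wedge x) (face_boundary S)"
      using face_boundary_wedge[of S x] Cons.prems
      by (metis List.finite_set add_diff_cancel_right' list.simps(15))
  qed
  also have "\<dots> = orient l - frag_extend (wedge x) (frag_extend face_boundary (orient l))"
    by (simp add: frag_extend_diff_fun frag_extend_frag_extend)
  also have "\<dots> = frag_extend orient (list_boundary (x # l))"
    using Cons by (simp add: frag_extend_diff prepend_def frag_extend_frag_extend)
  finally show ?case .
qed

lemma orient_map:
  assumes "inj_on g (set l)" "\<And>x. snd (g x) = snd x"
  shows "orient (map g l) = chain_image (image g) (orient l)"
  using assms(1)
proof (induction l)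
  case (Cons x l)
  have "frag_extend (\<lambda>S. wedge (g x) (g ` S)) (orient l) = frag_extend (\<lambda>S. chain_image (image g) (wedge x S)) (orient l)"
  proof (rule frag_extend_eq)
    fix S assume "S \<in> terms (orient l)"
    then have S: "S = set l" using keys_orient by blast
    have inj: "inj_on g {y \<in> S. snd y < snd x}"
      using Cons.prems S by (auto simp: inj_on_def)
    have "{y \<in> g ` S. snd y < snd (g x)} = g ` {y \<in> S. snd y < snd x}"
      using assms(2) by auto
    then have "level_sign (g x) (g ` S) = level_sign x S"
      using inj by (simp add: level_sign_def card_image)
    moreover have "g x \<in> g ` S \<longleftrightarrow> x \<in> S" using Cons.prems S by (auto simp: inj_on_def)
    ultimately show "wedge (g x) (g ` S) = chain_image (image g) (wedge x S)"
      by (simp add: wedge_def frag_extend_cmul)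
  qed
  then show ?case using Cons by (simp add: frag_extend_frag_extend)
qed simp

lemma face_boundary_image:
  assumes "inj_on g S" "\<And>x. snd (g x) = snd x" "finite S"
  shows "face_boundary (g ` S) = chain_image (image g) (face_boundary S)"
proof -
  have "face_boundary (g ` S) = (\<Sum>y\<in>S. frag_cmul (level_sign (g y) (g ` S)) (frag_of (g ` S - {g y})))"
    unfolding face_boundary_def using assms by (simp add: sum.reindex)
  also have "\<dots> = (\<Sum>y\<in>S. frag_cmul (level_sign y S) (frag_of (g ` (S - {y}))))"
  proof (rule sum.cong)
    fix y assume y: "y \<in> S"
    have "{z \<in> g ` S. snd z < snd (g y)} = g ` {z \<in> S. snd z < snd y}"
      using assms(2) by auto
    moreover have "inj_on g {z \<in> S. snd z < snd y}" using assms(1) by (auto simp: inj_on_def)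
    ultimately have "level_sign (g y) (g ` S) = level_sign y S"
      by (simp add: level_sign_def card_image)
    moreover have "g ` S - {g y} = g ` (S - {y})" using assms(1) y by (auto simp: inj_on_def)
    ultimately show "frag_cmul (level_sign (g y) (g ` S)) (frag_of (g ` S - {g y}))
      = frag_cmul (level_sign y S) (frag_of (g ` (S - {y})))" by simp
  qed simp
  also have "\<dots> = chain_image (image g) (face_boundary S)"
    unfolding face_boundary_def using assms by (simp add: frag_extend_sum frag_extend_cmul o_def)
  finally show ?thesis .
qed

section \<open>The alternating trace\<close>

text \<open>
  The graded form of the equality of the traces of \<open>A B\<close> and \<open>B A\<close>: interchanging the two sums
  shifts the degree by one, so the two traces cancel instead of agreeing.
\<close>

lemma supertrace_zero:
  fixes A B :: "'s \<Rightarrow> ('s \<Rightarrow>\<^sub>0 int)"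
  assumes fin: "finite D"
    and A: "\<And>s t. s \<in> D \<Longrightarrow> t \<in> terms (A s) \<Longrightarrow> t \<in> D \<and> d t = Suc (d s)"
    and B: "\<And>s t. s \<in> D \<Longrightarrow> t \<in> terms (B s) \<Longrightarrow> t \<in> D"
  shows "(\<Sum>s\<in>D. (-1) ^ d s * Poly_Mapping.lookup (frag_extend B (A s) + frag_extend A (B s)) s) = (0::int)"
proof -
  let ?a = "\<lambda>s t. Poly_Mapping.lookup (A s) t" and ?b = "\<lambda>s t. Poly_Mapping.lookup (B s) t"
  have "(\<Sum>s\<in>D. (-1) ^ d s * Poly_Mapping.lookup (frag_extend B (A s) + frag_extend A (B s)) s)
    = (\<Sum>s\<in>D. \<Sum>t\<in>D. (-1) ^ d s * (?a s t * ?b t s)) + (\<Sum>s\<in>D. \<Sum>t\<in>D. (-1) ^ d s * (?b s t * ?a t s))"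
    unfolding sum.distrib[symmetric]
  proof (rule sum.cong)
    fix s assume s: "s \<in> D"
    have "terms (A s) \<subseteq> D" "terms (B s) \<subseteq> D" using A B s by blast+
    then show "(-1) ^ d s * Poly_Mapping.lookup (frag_extend B (A s) + frag_extend A (B s)) s
      = (\<Sum>t\<in>D. (-1) ^ d s * (?a s t * ?b t s) + (-1) ^ d s * (?b s t * ?a t s))"
      using fin by (simp add: lookup_add lookup_frag_extend sum_distrib_left sum.distrib distrib_left)
  qed simp
  also have "(\<Sum>s\<in>D. \<Sum>t\<in>D. (-1) ^ d s * (?b s t * ?a t s)) = (\<Sum>s\<in>D. \<Sum>t\<in>D. (-1) ^ d t * (?b t s * ?a s t))"
    by (rule sum.swap)
  also have "\<dots> = - (\<Sum>s\<in>D. \<Sum>t\<in>D. (-1) ^ d s * (?a s t * ?b t s))"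
    unfolding sum_negf[symmetric]
  proof (intro sum.cong refl)
    fix s t assume "s \<in> D" "t \<in> D"
    then have "?a s t = 0 \<or> d t = Suc (d s)" using A in_keys_iff by metis
    then show "(-1) ^ d t * (?b t s * ?a s t) = - ((-1) ^ d s * (?a s t * ?b t s))"
      by auto
  qed
  finally show ?thesis by simp
qed

text \<open>
  The cone operator \<open>wedge v\<close> contracts the augmented chains of a complex that is a cone with
  apex \<open>v\<close>. Composed with \<open>F\<close> it writes \<open>F\<close> as a sum to which \<open>supertrace_zero\<close> applies. The
  empty simplex belongs to \<open>D\<close> and contributes to the trace; this is the source of the contradiction
  in \<open>no_coherent_labelling\<close>.
\<close>

lemma supertrace_cone:
  fixes F :: "('e \<times> int) set \<Rightarrow> (('e \<times> int) set \<Rightarrow>\<^sub>0 int)"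
  assumes fin: "finite D"
    and simp: "\<And>S. S \<in> D \<Longrightarrow> finite S \<and> inj_on snd (insert v S)"
    and face: "\<And>S y. S \<in> D \<Longrightarrow> S - {y} \<in> D"
    and cone: "\<And>S. S \<in> D \<Longrightarrow> insert v S \<in> D"
    and F: "\<And>S T. S \<in> D \<Longrightarrow> T \<in> terms (F S) \<Longrightarrow> T \<in> D \<and> card T = card S"
    and chain: "\<And>S. S \<in> D \<Longrightarrow> frag_extend face_boundary (F S) = frag_extend F (face_boundary S)"
  shows "(\<Sum>S\<in>D. (-1) ^ card S * Poly_Mapping.lookup (F S) S) = 0"
proof -
  let ?A = "\<lambda>S. frag_extend F (wedge v S)"
  have "F S = frag_extend face_boundary (?A S) + frag_extend ?A (face_boundary S)" if S: "S \<in> D" for S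
  proof -
    have "F S = frag_extend F (frag_extend face_boundary (wedge v S) + frag_extend (wedge v) (face_boundary S))"
      using face_boundary_wedge simp[OF S] by (metis frag_extend_of)
    also have "\<dots> = frag_extend (\<lambda>T. frag_extend F (face_boundary T)) (wedge v S) + frag_extend ?A (face_boundary S)"
      by (simp add: frag_extend_add frag_extend_frag_extend)
    also have "frag_extend (\<lambda>T. frag_extend F (face_boundary T)) (wedge v S)
        = frag_extend (\<lambda>T. frag_extend face_boundary (F T)) (wedge v S)"
      using chain[OF cone[OF S]] by (intro frag_extend_eq) (auto dest!: keys_wedge)
    finally show ?thesis by (simp add: frag_extend_frag_extend)
  qed
  then have "(\<Sum>S\<in>D. (-1) ^ card S * Poly_Mapping.lookup (F S) S)
    = (\<Sum>S\<in>D. (-1) ^ card S * Poly_Mapping.lookup (frag_extend face_boundary (?A S) + frag_extend ?A (face_boundary S)) S)"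
    by simp
  also have "\<dots> = 0"
  proof (rule supertrace_zero[OF fin])
    fix S T assume S: "S \<in> D" and T: "T \<in> terms (?A S)"
    from T obtain U where "U \<in> terms (wedge v S)" "T \<in> terms (F U)"
      by (rule keys_frag_extendE)
    then show "T \<in> D \<and> card T = Suc (card S)"
      using F[OF cone[OF S]] keys_wedge simp[OF S] by fastforce
  next
    fix S T assume "S \<in> D" "T \<in> terms (face_boundary S)"
    then show "T \<in> D" using keys_face_boundary simp face by metis
  qed
  finally show ?thesis .
qed

section \<open>Translations\<close>

lemma mem_Zp: "p > 0 \<Longrightarrow> e \<in> Zp p \<longleftrightarrow> 0 \<le> e \<and> e < int p"
  by (auto simp: carrier_integer_mod_group)

lemma finite_Zp: "p > 0 \<Longrightarrow> finite (Zp p)"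
  by (simp add: carrier_integer_mod_group)

lemma card_Zp: "p > 0 \<Longrightarrow> card (Zp p) = p"
  by (simp add: carrier_integer_mod_group)

lemma inj_on_add_mod:
  assumes "p > 0"
  shows "inj_on (\<lambda>i. (e + i) mod int p) (Zp p)"
proof (rule inj_onI)
  fix i j assume ij: "i \<in> Zp p" "j \<in> Zp p" "(e + i) mod int p = (e + j) mod int p"
  then have "i mod int p = j mod int p" by (metis add_diff_cancel_left' mod_diff_left_eq)
  then show "i = j" using ij mem_Zp[OF assms] by auto
qed

lemma snd_translate [simp]: "snd (translate p e x) = snd x"
  by (simp add: translate_def split_beta)

lemma fst_translate: "fst (translate p e x) = (e + fst x) mod int p"
  by (simp add: translate_def split_beta)

lemma translate_in: "p > 0 \<Longrightarrow> fst (translate p e x) \<in> Zp p"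
  by (simp add: fst_translate mem_Zp)

lemma snd_image_translate [simp]: "snd ` translate p e ` S = snd ` S"
  by (simp add: image_image)

lemma fst_image_translate: "fst ` translate p e ` S = (\<lambda>i. (e + i) mod int p) ` fst ` S"
  by (simp add: image_image fst_translate)

lemma inj_on_snd_translate: "inj_on snd S \<Longrightarrow> inj_on snd (translate p e ` S)"
  by (auto simp: inj_on_def)

lemma translate_translate: "translate p a (translate p b x) = translate p ((a + b) mod int p) x"
  by (simp add: translate_def split_beta mod_simps add.assoc)

lemma translate_zero: "p > 0 \<Longrightarrow> fst x \<in> Zp p \<Longrightarrow> translate p 0 x = x"
  by (cases x) (simp add: translate_def mem_Zp)

lemma translate_mod [simp]: "translate p (a mod int p) = translate p a"
  by (auto simp: translate_def mod_simps)

lemma translate_neg_translate: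
  assumes "p > 0" "fst x \<in> Zp p"
  shows "translate p (- e) (translate p e x) = x" "translate p e (translate p (- e) x) = x"
  using translate_zero[OF assms] by (simp_all add: translate_translate)

lemma inj_on_translate: "p > 0 \<Longrightarrow> inj_on (translate p e) {x. fst x \<in> Zp p}"
  by (rule inj_on_inverseI[of _ "translate p (- e)"]) (simp add: translate_neg_translate)

lemma translate_image_inverse:
  assumes "p > 0" "fst ` S \<subseteq> Zp p"
  shows "translate p (- e) ` translate p e ` S = S" "translate p e ` translate p (- e) ` S = S"
proof -
  have "fst x \<in> Zp p" if "x \<in> S" for x using assms(2) that by blast
  note neg = translate_neg_translate[OF assms(1) this]
  have "(\<lambda>x. translate p (- e) (translate p e x)) ` S = (\<lambda>x. x) ` S"
    "(\<lambda>x. translate p e (translate p (- e) x)) ` S = (\<lambda>x. x) ` S"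
    by (rule image_cong[OF refl], erule neg)+
  then show "translate p (- e) ` translate p e ` S = S" "translate p e ` translate p (- e) ` S = S"
    unfolding image_image by (simp_all only: image_ident)
qed

lemma translate_image_mem_iff:
  assumes "p > 0" "fst ` S \<subseteq> Zp p"
  shows "w \<in> translate p e ` S \<longleftrightarrow> fst w \<in> Zp p \<and> translate p (- e) w \<in> S"
proof
  assume "w \<in> translate p e ` S"
  then obtain v where "v \<in> S" "w = translate p e v" by blast
  then show "fst w \<in> Zp p \<and> translate p (- e) w \<in> S"
    using translate_neg_translate(1)[OF assms(1), of v e] translate_in[OF assms(1), of e v] assms(2) by auto
next
  assume "fst w \<in> Zp p \<and> translate p (- e) w \<in> S"
  then show "w \<in> translate p e ` S"
    using translate_neg_translate(2)[OF assms(1), of w e] by (metis imageI)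
qed

text \<open>
  The action of \<open>translate p e\<close> on points, as a formula without sums. Coordinates with an invalid first
  component are set to zero, in agreement with \<open>realization_map\<close> on all points of the complexes under
  consideration.
\<close>

definition rotate_point :: "nat \<Rightarrow> int \<Rightarrow> (int \<times> 'v \<Rightarrow> real) \<Rightarrow> (int \<times> 'v \<Rightarrow> real)" where
  "rotate_point p e x w = (if fst w \<in> Zp p then x (translate p (- e) w) else 0)"

lemma rotate_point_translate:
  "p > 0 \<Longrightarrow> fst w \<in> Zp p \<Longrightarrow> rotate_point p e x (translate p e w) = x w"
  by (simp add: rotate_point_def translate_neg_translate translate_in)

lemma realization_map_translate:
  fixes x :: "int \<times> 'v \<Rightarrow> real"
  assumes "p > 0" "\<And>v. x v \<noteq> 0 \<Longrightarrow> fst v \<in> Zp p"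
  shows "realization_map (translate p e) x = rotate_point p e x"
proof
  fix w :: "int \<times> 'v"
  let ?u = "translate p (- e) w"
  have "{v. x v \<noteq> 0 \<and> translate p e v = w} = (if fst w \<in> Zp p \<and> x ?u \<noteq> 0 then {?u} else {})"
  proof -
    have "translate p e v = w \<longleftrightarrow> fst w \<in> Zp p \<and> v = ?u" if "x v \<noteq> 0" for v
      using translate_neg_translate(1)[OF assms(1), of v e] assms(2)[OF that]
        translate_neg_translate(2)[OF assms(1), of w e] translate_in[OF assms(1), of e v]
      by metis
    note iff = this
    have "v \<in> {v. x v \<noteq> 0 \<and> translate p e v = w} \<longleftrightarrow>
        v \<in> (if fst w \<in> Zp p \<and> x ?u \<noteq> 0 then {?u} else {})" for v
      using iff[of v] by (cases "x v = 0") auto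
    then show ?thesis by blast
  qed
  then show "realization_map (translate p e) x w = rotate_point p e x w"
    by (simp add: realization_map_def rotate_point_def)
qed

section \<open>Points of the joins\<close>

lemma topspace_realization:
  "topspace (realization K) =
    {x. (\<forall>v. 0 \<le> x v) \<and> {v. x v \<noteq> 0} \<in> K \<and> (\<Sum>v | x v \<noteq> 0. x v) = 1}"
  by (simp add: realization_def)

lemma translate_EZp:
  assumes "p > 0" "S \<in> EZp p n"
  shows "translate p e ` S \<in> EZp p n"
proof -
  have "translate p e ` S \<subseteq> Zp p \<times> {1..n + 1}"
  proof (intro image_subsetI)
    fix x assume "x \<in> S"
    then have "snd x \<in> {1..n + 1}" using assms by (auto simp: EZp_def)
    then show "translate p e x \<in> Zp p \<times> {1..n + 1}"
      using translate_in[OF assms(1)] by (simp only: mem_Times_iff snd_translate simp_thms)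
  qed
  moreover have "inj_on snd (translate p e ` S)"
    using assms by (force simp: EZp_def inj_on_def)
  ultimately show ?thesis using assms by (auto simp: EZp_def)
qed

lemma finite_EZp: "p > 0 \<Longrightarrow> finite (EZp p n)"
  by (rule finite_subset[of _ "Pow (Zp p \<times> {1..n + 1})"]) (auto simp: EZp_def finite_Zp)

lemma finite_EZp_simplex: "p > 0 \<Longrightarrow> S \<in> EZp p n \<Longrightarrow> finite S"
  by (rule finite_subset[of _ "Zp p \<times> {1..n + 1}"]) (auto simp: EZp_def finite_Zp)

section \<open>Coherent labellings\<close>

text \<open>
  A combinatorial substitute for a continuous map into some \<open>EZp p n\<close>: near every point, labels
  on the same level agree, so the labels that occur there span a simplex.
\<close>

definition coherent :: "'x topology \<Rightarrow> ('x \<Rightarrow> 'e \<times> int) \<Rightarrow> bool" where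
  "coherent X lab \<longleftrightarrow> (\<forall>x\<in>topspace X. \<exists>U. openin X U \<and> x \<in> U \<and> inj_on snd (lab ` U))"

definition face_points :: "'v set \<Rightarrow> ('v \<Rightarrow> real) set" where
  "face_points T = {x. (\<forall>v. 0 \<le> x v) \<and> (\<forall>v. v \<notin> T \<longrightarrow> x v = 0) \<and> (\<Sum>v\<in>T. x v) = 1}"

lemma face_points_le_one:
  assumes "finite T" "x \<in> face_points T"
  shows "x v \<le> 1"
proof (cases "v \<in> T")
  case True
  then have "x v \<le> (\<Sum>v\<in>T. x v)" using assms by (intro member_le_sum) (auto simp: face_points_def)
  then show ?thesis using assms by (simp add: face_points_def)
qed (use assms in \<open>simp add: face_points_def\<close>)

lemma face_points_mono:
  assumes "S \<subseteq> T" "finite T"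
  shows "face_points S \<subseteq> face_points T"
proof
  fix x :: "'a \<Rightarrow> real" assume x: "x \<in> face_points S"
  have "(\<Sum>v\<in>T. x v) = (\<Sum>v\<in>S. x v)"
    using assms x by (intro sum.mono_neutral_right) (auto simp: face_points_def)
  then show "x \<in> face_points T" using x assms by (auto simp: face_points_def)
qed

lemma compact_face_points:
  assumes "finite T"
  shows "compact (face_points T :: ('v \<Rightarrow> real) set)"
proof -
  have "compactin (powertop_real UNIV) (PiE (UNIV::'v set) (\<lambda>_. {0..1}))"
    by (subst compactin_PiE) auto
  then have "compact (PiE (UNIV::'v set) (\<lambda>_. {0..1::real}))"
    by (simp add: euclidean_product_topology)
  moreover have "closed (face_points T :: ('v \<Rightarrow> real) set)"
  proof -
    have c: "continuous_on UNIV (\<lambda>x::'v \<Rightarrow> real. x v)" for v by simp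
    have "closed ({x. \<forall>v. 0 \<le> x v} :: ('v \<Rightarrow> real) set)"
      by (intro closed_Collect_all closed_Collect_le c) simp
    moreover have "closed ({x. \<forall>v. v \<notin> T \<longrightarrow> x v = 0} :: ('v \<Rightarrow> real) set)"
      by (intro closed_Collect_all closed_Collect_imp closed_Collect_eq c) auto
    moreover have "closed ({x. (\<Sum>v\<in>T. x v) = 1} :: ('v \<Rightarrow> real) set)"
      by (intro closed_Collect_eq continuous_on_sum c) simp
    ultimately have "closed (({x. \<forall>v. 0 \<le> x v} \<inter> {x. \<forall>v. v \<notin> T \<longrightarrow> x v = 0}) \<inter> {x. (\<Sum>v\<in>T. x v) = 1} :: ('v \<Rightarrow> real) set)"
      by (intro closed_Int)
    then show ?thesis by (simp add: face_points_def Int_def conj_assoc)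
  qed
  moreover have "face_points T \<subseteq> PiE UNIV (\<lambda>_. {0..1})"
    using face_points_le_one[OF assms] by (auto simp: face_points_def)
  ultimately show ?thesis by (metis closed_Int_compact inf.absorb1)
qed

lemma topspace_realization_faces:
  assumes "\<And>S. S \<in> K \<Longrightarrow> finite S"
    and "\<And>S T. S \<in> K \<Longrightarrow> T \<subseteq> S \<Longrightarrow> T \<noteq> {} \<Longrightarrow> T \<in> K"
  shows "topspace (realization K) = (\<Union>T\<in>K. face_points T)"
proof
  show "topspace (realization K) \<subseteq> (\<Union>T\<in>K. face_points T)"
    by (auto simp: topspace_realization face_points_def)
  show "(\<Union>T\<in>K. face_points T) \<subseteq> topspace (realization K)"
  proof
    fix x assume "x \<in> (\<Union>T\<in>K. face_points T)"
    then obtain T where T: "T \<in> K" "x \<in> face_points T" by blast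
    have eq: "(\<Sum>v | x v \<noteq> 0. x v) = (\<Sum>v\<in>T. x v)"
      using T assms(1)[OF T(1)] by (intro sum.mono_neutral_left) (auto simp: face_points_def)
    have one: "(\<Sum>v | x v \<noteq> 0. x v) = 1" using eq T by (simp add: face_points_def)
    then have "{v. x v \<noteq> 0} \<noteq> {}" by (metis sum.empty zero_neq_one)
    moreover have "{v. x v \<noteq> 0} \<subseteq> T" using T by (auto simp: face_points_def)
    ultimately show "x \<in> topspace (realization K)"
      using T assms(2) one by (auto simp: topspace_realization face_points_def)
  qed
qed

lemma EZp_face: "S \<in> EZp p n \<Longrightarrow> T \<subseteq> S \<Longrightarrow> T \<noteq> {} \<Longrightarrow> T \<in> EZp p n"
  by (auto simp: EZp_def inj_on_def)

text \<open>
  The distance of two functions is a weighted sum over an enumeration of the arguments; it is small as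
  soon as all coordinates are close.
\<close>

lemma dist_fun_less:
  fixes e :: real
  assumes "0 < e"
  obtains d where "0 < d" "\<And>x y :: 'v::countable \<Rightarrow> real. (\<And>v. \<bar>x v - y v\<bar> < d) \<Longrightarrow> dist x y < e"
proof -
  obtain N where N: "(1/2::real) ^ N < e / 2"
    using assms real_arch_pow_inv[of "e/2" "1/2"] by auto
  have "dist x y < e" if "\<And>v. \<bar>x v - y v\<bar> < e / 4" for x y :: "'v \<Rightarrow> real"
  proof -
    let ?D = "{dist (x (from_nat n)) (y (from_nat n)) |n. n \<le> N}"
    have "?D = (\<lambda>n. dist (x (from_nat n)) (y (from_nat n))) ` {..N}" by auto
    then have "Max ?D < e / 4"
      using that by (subst Max_less_iff) (auto simp: dist_real_def)
    then show ?thesis using dist_fun_le_dist_first_terms[of x y N] N by linarith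
  qed
  then show ?thesis using that[of "e / 4"] assms by simp
qed

text \<open>
  The coherence neighbourhoods form an open cover of a compact space; \<open>d\<close> is a Lebesgue number of it
  for the distance of coordinates.
\<close>

lemma coherent_lebesgue:
  fixes K :: "'v::countable set set"
  assumes "finite K" and "\<And>S. S \<in> K \<Longrightarrow> finite S"
    and "\<And>S T. S \<in> K \<Longrightarrow> T \<subseteq> S \<Longrightarrow> T \<noteq> {} \<Longrightarrow> T \<in> K"
    and "coherent (realization K) lab"
  obtains d where "0 < d"
    "\<And>A. A \<subseteq> topspace (realization K) \<Longrightarrow> (\<And>x y v. x \<in> A \<Longrightarrow> y \<in> A \<Longrightarrow> \<bar>x v - y v\<bar> < d)
      \<Longrightarrow> inj_on snd (lab ` A)"
proof -
  let ?X = "topspace (realization K)"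
  have "?X = (\<Union>T\<in>K. face_points T)"
    using assms(2,3) by (rule topspace_realization_faces)
  moreover have "compact (\<Union>T\<in>K. face_points T)"
    using compact_face_points[OF assms(2)] by (intro compact_UN[OF assms(1)] ballI)
  ultimately have comp: "compact ?X" by simp
  let ?G = "{G. open G \<and> inj_on snd (lab ` (G \<inter> ?X))}"
  have cover: "?X \<subseteq> \<Union>?G"
  proof
    fix x assume "x \<in> ?X"
    then obtain U where U: "openin (realization K) U" "x \<in> U" "inj_on snd (lab ` U)"
      using assms(4) unfolding coherent_def by blast
    obtain G where "open G" "U = G \<inter> ?X"
      using U(1) unfolding realization_def euclidean_product_topology
      by (auto simp: openin_subtopology)
    then show "x \<in> \<Union>?G" using U by auto
  qed
  obtain e where e: "0 < e" "\<And>x. x \<in> ?X \<Longrightarrow> \<exists>G\<in>?G. ball x e \<subseteq> G"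
    using Heine_Borel_lemma[OF comp cover] by auto
  obtain d where d: "0 < d" "\<And>x y :: 'v \<Rightarrow> real. (\<And>v. \<bar>x v - y v\<bar> < d) \<Longrightarrow> dist x y < e"
    using dist_fun_less[OF e(1)] by blast
  show ?thesis
  proof (rule that[OF d(1)])
    fix A assume A: "A \<subseteq> ?X" "\<And>x y v. x \<in> A \<Longrightarrow> y \<in> A \<Longrightarrow> \<bar>x v - y v\<bar> < d"
    show "inj_on snd (lab ` A)"
    proof (cases "A = {}")
      case False
      then obtain x where x: "x \<in> A" by blast
      from x A(1) have "x \<in> ?X" by blast
      from e(2)[OF this] obtain G where G: "G \<in> ?G" "ball x e \<subseteq> G" by blast
      have "A \<subseteq> G \<inter> ?X"
      proof
        fix y assume y: "y \<in> A"
        then have "dist x y < e" using A(2)[OF x y] by (intro d(2))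
        then show "y \<in> G \<inter> ?X" using G(2) A(1) y by auto
      qed
      then have "lab ` A \<subseteq> lab ` (G \<inter> ?X)" by (rule image_mono)
      then show ?thesis using G by (auto intro: inj_on_subset)
    qed simp
  qed
qed

section \<open>Mesh of iterated subdivisions\<close>

definition barycenter :: "('v \<Rightarrow> real) list \<Rightarrow> 'v \<Rightarrow> real" where
  "barycenter l v = (\<Sum>i<length l. (l ! i) v) / length l"

abbreviation refine :: "('v \<Rightarrow> real) list \<Rightarrow> (('v \<Rightarrow> real) list \<Rightarrow>\<^sub>0 int)" where
  "refine \<equiv> subdivide barycenter list_boundary length"

text \<open>
  The sets that all later barycenters stay in: closed faces confine the support of a subdivision, and
  slabs \<open>\<bar>c - x v\<bar> \<le> R\<close> control its mesh one coordinate at a time.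
\<close>

definition barycenter_closed :: "('v \<Rightarrow> real) set \<Rightarrow> bool" where
  "barycenter_closed C \<longleftrightarrow> (\<forall>l. l \<noteq> [] \<and> set l \<subseteq> C \<longrightarrow> barycenter l \<in> C)"

lemma refine_in:
  assumes "barycenter_closed C" "set l \<subseteq> C" "k \<in> terms (refine l)"
  shows "set k \<subseteq> C \<and> length k = length l"
  using keys_subdivide[of "{l. set l \<subseteq> C}" list_boundary length "\<lambda>_. C" barycenter l k]
    assms keys_list_boundary by (force simp: barycenter_closed_def)

lemma barycenter_closed_face_points:
  assumes "finite T"
  shows "barycenter_closed (face_points T)"
  unfolding barycenter_closed_def
proof (intro allI impI)
  fix l :: "('a \<Rightarrow> real) list" assume l: "l \<noteq> [] \<and> set l \<subseteq> face_points T"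
  have "l ! i \<in> face_points T" if "i < length l" for i using l that nth_mem by blast
  then have n: "0 \<le> (l ! i) v" "v \<notin> T \<Longrightarrow> (l ! i) v = 0" "(\<Sum>v\<in>T. (l ! i) v) = 1"
    if "i < length l" for i v using that by (auto simp: face_points_def)
  have "(\<Sum>v\<in>T. barycenter l v) = (\<Sum>i<length l. \<Sum>v\<in>T. (l ! i) v) / length l"
    unfolding barycenter_def sum_divide_distrib[symmetric] by (subst sum.swap) simp
  also have "\<dots> = 1" using n l by simp
  finally show "barycenter l \<in> face_points T"
    using n by (auto simp: face_points_def barycenter_def intro!: divide_nonneg_nonneg sum_nonneg)
qed

lemma barycenter_closed_slab: "barycenter_closed {x. \<bar>c - x v\<bar> \<le> R}"
  unfolding barycenter_closed_def
proof (intro allI impI CollectI)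
  fix l :: "('a \<Rightarrow> real) list" assume l: "l \<noteq> [] \<and> set l \<subseteq> {x. \<bar>c - x v\<bar> \<le> R}"
  have "\<bar>c - (l ! i) v\<bar> \<le> R" if "i < length l" for i using l that nth_mem by blast
  then have "\<bar>\<Sum>i<length l. c - (l ! i) v\<bar> \<le> real (card {..<length l}) * R"
    by (intro order_trans[OF sum_abs] sum_bounded_above) auto
  moreover have "(\<Sum>i<length l. c - (l ! i) v) = length l * (c - barycenter l v)"
    using l by (simp add: barycenter_def sum_subtractf field_simps)
  ultimately have "real (length l) * \<bar>c - barycenter l v\<bar> \<le> real (length l) * R"
    by (simp add: abs_mult)
  then show "\<bar>c - barycenter l v\<bar> \<le> R" using l by simp
qed

definition mesh_le :: "real \<Rightarrow> ('v \<Rightarrow> real) list \<Rightarrow> bool" where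
  "mesh_le r l \<longleftrightarrow> (\<forall>x\<in>set l. \<forall>y\<in>set l. \<forall>v. \<bar>x v - y v\<bar> \<le> r)"

text \<open>
  Among the differences that are averaged, the one for \<open>x\<close> itself vanishes. This gives the factor
  below one.
\<close>

lemma barycenter_near:
  assumes "mesh_le r l" "x \<in> set l"
  shows "\<bar>barycenter l v - x v\<bar> \<le> (1 - 1 / length l) * r"
proof -
  let ?n = "length l"
  obtain j where j: "j < ?n" "x = l ! j" using assms(2) by (auto simp: in_set_conv_nth)
  have "\<bar>(l ! i) v - x v\<bar> \<le> r" if "i < ?n" for i
    using assms that unfolding mesh_le_def by (meson nth_mem)
  then have "\<bar>\<Sum>i\<in>{..<?n} - {j}. (l ! i) v - x v\<bar> \<le> real (card ({..<?n} - {j})) * r"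
    by (intro order_trans[OF sum_abs] sum_bounded_above) auto
  also have "real (card ({..<?n} - {j})) = real ?n - 1" using j by simp
  also have "(\<Sum>i\<in>{..<?n} - {j}. (l ! i) v - x v) = (\<Sum>i<?n. (l ! i) v - x v)"
    using j by (subst sum.remove[of "{..<?n}" j]) auto
  also have "\<dots> = ?n * (barycenter l v - x v)"
    using j by (simp add: barycenter_def sum_subtractf field_simps)
  finally have "real ?n * \<bar>barycenter l v - x v\<bar> \<le> (real ?n - 1) * r"
    by (simp add: abs_mult)
  then have "\<bar>barycenter l v - x v\<bar> \<le> (real ?n - 1) * r / real ?n"
    using j by (subst pos_le_divide_eq) (auto simp: algebra_simps)
  also have "\<dots> = (1 - 1 / real ?n) * r"
    using j by (cases "l = []") (simp_all add: diff_divide_distrib left_diff_distrib)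
  finally show ?thesis .
qed

text \<open>
  A list in the subdivision of \<open>l\<close> is the barycenter of \<open>l\<close> followed by a list in the subdivision of a
  face of \<open>l\<close>. The latter is small by induction, and it lies in a slab around the barycenter because
  the vertices of \<open>l\<close> do.
\<close>

lemma mesh_refine:
  assumes "mesh_le r l" "length l \<le> N" "0 < N" "0 \<le> r" "k \<in> terms (refine l)"
  shows "mesh_le ((1 - 1 / N) * r) k"
  using assms(1,2,5)
proof (induction "length l" arbitrary: l k)
  case 0
  then show ?case by (simp add: subdivide_def mesh_le_def)
next
  case (Suc n)
  let ?R = "(1 - 1 / N) * r" and ?b = "barycenter l"
  have R: "0 \<le> ?R" using assms by simp
  have "refine l = prepend ?b (frag_extend refine (list_boundary l))"
    using Suc(2) keys_list_boundary by (intro subdivide_step) auto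
  with Suc.prems(3) obtain k' where k': "k' \<in> terms (frag_extend refine (list_boundary l))" "k = ?b # k'"
    by (auto elim: keys_prependE)
  obtain l' where l': "l' \<in> terms (list_boundary l)" "k' \<in> terms (refine l')"
    using k'(1) by (rule keys_frag_extendE)
  have sub: "set l' \<subseteq> set l" "length l = Suc (length l')" using keys_list_boundary[OF l'(1)] by auto
  have "mesh_le r l'" using Suc.prems(1) sub(1) by (auto simp: mesh_le_def)
  then have small: "mesh_le ?R k'" using Suc.hyps(1)[of l' k'] Suc(2) sub Suc.prems(2) l'(2) by simp
  have "\<bar>?b v - y v\<bar> \<le> ?R" if "y \<in> set k'" for y v
  proof -
    have "\<bar>?b v - x v\<bar> \<le> ?R" if "x \<in> set l'" for x
    proof -
      have "0 < real (length l)" "real (length l) \<le> real N" using Suc(2)[symmetric] Suc.prems(2) by simp_all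
      then have "1 / real N \<le> 1 / real (length l)" by (simp add: frac_le)
      then have "(1 - 1 / real (length l)) * r \<le> ?R" using assms(4) by (intro mult_right_mono) auto
      then show ?thesis using barycenter_near[OF Suc.prems(1), of x v] sub(1) that by auto
    qed
    then have "set l' \<subseteq> {x. \<bar>?b v - x v\<bar> \<le> ?R}" by blast
    then show ?thesis using refine_in[OF barycenter_closed_slab _ l'(2)] that by blast
  qed
  then show ?case using small R unfolding k'(2) mesh_le_def by (auto simp: abs_minus_commute)
qed

section \<open>Fine equivariant subdivisions\<close>

definition uniform_point :: "'v set \<Rightarrow> 'v \<Rightarrow> real" where
  "uniform_point S v = (if v \<in> S then 1 / card S else 0)"

lemma uniform_point_in: "finite S \<Longrightarrow> S \<noteq> {} \<Longrightarrow> uniform_point S \<in> face_points S"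
  by (auto simp: face_points_def uniform_point_def)

lemma uniform_point_translate:
  assumes "p > 0" "fst ` S \<subseteq> Zp p"
  shows "uniform_point (translate p e ` S) = rotate_point p e (uniform_point S)"
proof
  fix w
  have inj: "inj_on (translate p e) S"
    using inj_on_translate[OF assms(1)] by (rule inj_on_subset) (use assms in auto)
  have "w \<in> translate p e ` S \<longleftrightarrow> fst w \<in> Zp p \<and> translate p (- e) w \<in> S"
    by (rule translate_image_mem_iff[OF assms])
  then show "uniform_point (translate p e ` S) w = rotate_point p e (uniform_point S) w"
    by (simp add: uniform_point_def rotate_point_def card_image[OF inj])
qed

lemma barycenter_rotate: "barycenter (map (rotate_point p e) l) = rotate_point p e (barycenter l)"
  by (auto simp: barycenter_def rotate_point_def fun_eq_iff)

abbreviation first_subdivision :: "('e \<times> int) set \<Rightarrow> (('e \<times> int \<Rightarrow> real) list \<Rightarrow>\<^sub>0 int)" where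
  "first_subdivision \<equiv> subdivide uniform_point face_boundary card"

text \<open>
  The first subdivision turns a set of vertices into lists of points, which the other subdivisions
  refine.
\<close>

definition fine_chain :: "nat \<Rightarrow> ('e \<times> int) set \<Rightarrow> (('e \<times> int \<Rightarrow> real) list \<Rightarrow>\<^sub>0 int)" where
  "fine_chain m S = (frag_extend refine ^^ m) (first_subdivision S)"

lemma funpow_frag_extend:
  fixes f :: "'s \<Rightarrow> ('s \<Rightarrow>\<^sub>0 int)"
  shows
  "(frag_extend f ^^ m) (frag_extend g c) = frag_extend (\<lambda>x. (frag_extend f ^^ m) (g x)) c"
  by (induction m) (simp_all add: frag_extend_frag_extend)

lemma keys_face_boundary_card:
  assumes "finite S" "T \<in> terms (face_boundary S)"
  shows "T \<subseteq> S \<and> card S = Suc (card T)"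
  using keys_face_boundary[OF assms] assms(1) by (metis Diff_subset card.remove)

lemma boundary_fine_chain:
  assumes "finite S" "inj_on snd S"
  shows "frag_extend list_boundary (fine_chain m S) = frag_extend (fine_chain m) (face_boundary S)"
proof -
  have refine: "frag_extend list_boundary (frag_extend refine c) = frag_extend refine (frag_extend list_boundary c)"
    for c :: "('a \<times> int \<Rightarrow> real) list \<Rightarrow>\<^sub>0 int"
    unfolding frag_extend_frag_extend
    by (intro frag_extend_eq boundary_subdivide[of UNIV])
      (auto simp: list_boundary_boundary dest: keys_list_boundary)
  have "frag_extend list_boundary (first_subdivision S) = frag_extend first_subdivision (face_boundary S)"
  proof (rule boundary_subdivide[of "{S. finite S \<and> inj_on snd S}"])
    fix s t :: "('a \<times> int) set"
    assume "s \<in> {S. finite S \<and> inj_on snd S}" "t \<in> terms (face_boundary s)"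
    then show "t \<in> {S. finite S \<and> inj_on snd S} \<and> card s = Suc (card t)"
      using keys_face_boundary_card[of s t] by (auto intro: finite_subset inj_on_subset)
  qed (use assms face_boundary_boundary in auto)
  then have "(frag_extend refine ^^ m) (frag_extend list_boundary (first_subdivision S))
      = frag_extend (fine_chain m) (face_boundary S)"
    by (simp add: funpow_frag_extend fine_chain_def[abs_def])
  moreover have "frag_extend list_boundary ((frag_extend refine ^^ m) c)
      = (frag_extend refine ^^ m) (frag_extend list_boundary c)" for c :: "('a \<times> int \<Rightarrow> real) list \<Rightarrow>\<^sub>0 int"
    by (induction m) (simp_all add: refine)
  ultimately show ?thesis by (simp add: fine_chain_def)
qed

lemma keys_fine_chain:
  assumes "finite S" "card S \<le> N" "0 < N" "l \<in> terms (fine_chain m S)"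
  shows "set l \<subseteq> face_points S \<and> length l = card S \<and> mesh_le ((1 - 1 / N) ^ m) l"
  using assms(4) unfolding fine_chain_def
proof (induction m arbitrary: l)
  case 0
  have "set l \<subseteq> face_points S \<and> length l = card S"
  proof (rule keys_subdivide[of "{T. finite T}" face_boundary card])
    fix s t :: "('a \<times> int) set" assume "s \<in> {T. finite T}" "t \<in> terms (face_boundary s)"
    then show "t \<in> {T. finite T} \<and> card s = Suc (card t) \<and> face_points t \<subseteq> face_points s"
      using keys_face_boundary_card[of s t] face_points_mono[of t s] by (auto intro: finite_subset)
  qed (use 0 assms(1) uniform_point_in in \<open>auto simp: card_gt_0_iff\<close>)
  moreover have "\<bar>x v - y v\<bar> \<le> 1" if "x \<in> face_points S" "y \<in> face_points S" for x y v
  proof -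
    have "0 \<le> x v" "0 \<le> y v" using that unfolding face_points_def by blast+
    then show ?thesis
      using face_points_le_one[OF assms(1) that(1), of v] face_points_le_one[OF assms(1) that(2), of v] by linarith
  qed
  ultimately show ?case by (auto simp: mesh_le_def subset_iff)
next
  case (Suc m)
  then have "l \<in> terms (frag_extend refine ((frag_extend refine ^^ m) (first_subdivision S)))" by simp
  then obtain k where k: "k \<in> terms ((frag_extend refine ^^ m) (first_subdivision S))"
    "l \<in> terms (refine k)" by (rule keys_frag_extendE)
  note IH = Suc.IH[OF k(1)]
  have "0 \<le> (1 - 1 / real N) ^ m" using assms(3) by simp
  then have "mesh_le ((1 - 1 / N) * (1 - 1 / N) ^ m) l"
    using mesh_refine[of "(1 - 1 / real N) ^ m" k N l] IH k(2) assms by simp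
  then show ?case using refine_in[OF barycenter_closed_face_points[OF assms(1)] _ k(2)] IH by simp
qed

lemma fine_chain_translate:
  assumes "p > 0" "finite S" "inj_on snd S" "fst ` S \<subseteq> Zp p"
  shows "fine_chain m (translate p e ` S) = chain_image (map (rotate_point p e)) (fine_chain m S)"
proof -
  let ?h = "rotate_point p e :: (int \<times> int \<Rightarrow> real) \<Rightarrow> int \<times> int \<Rightarrow> real"
  have "first_subdivision (translate p e ` S) = chain_image (map ?h) (first_subdivision S)"
  proof (rule subdivide_map[of "{T. finite T \<and> inj_on snd T \<and> fst ` T \<subseteq> Zp p}"])
    fix s t :: "(int \<times> int) set"
    assume s: "s \<in> {T. finite T \<and> inj_on snd T \<and> fst ` T \<subseteq> Zp p}"
    then have inj: "inj_on (translate p e) s"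
      by (intro inj_on_subset[OF inj_on_translate[OF assms(1)]]) auto
    show "card (translate p e ` s) = card s" by (rule card_image[OF inj])
    show "face_boundary (translate p e ` s) = chain_image ((`) (translate p e)) (face_boundary s)"
      using face_boundary_image[OF inj] s by simp
    show "uniform_point (translate p e ` s) = ?h (uniform_point s)"
      using s by (intro uniform_point_translate[OF assms(1)]) blast
    assume "t \<in> terms (face_boundary s)"
    then show "t \<in> {T. finite T \<and> inj_on snd T \<and> fst ` T \<subseteq> Zp p} \<and> card s = Suc (card t)"
      using keys_face_boundary_card[of s t] s by (auto intro: finite_subset inj_on_subset)
  qed (use assms in auto)
  moreover have "frag_extend refine (chain_image (map ?h) c) = chain_image (map ?h) (frag_extend refine c)" for c
    unfolding frag_extend_frag_extend frag_extend_of
    by (intro frag_extend_eq subdivide_map[of UNIV])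
      (auto simp: barycenter_rotate list_boundary_map dest: keys_list_boundary)
  then have "(frag_extend refine ^^ m) (chain_image (map ?h) c) = chain_image (map ?h) ((frag_extend refine ^^ m) c)" for c
    by (induction m) simp_all
  ultimately show ?thesis by (simp add: fine_chain_def)
qed

lemma fine_chain_empty [simp]: "fine_chain m {} = frag_of []"
  unfolding fine_chain_def by (induction m) (simp_all add: subdivide_def)

section \<open>Dold's theorem for labellings\<close>

definition top_element :: "('e \<times> int) set \<Rightarrow> 'e \<times> int" where
  "top_element S = (THE x. x \<in> S \<and> (\<forall>y\<in>S. snd y \<le> snd x))"

lemma top_element:
  assumes "finite S" "S \<noteq> {}" "inj_on snd S"
  shows "top_element S \<in> S" "\<And>y. y \<in> S \<Longrightarrow> snd y \<le> snd (top_element S)"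
    and "\<And>x. x \<in> S \<Longrightarrow> (\<And>y. y \<in> S \<Longrightarrow> snd y \<le> snd x) \<Longrightarrow> top_element S = x"
proof -
  have "Max (snd ` S) \<in> snd ` S" using assms by simp
  then obtain x where x: "x \<in> S" "snd x = Max (snd ` S)" by auto
  have "\<exists>!x. x \<in> S \<and> (\<forall>y\<in>S. snd y \<le> snd x)"
  proof (rule ex1I[of _ x])
    show "x \<in> S \<and> (\<forall>y\<in>S. snd y \<le> snd x)" using x assms by simp
    fix z assume "z \<in> S \<and> (\<forall>y\<in>S. snd y \<le> snd z)"
    then show "z = x" using x assms by (metis Max_ge antisym finite_imageI image_eqI inj_onD)
  qed
  from theI'[OF this] this
  show "top_element S \<in> S" "\<And>y. y \<in> S \<Longrightarrow> snd y \<le> snd (top_element S)"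
    "\<And>x. x \<in> S \<Longrightarrow> (\<And>y. y \<in> S \<Longrightarrow> snd y \<le> snd x) \<Longrightarrow> top_element S = x"
    unfolding top_element_def by blast+
qed

lemma top_element_translate:
  assumes "finite S" "S \<noteq> {}" "inj_on snd S"
  shows "top_element (translate p e ` S) = translate p e (top_element S)"
proof -
  have "inj_on snd (translate p e ` S)"
    by (rule inj_on_snd_translate[OF assms(3)])
  then show ?thesis
  proof (rule top_element(3)[rotated 2])
    fix y assume "y \<in> translate p e ` S"
    then obtain x where "x \<in> S" "snd y = snd x" by auto
    then show "snd y \<le> snd (translate p e (top_element S))" using top_element(2)[OF assms] by simp
  qed (use top_element(1)[OF assms] assms in auto)
qed

text \<open>
  A nontrivial translate of a simplex with distinct levels has another colour at its top vertex. Hence the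
  simplices with a given colour at the top are a transversal of the orbits, and the sum splits
  into \<open>p\<close> equal parts.
\<close>

lemma dvd_sum_invariant:
  fixes h :: "(int \<times> int) set \<Rightarrow> int"
  assumes "p > 0" "finite D"
    and D: "\<And>S. S \<in> D \<Longrightarrow> finite S \<and> S \<noteq> {} \<and> inj_on snd S \<and> fst ` S \<subseteq> Zp p"
    and closed: "\<And>S e. S \<in> D \<Longrightarrow> translate p e ` S \<in> D"
    and inv: "\<And>S e. S \<in> D \<Longrightarrow> h (translate p e ` S) = h S"
  shows "int p dvd (\<Sum>S\<in>D. h S)"
proof -
  let ?s = "\<lambda>S. fst (top_element S)"
  have s: "?s S \<in> Zp p" if "S \<in> D" for S using top_element(1) D[OF that] by blast
  have img: "translate p (- e) ` translate p e ` S = S" "translate p e ` translate p (- e) ` S = S"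
    if "S \<in> D" for S e
  proof -
    have "fst ` S \<subseteq> Zp p" using D[OF that] by blast
    then show "translate p (- e) ` translate p e ` S = S" "translate p e ` translate p (- e) ` S = S"
      by (rule translate_image_inverse[OF assms(1)])+
  qed
  have "(\<Sum>S\<in>{S\<in>D. ?s S = e}. h S) = (\<Sum>S\<in>{S\<in>D. ?s S = 0}. h S)" if "e \<in> Zp p" for e
  proof (rule sum.reindex_bij_witness[where j = "image (translate p (- e))" and i = "image (translate p e)"])
    fix S assume S: "S \<in> {S \<in> D. ?s S = e}"
    show "translate p (- e) ` S \<in> {S \<in> D. ?s S = 0}"
      using S closed[of S "- e"] D[of S] top_element_translate[of S p "- e"] by (simp add: fst_translate)
  next
    fix S assume S: "S \<in> {S \<in> D. ?s S = 0}"
    show "translate p e ` S \<in> {S \<in> D. ?s S = e}"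
      using S closed[of S e] D[of S] top_element_translate[of S p e] that by (simp add: fst_translate mem_Zp[OF assms(1)])
  next
    fix S assume "S \<in> {S \<in> D. ?s S = e}"
    then show "translate p e ` translate p (- e) ` S = S" "h (translate p (- e) ` S) = h S"
      using img(2)[of S e] inv[of S "- e"] by simp_all
  next
    fix S assume "S \<in> {S \<in> D. ?s S = 0}"
    then show "translate p (- e) ` translate p e ` S = S" using img(1)[of S e] by simp
  qed
  then have "(\<Sum>e\<in>Zp p. \<Sum>S\<in>{S\<in>D. ?s S = e}. h S) = (\<Sum>e\<in>Zp p. \<Sum>S\<in>{S\<in>D. ?s S = 0}. h S)"
    by (rule sum.cong[OF refl])
  also have "\<dots> = int p * (\<Sum>S\<in>{S\<in>D. ?s S = 0}. h S)"
    by (simp add: card_Zp[OF assms(1)])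
  finally have "(\<Sum>e\<in>Zp p. \<Sum>S\<in>{S\<in>D. ?s S = e}. h S) = int p * (\<Sum>S\<in>{S\<in>D. ?s S = 0}. h S)" .
  moreover have "?s ` D \<subseteq> Zp p" using s by (rule image_subsetI)
  from sum.group[where h = h and g = ?s, OF assms(2) finite_Zp[OF assms(1)] this]
  have "(\<Sum>e\<in>Zp p. \<Sum>S\<in>{S\<in>D. ?s S = e}. h S) = (\<Sum>S\<in>D. h S)" .
  ultimately have "(\<Sum>S\<in>D. h S) = int p * (\<Sum>S\<in>{S\<in>D. ?s S = 0}. h S)" by (rule trans[OF sym, rotated])
  then show ?thesis by (rule dvdI)
qed

text \<open>
  Dold's theorem for joins of the cyclic group (the theorem of Borsuk and Ulam if \<open>p = 2\<close>), for
  labellings instead of continuous maps. A fine subdivision followed by the labelling is a chain map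
  \<open>F\<close>. It is considered on the cone with apex \<open>v\<close> over the simplices with levels \<open>1, \<dots>, n\<close>. Its
  values do not involve \<open>v\<close>, and it commutes with translations of the simplices without \<open>v\<close>. Its alternating trace is zero since the cone is
  contractible. On the other hand the empty simplex contributes \<open>1\<close>, and the contributions of the
  nonempty simplices add up to a multiple of \<open>p\<close>.
\<close>

theorem no_coherent_labelling:
  fixes lab :: "(int \<times> int \<Rightarrow> real) \<Rightarrow> int \<times> int"
  assumes p: "p \<ge> 2"
    and range: "\<And>x. x \<in> topspace (realization (EZp p (int n))) \<Longrightarrow> lab x \<in> Zp p \<times> {1..int n}"
    and equi: "equivariant_on p (topspace (realization (EZp p (int n))))
      (\<lambda>e. realization_map (translate p e)) (translate p) lab"
    and coh: "coherent (realization (EZp p (int n))) lab"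
  shows False
proof -
  let ?E = "EZp p (int n)" let ?X = "topspace (realization ?E)"
  have p0: "p > 0" using p by simp
  obtain d where d: "0 < d"
    "\<And>A. A \<subseteq> ?X \<Longrightarrow> (\<And>x y v. x \<in> A \<Longrightarrow> y \<in> A \<Longrightarrow> \<bar>x v - y v\<bar> < d) \<Longrightarrow> inj_on snd (lab ` A)"
  proof (rule coherent_lebesgue[OF finite_EZp[OF p0, of "int n"] _ _ coh])
    show "finite S" if "S \<in> ?E" for S using finite_EZp_simplex[OF p0 that] .
    show "T \<in> ?E" if "S \<in> ?E" "T \<subseteq> S" "T \<noteq> {}" for S T using EZp_face that .
  qed (use that in blast)
  let ?N = "Suc n"
  \<comment> \<open>\<open>m\<close> subdivisions make the mesh smaller than the Lebesgue number.\<close>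
  obtain m where m: "(1 - 1 / real ?N) ^ m < d"
    using real_arch_pow_inv[OF d(1), of "1 - 1 / real ?N"] by auto
  \<comment> \<open>The set \<open>D\<close> is the cone with apex \<open>v\<close> over \<open>A\<close>; both contain the empty simplex.\<close>
  define v where "v = (0 :: int, int n + 1)"
  define A where "A = {S. S \<subseteq> Zp p \<times> {1..int n} \<and> inj_on snd S}"
  define D where "D = {S. S \<subseteq> insert v (Zp p \<times> {1..int n}) \<and> inj_on snd S}"
  define F where "F S = frag_extend (\<lambda>l. orient (map lab l)) (fine_chain m S)" for S
  let ?t = "\<lambda>S. (-1) ^ card S * Poly_Mapping.lookup (F S) S"
  have fin: "finite (insert v (Zp p \<times> {1..int n}))" using finite_Zp[OF p0] by simp
  then have finD: "finite D" by (auto intro: finite_subset[of _ "Pow (insert v (Zp p \<times> {1..int n}))"] simp: D_def)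
  have AD: "A \<subseteq> D" by (auto simp: A_def D_def)
  have v0: "0 \<in> Zp p" using p0 by (simp add: mem_Zp)
  have vA: "v \<notin> S" if "S \<in> A" for S using that by (auto simp: A_def v_def)
  have finS: "finite S" if "S \<in> D" for S using that fin by (auto simp: D_def intro: finite_subset)
  have insD: "inj_on snd (insert v S)" "insert v S \<in> D" if "S \<in> D" for S
    using that by (force simp: D_def v_def inj_on_def)+
  have DE: "S \<in> ?E" if "S \<in> D" "S \<noteq> {}" for S
    using that v0 by (force simp: D_def EZp_def v_def)
  have points: "face_points S \<subseteq> ?X" if "S \<in> D" for S
  proof (cases "S = {}")
    case False
    have "?X = (\<Union>T\<in>?E. face_points T)"
    proof (rule topspace_realization_faces)
      show "finite S" if "S \<in> ?E" for S using finite_EZp_simplex[OF p0 that] .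
      show "T \<in> ?E" if "S \<in> ?E" "T \<subseteq> S" "T \<noteq> {}" for S T using EZp_face that .
    qed
    then show ?thesis using DE[OF that False] by blast
  qed (auto simp: face_points_def)
  have card_le: "card S \<le> ?N" if "S \<in> D" for S
  proof -
    have "card S = card (snd ` S)" using that by (auto simp: D_def card_image)
    also have "\<dots> \<le> card {1..int n + 1}" using that by (intro card_mono) (auto simp: D_def v_def)
    finally show ?thesis by simp
  qed
  have key: "set l \<subseteq> ?X \<and> length l = card S \<and> inj_on snd (set (map lab l))"
    if S: "S \<in> D" and l: "l \<in> terms (fine_chain m S)" for S l
  proof -
    note k = keys_fine_chain[OF finS[OF S] card_le[OF S] _ l]
    have "set l \<subseteq> ?X" using k points[OF S] by auto
    moreover have "inj_on snd (lab ` set l)"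
    proof (rule d(2)[OF calculation])
      fix x y v assume "x \<in> set l" "y \<in> set l"
      then have "\<bar>x v - y v\<bar> \<le> (1 - 1 / real ?N) ^ m" using k unfolding mesh_le_def by blast
      then show "\<bar>x v - y v\<bar> < d" using m by linarith
    qed
    ultimately show ?thesis using k by simp
  qed
  have FA: "T \<in> A \<and> card T = card S" if S: "S \<in> D" and T: "T \<in> terms (F S)" for S T
  proof -
    obtain l where l: "l \<in> terms (fine_chain m S)" "T \<in> terms (orient (map lab l))"
      using T unfolding F_def by (rule keys_frag_extendE)
    then have "T = lab ` set l" "card T = length l" using keys_orient by force+
    moreover have "lab ` set l \<subseteq> Zp p \<times> {1..int n}"
      using key[OF S l(1)] range by (intro image_subsetI) blast
    ultimately show ?thesis using key[OF S l(1)] by (simp add: A_def)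
  qed
  have "(\<Sum>S\<in>D. ?t S) = 0"
  proof (rule supertrace_cone[OF finD])
    fix S assume S: "S \<in> D"
    show "finite S \<and> inj_on snd (insert v S)" "insert v S \<in> D" using finS insD S by auto
    show "S - {y} \<in> D" for y using S by (auto simp: D_def inj_on_def)
    show "T \<in> D \<and> card T = card S" if "T \<in> terms (F S)" for T using FA[OF S that] AD by blast
    have "frag_extend face_boundary (F S)
      = frag_extend (\<lambda>l. frag_extend orient (list_boundary (map lab l))) (fine_chain m S)"
      unfolding F_def frag_extend_frag_extend
      using key[OF S] by (intro frag_extend_eq face_boundary_orient) blast
    also have "\<dots> = frag_extend (\<lambda>l. orient (map lab l)) (frag_extend list_boundary (fine_chain m S))"
      by (simp add: list_boundary_map frag_extend_frag_extend)
    also have "\<dots> = frag_extend F (face_boundary S)"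
      using S finS[OF S] by (simp add: boundary_fine_chain D_def frag_extend_frag_extend F_def[abs_def])
    finally show "frag_extend face_boundary (F S) = frag_extend F (face_boundary S)" .
  qed
  also have "(\<Sum>S\<in>D. ?t S) = (\<Sum>S\<in>A. ?t S)"
    using FA finD AD by (intro sum.mono_neutral_right) (auto simp: in_keys_iff)
  also have "\<dots> = 1 + (\<Sum>S\<in>A - {{}}. ?t S)"
  proof -
    have "{} \<in> A" "finite A" using finite_subset[OF AD finD] by (auto simp: A_def)
    then show ?thesis by (simp add: sum.remove F_def)
  qed
  finally have trace: "(\<Sum>S\<in>A - {{}}. ?t S) = -1"
    by linarith
  \<comment> \<open>The action is free on nonempty simplices, and \<open>F\<close> commutes with it.\<close>
  have "int p dvd (\<Sum>S\<in>A - {{}}. ?t S)"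
  proof (rule dvd_sum_invariant[OF p0])
    show "finite (A - {{}})" using finite_subset[OF AD finD] by simp
    fix S assume S: "S \<in> A - {{}}"
    have SD: "S \<in> D" using S AD by blast
    have sub: "fst ` S \<subseteq> Zp p" using S by (auto simp: A_def)
    show "finite S \<and> S \<noteq> {} \<and> inj_on snd S \<and> fst ` S \<subseteq> Zp p"
      using S finS[OF SD] sub by (auto simp: A_def)
    fix e
    have inj: "inj_on (translate p e) U" if "fst ` U \<subseteq> Zp p" for U :: "(int \<times> int) set"
      using that by (intro inj_on_subset[OF inj_on_translate[OF p0]]) auto
    have cl: "translate p e ` T \<in> A" if "T \<in> A" for T
    proof -
      have "translate p e x \<in> Zp p \<times> {1..int n}" if "x \<in> T" for x
        using \<open>T \<in> A\<close> that translate_in[OF p0, of e x] by (auto simp: A_def mem_Times_iff)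
      then have "translate p e ` T \<subseteq> Zp p \<times> {1..int n}" by (rule image_subsetI)
      moreover have "inj_on snd (translate p e ` T)" using that by (auto simp: A_def inj_on_def)
      ultimately show ?thesis by (simp add: A_def)
    qed
    then show "translate p e ` S \<in> A - {{}}" using S by auto
    have "F (translate p e ` S) = frag_extend (\<lambda>l. orient (map lab (map (rotate_point p e) l))) (fine_chain m S)"
      using fine_chain_translate[OF p0 finS[OF SD] _ sub] S
      by (simp add: F_def frag_extend_frag_extend A_def)
    also have "\<dots> = frag_extend (\<lambda>l. chain_image (image (translate p e)) (orient (map lab l))) (fine_chain m S)"
    proof (rule frag_extend_eq)
      fix l assume l: "l \<in> terms (fine_chain m S)"
      have "lab (rotate_point p e x) = translate p e (lab x)" if "x \<in> set l" for x
      proof -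
        have x: "x \<in> ?X" using key[OF SD l] that by blast
        have "rotate_point p e x = rotate_point p (e mod int p) x"
          by (rule ext) (simp add: rotate_point_def translate_def mod_simps)
        also have "\<dots> = realization_map (translate p (e mod int p)) x"
          using x by (intro realization_map_translate[symmetric] p0) (auto simp: topspace_realization EZp_def)
        finally have "lab (rotate_point p e x) = lab (realization_map (translate p (e mod int p)) x)" by simp
        also have "\<dots> = translate p (e mod int p) (lab x)"
        proof -
          have "e mod int p \<in> Zp p" using p0 by (simp add: mem_Zp)
          then show ?thesis using equi x unfolding equivariant_on_def by blast
        qed
        finally show ?thesis by simp
      qed
      then have "map lab (map (rotate_point p e) l) = map (translate p e) (map lab l)" by simp
      moreover have "fst ` set (map lab l) \<subseteq> Zp p" using key[OF SD l] range by fastforce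
      ultimately show "orient (map lab (map (rotate_point p e) l)) = chain_image (image (translate p e)) (orient (map lab l))"
        using inj by (metis orient_map snd_translate)
    qed
    also have "\<dots> = chain_image (image (translate p e)) (F S)"
      by (simp add: F_def frag_extend_frag_extend)
    finally have "Poly_Mapping.lookup (F (translate p e ` S)) (translate p e ` S) = Poly_Mapping.lookup (F S) S"
    proof (simp, intro lookup_chain_image_inj[where D = A])
      show "inj_on (image (translate p e)) A"
      proof (rule inj_onI)
        fix S T assume "S \<in> A" "T \<in> A" "translate p e ` S = translate p e ` T"
        moreover from this have "fst ` (S \<union> T) \<subseteq> Zp p" by (auto simp: A_def)
        ultimately show "S = T" using inj_on_image_eq_iff[OF inj[of "S \<union> T"], of S T] by blast
      qed
    qed (use FA[OF SD] S in auto)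
    moreover have "card (translate p e ` S) = card S" using card_image[OF inj[OF sub]] .
    ultimately show "?t (translate p e ` S) = ?t S" by simp
  qed
  then have "int p dvd -1" unfolding trace .
  then show False using p by simp
qed

section \<open>Labellings from continuous maps\<close>

lemma continuous_map_realization_coordinate:
  "continuous_map (realization K) euclideanreal (\<lambda>x. x v)"
  unfolding realization_def by (intro continuous_map_from_subtopology continuous_map_product_projection) simp

lemma continuous_map_into_realization:
  "continuous_map X (realization K) f \<longleftrightarrow>
    (\<forall>v. continuous_map X euclideanreal (\<lambda>x. f x v)) \<and> f ` topspace X \<subseteq> topspace (realization K)"
  unfolding topspace_realization
  by (simp add: realization_def continuous_map_in_subtopology continuous_map_componentwise_UNIV image_subset_iff_funcset)

lemma openin_less:
  assumes "continuous_map X euclideanreal f" "continuous_map X euclideanreal g"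
  shows "openin X {x \<in> topspace X. f x < g x}"
proof -
  have "continuous_map X euclideanreal (\<lambda>x. g x - f x)"
    by (intro continuous_map_diff assms)
  from openin_continuous_map_preimage[OF this, of "{0<..}"] show ?thesis
    by simp
qed

text \<open>
  Let \<open>f x w0\<close> be positive. An index \<open>w\<close> with \<open>f x w \<le> 0\<close> stays below \<open>w0\<close> in a neighbourhood of \<open>x\<close>,
  so it is not maximal at any point there.
\<close>

lemma dominant_nearby:
  fixes f :: "'x \<Rightarrow> 'w \<Rightarrow> real"
  assumes "finite W" "\<And>w. w \<in> W \<Longrightarrow> continuous_map X euclideanreal (\<lambda>x. f x w)"
    and "x \<in> topspace X" "\<exists>w\<in>W. 0 < f x w"
  obtains U where "openin X U" "x \<in> U"
    "\<And>y w. y \<in> U \<Longrightarrow> w \<in> W \<Longrightarrow> (\<And>w'. w' \<in> W \<Longrightarrow> f y w' \<le> f y w) \<Longrightarrow> 0 < f x w"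
proof -
  obtain w0 where w0: "w0 \<in> W" "0 < f x w0" using assms(4) by blast
  let ?I = "{w \<in> W. f x w \<le> 0}"
  let ?U = "(\<Inter>w\<in>?I. {y \<in> topspace X. f y w < f y w0}) \<inter> topspace X"
  show ?thesis
  proof (rule that[of ?U])
    show "openin X ?U" using assms(1,2) w0 by (intro openin_INT openin_less) auto
    show "x \<in> ?U" using assms(3) w0 by auto
    fix y w assume y: "y \<in> ?U" "w \<in> W" "\<And>w'. w' \<in> W \<Longrightarrow> f y w' \<le> f y w"
    show "0 < f x w"
    proof (rule ccontr)
      assume "\<not> 0 < f x w"
      then have "f y w < f y w0" using y by auto
      then show False using y(3)[OF w0(1)] by simp
    qed
  qed
qed

definition dominant :: "('v \<Rightarrow> real) \<Rightarrow> 'v set" where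
  "dominant y = {w. 0 < y w \<and> (\<forall>w'. y w' \<le> y w)}"

text \<open>
  The vertices with the largest coordinate form a simplex; picking the one of highest level is an
  equivariant choice.
\<close>

definition point_label :: "('e \<times> int \<Rightarrow> real) \<Rightarrow> 'e \<times> int" where
  "point_label y = top_element (dominant y)"

lemma dominant_EZp:
  assumes "p > 0" "y \<in> topspace (realization (EZp p m))"
  shows "finite (dominant y) \<and> dominant y \<noteq> {} \<and> inj_on snd (dominant y) \<and> dominant y \<subseteq> {w. y w \<noteq> 0}"
proof -
  have y: "\<forall>v. 0 \<le> y v" "{v. y v \<noteq> 0} \<in> EZp p m" using assms by (auto simp: topspace_realization)
  let ?S = "{v. y v \<noteq> 0}"
  have S: "finite ?S" "?S \<noteq> {}" "inj_on snd ?S"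
    using finite_EZp_simplex[OF assms(1) y(2)] y(2) by (simp_all add: EZp_def)
  have sub: "dominant y \<subseteq> ?S" unfolding dominant_def by auto
  obtain w where w: "w \<in> ?S" "y w = Max (y ` ?S)"
  proof -
    have "Max (y ` ?S) \<in> y ` ?S" using S(1,2) by (intro Max_in) simp_all
    then show ?thesis using that by (metis (no_types, lifting) imageE)
  qed
  have "y w' \<le> y w" for w'
  proof (cases "w' \<in> ?S")
    case True
    then show ?thesis using w S by simp
  next
    case False
    then show ?thesis using y(1) by (metis (mono_tags, lifting) mem_Collect_eq)
  qed
  moreover have "0 < y w" using w(1) y(1) by (metis (mono_tags, lifting) mem_Collect_eq order_le_less)
  ultimately have "w \<in> dominant y" unfolding dominant_def by blast
  then show ?thesis using S sub by (auto intro: finite_subset inj_on_subset)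
qed

lemma point_label_dominant:
  assumes "p > 0" "y \<in> topspace (realization (EZp p m))"
  shows "point_label y \<in> dominant y"
  unfolding point_label_def using dominant_EZp[OF assms] by (intro top_element(1)) auto

lemma point_label_range:
  assumes "p > 0" "y \<in> topspace (realization (EZp p m))"
  shows "point_label y \<in> Zp p \<times> {1..m + 1}"
proof -
  have "point_label y \<in> {v. y v \<noteq> 0}" using point_label_dominant[OF assms] dominant_EZp[OF assms] by blast
  moreover have "{v. y v \<noteq> 0} \<in> EZp p m" using assms by (simp add: topspace_realization)
  ultimately show ?thesis unfolding EZp_def by blast
qed

lemma support_in_Zp:
  assumes "x \<in> topspace (realization K)" "\<And>S. S \<in> K \<Longrightarrow> fst ` S \<subseteq> Zp p" "x v \<noteq> 0"
  shows "fst v \<in> Zp p"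
  using assms by (auto simp: topspace_realization simp del: split_paired_All)

lemma EZp_fst: "S \<in> EZp p n \<Longrightarrow> fst ` S \<subseteq> Zp p"
  by (auto simp: EZp_def)

lemma point_label_rotate:
  assumes "p > 0" "y \<in> topspace (realization (EZp p m))"
  shows "point_label (rotate_point p e y) = translate p e (point_label y)"
proof -
  have supp: "fst v \<in> Zp p" if "y v \<noteq> 0" for v
    by (rule support_in_Zp[OF assms(2) EZp_fst that])
  have y0: "0 \<le> y v" for v using assms(2) unfolding topspace_realization by blast
  have "dominant (rotate_point p e y) = translate p e ` dominant y"
  proof (rule Set.set_eqI)
    fix w
    have D: "fst ` dominant y \<subseteq> Zp p" using supp dominant_EZp[OF assms] by blast
    show "w \<in> dominant (rotate_point p e y) \<longleftrightarrow> w \<in> translate p e ` dominant y"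
    proof (cases "fst w \<in> Zp p")
      case True
      have "(\<forall>w'. rotate_point p e y w' \<le> y (translate p (- e) w)) \<longleftrightarrow> (\<forall>v. y v \<le> y (translate p (- e) w))"
      proof (intro iffI allI)
        fix v assume *: "\<forall>w'. rotate_point p e y w' \<le> y (translate p (- e) w)"
        show "y v \<le> y (translate p (- e) w)"
          using spec[OF *, of "translate p e v"] rotate_point_translate[OF assms(1), of v e y] supp[of v] y0
          by (cases "y v = 0") auto
      next
        fix w' assume *: "\<forall>v. y v \<le> y (translate p (- e) w)"
        show "rotate_point p e y w' \<le> y (translate p (- e) w)"
          using spec[OF *, of "translate p (- e) w'"] y0 by (simp add: rotate_point_def del: split_paired_All)
      qed
      moreover have "rotate_point p e y w = y (translate p (- e) w)" using True by (simp add: rotate_point_def)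
      ultimately show ?thesis
        using True unfolding translate_image_mem_iff[OF assms(1) D] unfolding dominant_def by simp
    next
      case False
      then show ?thesis unfolding translate_image_mem_iff[OF assms(1) D] unfolding dominant_def
        by (simp add: rotate_point_def)
    qed
  qed
  then show ?thesis
    unfolding point_label_def using dominant_EZp[OF assms] top_element_translate by metis
qed

text \<open>
  By \<open>dominant_nearby\<close>, labels near \<open>x\<close> belong to the support of \<open>f x\<close>, which is a simplex
  of \<open>EZp p m\<close>.
\<close>

lemma coherent_point_label:
  assumes "p > 0" "continuous_map X (realization (EZp p m)) f"
  shows "coherent X (\<lambda>x. point_label (f x))"
  unfolding coherent_def
proof
  fix x assume x: "x \<in> topspace X"
  let ?W = "Zp p \<times> {1..m + 1}"
  have f: "\<And>v. continuous_map X euclideanreal (\<lambda>x. f x v)"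
    and fX: "\<And>x. x \<in> topspace X \<Longrightarrow> f x \<in> topspace (realization (EZp p m))"
    using assms(2) unfolding continuous_map_into_realization by blast+
  have dom: "point_label (f y) \<in> ?W \<and> (\<forall>w. f y w \<le> f y (point_label (f y))) \<and> 0 < f y (point_label (f y))"
    if "y \<in> topspace X" for y
    using point_label_range[OF assms(1) fX[OF that]] point_label_dominant[OF assms(1) fX[OF that]]
    unfolding dominant_def by blast
  have ex: "\<exists>w\<in>?W. 0 < f x w" using dom[OF x] by (intro bexI[of _ "point_label (f x)"]) simp_all
  have fin: "finite ?W" using finite_Zp[OF assms(1)] by simp
  obtain U where U: "openin X U" "x \<in> U"
    "\<And>y w. y \<in> U \<Longrightarrow> w \<in> ?W \<Longrightarrow> (\<And>w'. w' \<in> ?W \<Longrightarrow> f y w' \<le> f y w) \<Longrightarrow> 0 < f x w"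
    using dominant_nearby[OF fin f x ex] by blast
  have "(\<lambda>x. point_label (f x)) ` U \<subseteq> {w. f x w \<noteq> 0}"
  proof (intro image_subsetI CollectI)
    fix y assume y: "y \<in> U"
    then have "y \<in> topspace X" using openin_subset[OF U(1)] by blast
    then have "0 < f x (point_label (f y))" using dom U(3)[OF y] by blast
    then show "f x (point_label (f y)) \<noteq> 0" by simp
  qed
  moreover have "inj_on snd {w. f x w \<noteq> 0}"
    using fX[OF x] unfolding topspace_realization EZp_def by blast
  ultimately have "inj_on snd ((\<lambda>x. point_label (f x)) ` U)" by (rule inj_on_subset[rotated])
  then show "\<exists>U. openin X U \<and> x \<in> U \<and> inj_on snd ((\<lambda>x. point_label (f x)) ` U)" using U by blast
qed

section \<open>Weights\<close>

text \<open>
  Up to positive factors, the weights of the faces \<open>S\<close> are the coordinates of \<open>x\<close> in the barycentric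
  subdivision: the weight is positive iff \<open>S\<close> consists of the vertices whose coordinate exceeds
  some threshold \<open>t \<ge> 0\<close>. Products and \<open>max\<close> make continuity and equivariance evident.
\<close>

definition weight :: "'v set \<Rightarrow> ('v \<Rightarrow> real) \<Rightarrow> 'v set \<Rightarrow> real" where
  "weight V x S = (\<Prod>v\<in>S. x v * (\<Prod>u\<in>V - S. max 0 (x v - x u)))"

lemma weight_nonneg: "(\<And>v. 0 \<le> x v) \<Longrightarrow> 0 \<le> weight V x S"
  unfolding weight_def by (intro prod_nonneg mult_nonneg_nonneg) auto

lemma weight_pos_iff:
  assumes "finite V" "S \<subseteq> V" "\<And>v. 0 \<le> x v"
  shows "0 < weight V x S \<longleftrightarrow> (\<forall>v\<in>S. 0 < x v \<and> (\<forall>u\<in>V - S. x u < x v))"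
proof -
  have fin: "finite S" "finite (V - S)" using assms finite_subset by auto
  have "0 < weight V x S \<longleftrightarrow> weight V x S \<noteq> 0" using weight_nonneg[of x V S] assms(3) by (simp add: less_le)
  also have "\<dots> \<longleftrightarrow> (\<forall>v\<in>S. x v \<noteq> 0 \<and> (\<forall>u\<in>V - S. max 0 (x v - x u) \<noteq> 0))"
    unfolding weight_def using fin by auto
  also have "\<dots> \<longleftrightarrow> (\<forall>v\<in>S. 0 < x v \<and> (\<forall>u\<in>V - S. x u < x v))"
  proof -
    have "x v \<noteq> 0 \<longleftrightarrow> 0 < x v" "max 0 (x v - x u) \<noteq> 0 \<longleftrightarrow> x u < x v" for u v
      using assms(3)[of v] by auto
    then show ?thesis by simp
  qed
  finally show ?thesis .
qed

lemma weight_pos_chain: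
  assumes "finite V" "S \<subseteq> V" "T \<subseteq> V" "\<And>v. 0 \<le> x v" "0 < weight V x S" "0 < weight V x T"
  shows "S \<subseteq> T \<or> T \<subseteq> S"
proof (rule ccontr)
  assume "\<not> (S \<subseteq> T \<or> T \<subseteq> S)"
  then obtain s t where st: "s \<in> S" "s \<notin> T" "t \<in> T" "t \<notin> S" by blast
  have "\<forall>u\<in>V - S. x u < x s" using assms(5) st(1) unfolding weight_pos_iff[OF assms(1,2,4)] by blast
  moreover have "\<forall>u\<in>V - T. x u < x t" using assms(6) st(3) unfolding weight_pos_iff[OF assms(1,3,4)] by blast
  ultimately have "x t < x s" "x s < x t" using st assms(2,3) by blast+
  then show False by simp
qed

text \<open>
  The support is the superlevel set for the threshold \<open>0\<close>. Thus some face has positive weight at every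
  point.
\<close>

lemma weight_support_pos:
  assumes "finite V" "{v. x v \<noteq> 0} \<subseteq> V" "\<And>v. 0 \<le> x v"
  shows "0 < weight V x {v. x v \<noteq> 0}"
  unfolding weight_pos_iff[OF assms]
proof
  fix v assume "v \<in> {v. x v \<noteq> 0}"
  then have "0 < x v" using assms(3)[of v] by simp
  then show "0 < x v \<and> (\<forall>u\<in>V - {v. x v \<noteq> 0}. x u < x v)" by simp
qed

lemma weight_image:
  assumes "inj_on g V" "g ` V = V" "S \<subseteq> V" "\<And>v. v \<in> V \<Longrightarrow> y (g v) = x v"
  shows "weight V y (g ` S) = weight V x S"
proof -
  have diff: "V - g ` S = g ` (V - S)" using assms(1,2,3) by (metis inj_on_image_set_diff order_refl Diff_subset)
  have inj: "inj_on g S" "inj_on g (V - S)" using assms(1,3) by (auto intro: inj_on_subset)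
  have in_V: "v \<in> V" if "v \<in> S" for v using that assms(3) by blast
  show ?thesis unfolding weight_def diff using inj in_V assms(4) by (simp add: prod.reindex)
qed

lemma continuous_map_weight:
  assumes "finite V" "S \<subseteq> V" "\<And>v. continuous_map X euclideanreal (\<lambda>x. f x v)"
  shows "continuous_map X euclideanreal (\<lambda>x. weight V (f x) S)"
  unfolding weight_def using assms finite_subset[OF assms(2,1)]
  by (intro continuous_map_prod continuous_map_real_mult continuous_map_real_max continuous_map_diff) auto

text \<open>
  The barycenter of a face \<open>S\<close> in \<open>P\<close> is sent to the sum of the vertices in \<open>h S\<close>, extended by means of
  the weights and normalized. \<open>P\<close> may leave out faces; the map is meaningful where some face in \<open>P\<close>
  has positive weight, and it vanishes elsewhere by the convention for division by zero.
\<close>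

definition carrier_map :: "'v set \<Rightarrow> 'v set set \<Rightarrow> ('v set \<Rightarrow> 'w set) \<Rightarrow> ('v \<Rightarrow> real) \<Rightarrow> 'w \<Rightarrow> real" where
  "carrier_map V P h x w = (\<Sum>S | S \<in> P \<and> w \<in> h S. weight V x S) / (\<Sum>S\<in>P. card (h S) * weight V x S)"

lemma carrier_map_total_pos:
  assumes "finite P" "\<And>S. S \<in> P \<Longrightarrow> finite (h S) \<and> h S \<noteq> {}" "\<And>v. 0 \<le> x v"
    and "\<exists>S\<in>P. 0 < weight V x S"
  shows "0 < (\<Sum>S\<in>P. card (h S) * weight V x S)"
proof -
  obtain S where S: "S \<in> P" "0 < weight V x S" using assms(4) by blast
  then have "0 < card (h S) * weight V x S" using assms(2)[OF S(1)] by (simp add: card_gt_0_iff)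
  moreover have nn: "0 \<le> weight V x T" for T using assms(3) by (rule weight_nonneg)
  ultimately show ?thesis using S(1) assms(1) by (intro sum_pos2[of _ S] mult_nonneg_nonneg) auto
qed

text \<open>
  The support of the image is the union of the sets \<open>h S\<close> over the faces \<open>S\<close> of positive weight. In the
  applications these faces form a chain that \<open>h\<close> sends to simplices with a common simplex as union.
\<close>

lemma carrier_map_in:
  assumes "finite P" "\<And>S. S \<in> P \<Longrightarrow> finite (h S) \<and> h S \<noteq> {}" "\<And>v. 0 \<le> x v"
    and "\<exists>S\<in>P. 0 < weight V x S"
    and "\<Union>{h S |S. S \<in> P \<and> 0 < weight V x S} \<in> L"
  shows "carrier_map V P h x \<in> topspace (realization L)"
proof -
  note pos = carrier_map_total_pos[where h = h, OF assms(1-4)]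
  have nn: "0 \<le> weight V x S" for S using weight_nonneg[OF assms(3)] .
  have num_pos: "0 < (\<Sum>S | S \<in> P \<and> w \<in> h S. weight V x S) \<longleftrightarrow> (\<exists>S\<in>P. w \<in> h S \<and> 0 < weight V x S)" for w
  proof -
    have "(\<Sum>S | S \<in> P \<and> w \<in> h S. weight V x S) = 0 \<longleftrightarrow> (\<forall>S\<in>{S. S \<in> P \<and> w \<in> h S}. weight V x S = 0)"
      using assms(1) nn by (intro sum_nonneg_eq_0_iff) auto
    moreover have "0 \<le> (\<Sum>S | S \<in> P \<and> w \<in> h S. weight V x S)" using nn by (simp add: sum_nonneg)
    ultimately show ?thesis using nn by (auto simp: less_le)
  qed
  have "carrier_map V P h x w \<noteq> 0 \<longleftrightarrow> 0 < (\<Sum>S | S \<in> P \<and> w \<in> h S. weight V x S)" for w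
    using pos sum_nonneg[of "{S. S \<in> P \<and> w \<in> h S}" "weight V x"] nn by (simp add: carrier_map_def less_le)
  then have supp: "{w. carrier_map V P h x w \<noteq> 0} = \<Union>{h S |S. S \<in> P \<and> 0 < weight V x S}"
    using num_pos by auto
  have nonneg: "\<forall>w. 0 \<le> carrier_map V P h x w"
    unfolding carrier_map_def using pos nn by (intro allI divide_nonneg_pos sum_nonneg) auto
  let ?W = "\<Union>(h ` P)"
  have finW: "finite ?W" using assms(1,2) by auto
  have "(\<Sum>w | carrier_map V P h x w \<noteq> 0. carrier_map V P h x w) = (\<Sum>w\<in>?W. carrier_map V P h x w)"
  proof (rule sum.mono_neutral_left[OF finW])
    show "{w. carrier_map V P h x w \<noteq> 0} \<subseteq> ?W" unfolding supp by auto
  qed simp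
  also have "\<dots> = (\<Sum>w\<in>?W. \<Sum>S | S \<in> P \<and> w \<in> h S. weight V x S) / (\<Sum>S\<in>P. card (h S) * weight V x S)"
    unfolding carrier_map_def by (rule sum_divide_distrib[symmetric])
  also have "(\<Sum>w\<in>?W. \<Sum>S | S \<in> P \<and> w \<in> h S. weight V x S) = (\<Sum>S\<in>P. \<Sum>w | w \<in> ?W \<and> w \<in> h S. weight V x S)"
    by (rule sum.swap_restrict[OF finW assms(1)])
  also have "\<dots> = (\<Sum>S\<in>P. card (h S) * weight V x S)"
  proof (rule sum.cong[OF refl])
    fix S assume "S \<in> P"
    then have "{w. w \<in> ?W \<and> w \<in> h S} = h S" by auto
    then show "(\<Sum>w | w \<in> ?W \<and> w \<in> h S. weight V x S) = card (h S) * weight V x S" by simp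
  qed
  finally have "(\<Sum>w | carrier_map V P h x w \<noteq> 0. carrier_map V P h x w) = 1" using pos by simp
  then show ?thesis using nonneg supp assms(5) by (simp add: topspace_realization)
qed

lemma continuous_carrier_map:
  assumes "finite V" "finite P" "\<And>S. S \<in> P \<Longrightarrow> S \<subseteq> V \<and> finite (h S) \<and> h S \<noteq> {}"
    and "\<And>x. x \<in> topspace (realization K) \<Longrightarrow> \<exists>S\<in>P. 0 < weight V x S \<Longrightarrow>
      \<Union>{h S |S. S \<in> P \<and> 0 < weight V x S} \<in> L"
  shows "continuous_map (subtopology (realization K) {x. \<exists>S\<in>P. 0 < weight V x S}) (realization L) (carrier_map V P h)"
    (is "continuous_map ?X _ _")
  unfolding continuous_map_into_realization
proof
  have nonneg: "0 \<le> x v" if "x \<in> topspace (realization K)" for x v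
    using that unfolding topspace_realization by blast
  have top: "x \<in> topspace (realization K)" "\<exists>S\<in>P. 0 < weight V x S" if "x \<in> topspace ?X" for x
    using that by auto
  have w: "continuous_map ?X euclideanreal (\<lambda>x. weight V x S)" if "S \<in> P" for S
    using assms(3)[OF that]
    by (intro continuous_map_weight[OF assms(1)] continuous_map_from_subtopology
        continuous_map_realization_coordinate) auto
  show "\<forall>w. continuous_map ?X euclideanreal (\<lambda>x. carrier_map V P h x w)"
  proof
    fix u
    show "continuous_map ?X euclideanreal (\<lambda>x. carrier_map V P h x u)"
      unfolding carrier_map_def
    proof (rule continuous_map_real_divide)
      show "continuous_map ?X euclideanreal (\<lambda>x. \<Sum>S | S \<in> P \<and> u \<in> h S. weight V x S)"
        using assms(2) w by (intro continuous_map_sum) auto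
      show "continuous_map ?X euclideanreal (\<lambda>x. \<Sum>S\<in>P. card (h S) * weight V x S)"
        using assms(2) w by (intro continuous_map_sum continuous_map_real_mult_left) auto
      fix x assume "x \<in> topspace ?X"
      note x = top[OF this]
      have "0 < (\<Sum>S\<in>P. card (h S) * weight V x S)"
        using assms(3) nonneg[OF x(1)] x(2) by (intro carrier_map_total_pos[OF assms(2)]) auto
      then show "(\<Sum>S\<in>P. card (h S) * weight V x S) \<noteq> 0" by simp
    qed
  qed
  show "carrier_map V P h ` topspace ?X \<subseteq> topspace (realization L)"
  proof (rule image_subsetI)
    fix x assume "x \<in> topspace ?X"
    note x = top[OF this]
    show "carrier_map V P h x \<in> topspace (realization L)"
      using assms(3) nonneg[OF x(1)] x(2) assms(4)[OF x] by (intro carrier_map_in[OF assms(2)]) auto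
  qed
qed

lemma weight_rotate:
  assumes "p > 0" "fst ` V \<subseteq> Zp p" "\<And>v. v \<in> V \<Longrightarrow> translate p e v \<in> V" "finite V" "S \<subseteq> V"
  shows "weight V (rotate_point p e x) (translate p e ` S) = weight V x S"
proof (rule weight_image)
  show inj: "inj_on (translate p e) V"
    using inj_on_translate[OF assms(1)] by (rule inj_on_subset) (use assms(2) in auto)
  show "translate p e ` V = V" using assms(3,4) inj by (intro endo_inj_surj) auto
  show "rotate_point p e x (translate p e v) = x v" if "v \<in> V" for v
    using that assms(2) by (intro rotate_point_translate[OF assms(1)]) auto
qed (rule assms(5))

lemma carrier_map_rotate:
  assumes "p > 0" "finite V" "fst ` V \<subseteq> Zp p" "\<And>v e. v \<in> V \<Longrightarrow> translate p e v \<in> V"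
    and P: "\<And>S. S \<in> P \<Longrightarrow> S \<subseteq> V" "\<And>S e. S \<in> P \<Longrightarrow> translate p e ` S \<in> P"
    and h: "\<And>S e. S \<in> P \<Longrightarrow> fst ` h S \<subseteq> Zp p \<and> finite (h S)"
      "\<And>S e. S \<in> P \<Longrightarrow> h (translate p e ` S) = translate p e ` h S"
  shows "carrier_map V P h (rotate_point p e x) = rotate_point p e (carrier_map V P h x)"
proof
  fix w
  let ?g = "image (translate p e)" and ?y = "rotate_point p e x"
  have inv: "?g (translate p (- e) ` S) = S" "translate p (- e) ` ?g S = S" if "S \<in> P" for S
    using translate_image_inverse[OF assms(1), of S e] P(1)[OF that] assms(3) by blast+
  have wt: "weight V ?y (?g S) = weight V x S" if "S \<in> P" for S
    using P(1)[OF that] assms by (intro weight_rotate) auto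
  have crd: "card (h (?g S)) = card (h S)" if "S \<in> P" for S
    unfolding h(2)[OF that] using h(1)[OF that]
    by (intro card_image inj_on_subset[OF inj_on_translate[OF assms(1)]]) auto
  have mem: "w \<in> h (?g S) \<longleftrightarrow> fst w \<in> Zp p \<and> translate p (- e) w \<in> h S" if "S \<in> P" for S
    unfolding h(2)[OF that] using h(1)[OF that] by (intro translate_image_mem_iff[OF assms(1)]) blast
  have den: "(\<Sum>S\<in>P. card (h S) * weight V ?y S) = (\<Sum>S\<in>P. card (h S) * weight V x S)"
    by (rule sum.reindex_bij_witness[where j = ?g and i = "image (translate p (- e))", symmetric])
      (use inv wt crd P(2) in \<open>simp_all\<close>)
  show "carrier_map V P h ?y w = rotate_point p e (carrier_map V P h x) w"
  proof (cases "fst w \<in> Zp p")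
    case True
    have "(\<Sum>S | S \<in> P \<and> w \<in> h S. weight V ?y S) = (\<Sum>S | S \<in> P \<and> translate p (- e) w \<in> h S. weight V x S)"
    proof (rule sum.reindex_bij_witness[where j = "image (translate p (- e))" and i = ?g])
      fix S assume S: "S \<in> {S. S \<in> P \<and> w \<in> h S}"
      then have S': "S \<in> P" "translate p (- e) ` S \<in> P" using P(2) by auto
      show "?g (translate p (- e) ` S) = S" using inv(1)[OF S'(1)] .
      show "translate p (- e) ` S \<in> {S. S \<in> P \<and> translate p (- e) w \<in> h S}"
        using mem[OF S'(2)] inv(1)[OF S'(1)] S S' by auto
      show "weight V x (translate p (- e) ` S) = weight V ?y S"
        using wt[OF S'(2)] inv(1)[OF S'(1)] by simp
    next
      fix S assume S: "S \<in> {S. S \<in> P \<and> translate p (- e) w \<in> h S}"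
      then show "translate p (- e) ` ?g S = S" using inv(2) by blast
      show "?g S \<in> {S. S \<in> P \<and> w \<in> h S}" using S mem P(2) True by blast
    qed
    then show ?thesis using True by (simp add: carrier_map_def rotate_point_def den)
  next
    case False
    have "w \<notin> h S" if "S \<in> P" for S using h(1)[OF that] False by blast
    then have "(\<Sum>S | S \<in> P \<and> w \<in> h S. weight V ?y S) = 0" by (intro sum.neutral) blast
    then show ?thesis using False by (simp add: carrier_map_def rotate_point_def)
  qed
qed

section \<open>Indices and order-preserving maps\<close>

text \<open>
  Both indices are least integers subject to the bound \<open>-1\<close>. The last two claims need an integer with
  the property, for otherwise \<open>LEAST\<close> is arbitrary.
\<close>

lemma Least_int:
  assumes "-1 \<le> m" "P m"
  shows "(LEAST n::int. -1 \<le> n \<and> P n) \<le> m"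
    and "-1 \<le> (LEAST n::int. -1 \<le> n \<and> P n)" and "P (LEAST n::int. -1 \<le> n \<and> P n)"
proof -
  have "P (int (nat (m + 1)) - 1)" using assms by simp
  define k where "k = (LEAST k. P (int k - 1))"
  have k: "P (int k - 1)" unfolding k_def by (rule LeastI) fact
  have le: "int k - 1 \<le> n" if "-1 \<le> n" "P n" for n
  proof -
    have "P (int (nat (n + 1)) - 1)" using that by simp
    then have "k \<le> nat (n + 1)" unfolding k_def by (rule Least_le)
    then show ?thesis using that by simp
  qed
  have "(LEAST n::int. -1 \<le> n \<and> P n) = int k - 1"
    using k le by (intro Least_equality) auto
  then show "(LEAST n::int. -1 \<le> n \<and> P n) \<le> m" "-1 \<le> (LEAST n::int. -1 \<le> n \<and> P n)"
    "P (LEAST n::int. -1 \<le> n \<and> P n)" using k le assms by auto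
qed

definition index_witness :: "nat \<Rightarrow> (int \<times> 'v) set set \<Rightarrow> int \<Rightarrow> ((int \<times> 'v \<Rightarrow> real) \<Rightarrow> (int \<times> int \<Rightarrow> real)) \<Rightarrow> bool" where
  "index_witness p K n f \<longleftrightarrow> continuous_map (realization K) (realization (EZp p n)) f \<and>
     equivariant_on p (topspace (realization K)) (\<lambda>e. realization_map (translate p e))
       (\<lambda>e. realization_map (translate p e)) f"

lemma ind_complex_alt:
  "ind_complex p K (translate p) = (LEAST n. -1 \<le> n \<and> (\<exists>f. index_witness p K n f))"
  by (simp add: ind_complex_def ind_def index_witness_def)

definition translation_closed :: "nat \<Rightarrow> (int \<times> 'v) set set \<Rightarrow> bool" where
  "translation_closed p K \<longleftrightarrow>
     (\<forall>S\<in>K. fst ` S \<subseteq> Zp p \<and> S \<noteq> {} \<and> (\<forall>e. translate p e ` S \<in> K))"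

lemma translation_closedD:
  assumes "translation_closed p K"
  shows "S \<in> K \<Longrightarrow> fst ` S \<subseteq> Zp p" "S \<in> K \<Longrightarrow> translate p e ` S \<in> K"
    and "fst ` \<Union>K \<subseteq> Zp p" "v \<in> \<Union>K \<Longrightarrow> translate p e v \<in> \<Union>K"
proof -
  show Z: "fst ` S \<subseteq> Zp p" and cl: "translate p e ` S \<in> K" if "S \<in> K" for S e
    using assms that unfolding translation_closed_def by blast+
  show "fst ` \<Union>K \<subseteq> Zp p" using Z by blast
  assume "v \<in> \<Union>K"
  then obtain S where "v \<in> S" "S \<in> K" by (rule UnionE)
  then show "translate p e v \<in> \<Union>K" using cl[of S e] by blast
qed

lemma translation_closed_EZp:
  assumes "p > 0"
  shows "translation_closed p (EZp p n)"
  unfolding translation_closed_def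
proof (intro ballI conjI allI)
  fix S e assume S: "S \<in> EZp p n"
  show "fst ` S \<subseteq> Zp p" by (rule EZp_fst[OF S])
  show "S \<noteq> {}" using S by (simp add: EZp_def)
  show "translate p e ` S \<in> EZp p n" by (rule translate_EZp[OF assms S])
qed

text \<open>
  The faces that have positive weight at a point form a chain. An order-preserving map sends it to
  vertices that are equal or on different levels, that is, to a simplex of \<open>EZp p m\<close>.
\<close>

lemma index_witness_of_poset_map:
  assumes p: "p > 0" and fin: "finite (\<Union>K)" and K: "translation_closed p K"
    and range: "\<And>S. S \<in> K \<Longrightarrow> \<phi> S \<in> Q_set p m"
    and mono: "\<And>S T. S \<in> K \<Longrightarrow> T \<in> K \<Longrightarrow> S \<subseteq> T \<Longrightarrow> Q_le (\<phi> S) (\<phi> T)"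
    and equi: "\<And>S e. S \<in> K \<Longrightarrow> \<phi> (translate p e ` S) = translate p e (\<phi> S)"
  shows "index_witness p K m (carrier_map (\<Union>K) K (\<lambda>S. {\<phi> S}))" (is "index_witness p K m ?f")
proof -
  let ?V = "\<Union>K"
  have finK: "finite K" using fin by (rule finite_UnionD)
  note VZ = translation_closedD(3)[OF K] and VT = translation_closedD(4)[OF K]
  have \<phi>Z: "fst (\<phi> S) \<in> Zp p" if "S \<in> K" for S
    using range[OF that] by (auto simp: Q_set_def)
  have pos: "\<exists>S\<in>K. 0 < weight ?V x S" if x: "x \<in> topspace (realization K)" for x
  proof -
    have "\<And>v. 0 \<le> x v" "{v. x v \<noteq> 0} \<in> K" using x unfolding topspace_realization by blast+
    then show ?thesis using weight_support_pos[OF fin, of x] by blast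
  qed
  have "continuous_map (subtopology (realization K) {x. \<exists>S\<in>K. 0 < weight ?V x S}) (realization (EZp p m)) ?f"
  proof (rule continuous_carrier_map[OF fin finK])
    show "S \<subseteq> ?V \<and> finite {\<phi> S} \<and> {\<phi> S} \<noteq> {}" if "S \<in> K" for S using that by auto
    fix x assume x: "x \<in> topspace (realization K)" "\<exists>S\<in>K. 0 < weight ?V x S"
    have x0: "0 \<le> x v" for v using x(1) unfolding topspace_realization by blast
    let ?C = "{S \<in> K. 0 < weight ?V x S}"
    have eq: "\<Union>{{\<phi> S} |S. S \<in> K \<and> 0 < weight ?V x S} = \<phi> ` ?C" by auto
    have "inj_on snd (\<phi> ` ?C)"
    proof (rule inj_onI)
      fix a b assume "a \<in> \<phi> ` ?C" "b \<in> \<phi> ` ?C" and ab: "snd a = snd b"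
      then obtain S T where ST: "a = \<phi> S" "b = \<phi> T" "S \<in> K" "T \<in> K"
        "0 < weight ?V x S" "0 < weight ?V x T" by blast
      have "S \<subseteq> ?V" "T \<subseteq> ?V" using ST(3,4) by auto
      from weight_pos_chain[OF fin this x0 ST(5,6)] have "Q_le a b \<or> Q_le b a"
        using mono[OF ST(3,4)] mono[OF ST(4,3)] unfolding ST(1,2) by blast
      then show "a = b" using ab by (auto simp: Q_le_def)
    qed
    moreover have "\<phi> ` ?C \<subseteq> Zp p \<times> {1..m + 1}"
      using range by (intro image_subsetI) (auto simp: Q_set_def)
    moreover have "\<phi> ` ?C \<noteq> {}" using x(2) by blast
    ultimately show "\<Union>{{\<phi> S} |S. S \<in> K \<and> 0 < weight ?V x S} \<in> EZp p m"
      unfolding eq EZp_def by blast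
  qed
  moreover have "subtopology (realization K) {x. \<exists>S\<in>K. 0 < weight ?V x S} = realization K"
    by (rule subtopology_superset) (use pos in blast)
  ultimately have cont: "continuous_map (realization K) (realization (EZp p m)) ?f" by simp
  have "equivariant_on p (topspace (realization K)) (\<lambda>e. realization_map (translate p e))
       (\<lambda>e. realization_map (translate p e)) ?f"
    unfolding equivariant_on_def
  proof (intro ballI)
    fix e x assume x: "x \<in> topspace (realization K)"
    have "\<And>v. x v \<noteq> 0 \<Longrightarrow> fst v \<in> Zp p"
      using support_in_Zp[OF x] K unfolding translation_closed_def by blast
    then have "realization_map (translate p e) x = rotate_point p e x"
      by (rule realization_map_translate[OF p])
    moreover have fx: "?f x \<in> topspace (realization (EZp p m))"
      using cont x unfolding continuous_map_into_realization by blast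
    have "realization_map (translate p e) (?f x) = rotate_point p e (?f x)"
      by (rule realization_map_translate[OF p support_in_Zp[OF fx EZp_fst]])
    moreover have "?f (rotate_point p e x) = rotate_point p e (?f x)"
      using VZ VT K \<phi>Z equi unfolding translation_closed_def
      by (intro carrier_map_rotate[OF p fin]) auto
    ultimately show "?f (realization_map (translate p e) x) = realization_map (translate p e) (?f x)"
      by simp
  qed
  with cont show ?thesis by (simp add: index_witness_def)
qed

section \<open>The box complex\<close>

lemma complete_partite_partite_sub:
  "complete_partite r I U (partite_sub H I U) \<longleftrightarrow>
    (\<forall>e. e \<subseteq> (\<Union>i\<in>I. U i) \<and> card e = r \<and> (\<forall>i\<in>I. card (e \<inter> U i) \<le> 1) \<longrightarrow> e \<in> edges H)"
  by (auto simp: complete_partite_def partite_sub_def)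

text \<open>
  The completeness condition of the box complex for a set \<open>S\<close> of pairs, whose parts are the sections
  of \<open>S\<close>.
\<close>

definition rainbow_complete :: "nat \<Rightarrow> nat \<Rightarrow> 'a hypergraph \<Rightarrow> (int \<times> 'a) set \<Rightarrow> bool" where
  "rainbow_complete r p H S \<longleftrightarrow>
    (\<forall>e. e \<subseteq> snd ` S \<and> card e = r \<and> (\<forall>i\<in>Zp p. card (e \<inter> S `` {i}) \<le> 1) \<longrightarrow> e \<in> edges H)"

text \<open>
  Instead of a family of parts, a simplex is a set of pairs with one colour per vertex. In this form the
  face order is inclusion, and the group acts by images.
\<close>

lemma box_complex_iff:
  "S \<in> box_complex r p H \<longleftrightarrow>
    S \<subseteq> Zp p \<times> verts H \<and> S \<noteq> {} \<and> inj_on snd S \<and> rainbow_complete r p H S"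
proof
  assume "S \<in> box_complex r p H"
  then obtain U where U: "S = Sigma (Zp p) U" "\<forall>i\<in>Zp p. U i \<subseteq> verts H" "disjoint_family_on U (Zp p)"
    "(\<Union>i\<in>Zp p. U i) \<noteq> {}" "complete_partite r (Zp p) U (partite_sub H (Zp p) U)"
    unfolding box_complex_def by blast
  have "snd ` S = (\<Union>i\<in>Zp p. U i)" unfolding U(1) by force
  moreover have "S `` {i} = U i" if "i \<in> Zp p" for i unfolding U(1) using that by auto
  ultimately have "rainbow_complete r p H S"
    using U(5) by (simp add: rainbow_complete_def complete_partite_partite_sub)
  moreover have "inj_on snd S"
    using U(3) unfolding U(1) by (auto simp: inj_on_def disjoint_family_on_def)
  ultimately show "S \<subseteq> Zp p \<times> verts H \<and> S \<noteq> {} \<and> inj_on snd S \<and> rainbow_complete r p H S"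
    using U(2,4) unfolding U(1) by auto
next
  assume S: "S \<subseteq> Zp p \<times> verts H \<and> S \<noteq> {} \<and> inj_on snd S \<and> rainbow_complete r p H S"
  let ?U = "\<lambda>i. S `` {i}"
  have "S = Sigma (Zp p) ?U" using S by auto
  moreover have un: "(\<Union>i\<in>Zp p. ?U i) = snd ` S" using S by force
  moreover have "disjoint_family_on ?U (Zp p)"
    using S by (force simp: disjoint_family_on_def inj_on_def)
  moreover have "\<forall>i\<in>Zp p. ?U i \<subseteq> verts H" using S by auto
  moreover have "complete_partite r (Zp p) ?U (partite_sub H (Zp p) ?U)"
    using S unfolding complete_partite_partite_sub un rainbow_complete_def by blast
  moreover have "snd ` S \<noteq> {}" using S by simp
  ultimately show "S \<in> box_complex r p H" unfolding box_complex_def by (intro CollectI exI[of _ ?U]) simp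
qed

lemma translate_image_section:
  assumes "p > 0" "fst ` S \<subseteq> Zp p" "i \<in> Zp p"
  shows "(translate p e ` S) `` {i} = S `` {(i - e) mod int p}"
  using translate_image_mem_iff[OF assms(1,2)] assms(3)
  by (auto simp: Image_singleton translate_def)

lemma translation_closed_box_complex:
  assumes "p > 0"
  shows "translation_closed p (box_complex r p H)"
  unfolding translation_closed_def
proof (intro ballI conjI allI)
  fix S e assume S: "S \<in> box_complex r p H"
  then have S': "S \<subseteq> Zp p \<times> verts H" "S \<noteq> {}" "inj_on snd S" "rainbow_complete r p H S"
    by (simp_all add: box_complex_iff)
  show fst: "fst ` S \<subseteq> Zp p" using S'(1) by auto
  show "S \<noteq> {}" by fact
  have "rainbow_complete r p H (translate p e ` S)"
    unfolding rainbow_complete_def snd_image_translate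
  proof (intro allI impI)
    fix A assume A: "A \<subseteq> snd ` S \<and> card A = r \<and> (\<forall>i\<in>Zp p. card (A \<inter> (translate p e ` S) `` {i}) \<le> 1)"
    have "card (A \<inter> S `` {j}) \<le> 1" if j: "j \<in> Zp p" for j
    proof -
      have "(e + j) mod int p \<in> Zp p" using assms by (simp add: mem_Zp)
      moreover have "((e + j) mod int p - e) mod int p = j" using j assms by (simp add: mod_simps mem_Zp)
      ultimately show ?thesis using A translate_image_section[OF assms fst, of "(e + j) mod int p" e] by fastforce
    qed
    then show "A \<in> edges H" using S'(4) A unfolding rainbow_complete_def by blast
  qed
  moreover have "translate p e ` S \<subseteq> Zp p \<times> verts H"
  proof (rule image_subsetI)
    fix x assume "x \<in> S"
    then have "snd x \<in> verts H" using S'(1) by auto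
    then show "translate p e x \<in> Zp p \<times> verts H"
      using translate_in[OF assms, of e x] by (simp add: mem_Times_iff)
  qed
  ultimately show "translate p e ` S \<in> box_complex r p H"
    using S' inj_on_snd_translate[of S p e] by (simp add: box_complex_iff)
qed

text \<open>
  The colour of a vertex chosen from \<open>snd ` S\<close>. This set is the same for all translates of \<open>S\<close>, so they
  choose the same vertex, and the colour is equivariant.
\<close>

definition vertex_colour :: "(int \<times> 'v) set \<Rightarrow> int" where
  "vertex_colour S = (THE i. (i, SOME v. v \<in> snd ` S) \<in> S)"

lemma vertex_colour_eq:
  assumes "inj_on snd S" "(i, SOME v. v \<in> snd ` S) \<in> S"
  shows "vertex_colour S = i"
  unfolding vertex_colour_def
proof (rule the_equality)
  fix j assume "(j, SOME v. v \<in> snd ` S) \<in> S"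
  then show "j = i" using inj_onD[OF assms(1), of "(j, SOME v. v \<in> snd ` S)" "(i, SOME v. v \<in> snd ` S)"] assms(2)
    by simp
qed (rule assms(2))

lemma vertex_colour_mem:
  assumes "inj_on snd S" "S \<noteq> {}"
  shows "(vertex_colour S, SOME v. v \<in> snd ` S) \<in> S"
proof -
  have "(SOME v. v \<in> snd ` S) \<in> snd ` S" using assms(2) by (simp add: some_in_eq)
  then obtain x where "x \<in> S" "snd x = (SOME v. v \<in> snd ` S)" by (metis imageE)
  then have "(fst x, SOME v. v \<in> snd ` S) \<in> S" by (metis prod.collapse)
  then show ?thesis using vertex_colour_eq[OF assms(1)] by metis
qed

lemma vertex_colour_translate:
  assumes "inj_on snd S" "S \<noteq> {}"
  shows "vertex_colour (translate p e ` S) = (e + vertex_colour S) mod int p"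
proof (rule vertex_colour_eq[OF inj_on_snd_translate[OF assms(1)]])
  show "((e + vertex_colour S) mod int p, SOME v. v \<in> snd ` translate p e ` S) \<in> translate p e ` S"
    unfolding snd_image_translate using imageI[OF vertex_colour_mem[OF assms], of "translate p e"]
    by (simp add: translate_def)
qed

text \<open>
  An equivariant order-preserving map: proper inclusions increase the cardinality.
\<close>

definition size_label :: "(int \<times> 'v) set \<Rightarrow> int \<times> int" where
  "size_label S = (vertex_colour S, int (card S))"

lemma size_label_range:
  assumes "S \<in> box_complex r p H" "finite (verts H)" "p > 0"
  shows "size_label S \<in> Q_set p (int (p * card (verts H)) - 1)"
proof -
  have S: "S \<subseteq> Zp p \<times> verts H" "S \<noteq> {}" "inj_on snd S" using assms(1) by (simp_all add: box_complex_iff)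
  have fin: "finite (Zp p \<times> verts H)" using assms finite_Zp by simp
  have "card S \<le> p * card (verts H)"
    using card_mono[OF fin S(1)] unfolding card_cartesian_product card_Zp[OF assms(3)] .
  moreover have "card S \<noteq> 0" using S finite_subset[OF S(1) fin] by simp
  moreover have "vertex_colour S \<in> Zp p" using vertex_colour_mem[OF S(3,2)] S(1) by auto
  ultimately show ?thesis unfolding Q_set_def size_label_def by (simp del: of_nat_mult)
qed

lemma size_label_mono:
  assumes "finite T" "S \<subseteq> T"
  shows "Q_le (size_label S) (size_label T)"
  using psubset_card_mono[OF assms(1)] assms(2) by (cases "S = T") (auto simp: Q_le_def size_label_def)

lemma size_label_translate:
  assumes "p > 0" "S \<in> box_complex r p H"
  shows "size_label (translate p e ` S) = translate p e (size_label S)"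
proof -
  have S: "S \<subseteq> Zp p \<times> verts H" "S \<noteq> {}" "inj_on snd S" using assms(2) by (simp_all add: box_complex_iff)
  have "inj_on (translate p e) S" using S(1) by (intro inj_on_subset[OF inj_on_translate[OF assms(1)]]) auto
  then show ?thesis
    using vertex_colour_translate[OF S(3,2), of p e] by (simp add: size_label_def card_image translate_def)
qed

lemma finite_Union_box_complex:
  assumes "p > 0" "finite (verts H)"
  shows "finite (\<Union>(box_complex r p H))" "S \<in> box_complex r p H \<Longrightarrow> finite S"
proof -
  have "finite (Zp p \<times> verts H)" using assms finite_Zp by simp
  then show "finite (\<Union>(box_complex r p H))"
    by (rule rev_finite_subset) (auto simp: box_complex_iff)
  then show "S \<in> box_complex r p H \<Longrightarrow> finite S" by (meson Sup_upper rev_finite_subset)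
qed

text \<open>
  The map \<open>size_label\<close> shows that there is a witness in some dimension.
\<close>

lemma ind_box_attained:
  assumes "p > 0" "finite (verts H)"
  obtains f where "-1 \<le> ind_box r p H" "index_witness p (box_complex r p H) (ind_box r p H) f"
proof -
  let ?m = "int (p * card (verts H)) - 1"
  have "index_witness p (box_complex r p H) ?m
      (carrier_map (\<Union>(box_complex r p H)) (box_complex r p H) (\<lambda>S. {size_label S}))"
    by (intro index_witness_of_poset_map[OF assms(1) finite_Union_box_complex(1)[OF assms]
          translation_closed_box_complex[OF assms(1)]])
      (use assms finite_Union_box_complex(2)[OF assms] in
        \<open>blast intro: size_label_range size_label_mono size_label_translate\<close>)+
  then have "\<exists>f. index_witness p (box_complex r p H) ?m f" by blast
  moreover have "-1 \<le> ?m" by (simp del: of_nat_mult)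
  ultimately have "-1 \<le> ind_box r p H \<and> (\<exists>f. index_witness p (box_complex r p H) (ind_box r p H) f)"
    unfolding ind_complex_alt
    using Least_int(2,3)[of ?m "\<lambda>n. \<exists>f. index_witness p (box_complex r p H) n f"] by blast
  then show ?thesis using that by blast
qed

section \<open>The Hom complex\<close>

text \<open>
  An element of the Hom complex acts on index families by a shift that is opposite to the action on
  sets of pairs, see \<open>translate_Sigma_hom\<close>. Reflecting the colours exchanges the two actions.
\<close>

definition reflect :: "nat \<Rightarrow> int \<times> int \<Rightarrow> int \<times> int" where
  "reflect p x = ((- fst x) mod int p, snd x)"

lemma reflect_translate: "reflect p (translate p (- e) x) = translate p e (reflect p x)"
  by (simp add: reflect_def translate_def split_beta mod_simps)

lemma hom_set_box:
  assumes "p > 0" "U \<in> hom_set r p H"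
  shows "Sigma (Zp p) U \<in> box_complex r p H" "fst ` Sigma (Zp p) U = Zp p"
proof -
  have U: "\<forall>i\<in>Zp p. U i \<subseteq> verts H \<and> U i \<noteq> {}" "disjoint_family_on U (Zp p)"
    "complete_partite r (Zp p) U (partite_sub H (Zp p) U)"
    using assms(2) by (auto simp: hom_set_def)
  have "0 \<in> Zp p" using assms(1) by (simp add: mem_Zp)
  then have "(\<Union>i\<in>Zp p. U i) \<noteq> {}" using U(1) by blast
  then show "Sigma (Zp p) U \<in> box_complex r p H"
    using U unfolding box_complex_def by blast
  show "fst ` Sigma (Zp p) U = Zp p" using U(1) by force
qed

lemma box_hom_set:
  assumes "S \<in> box_complex r p H" "fst ` S = Zp p"
  shows "(\<lambda>i\<in>Zp p. S `` {i}) \<in> hom_set r p H"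
proof -
  let ?U = "\<lambda>i\<in>Zp p. S `` {i}"
  have S: "S \<subseteq> Zp p \<times> verts H" "S \<noteq> {}" "inj_on snd S" "rainbow_complete r p H S"
    using assms(1) by (simp_all add: box_complex_iff)
  have un: "(\<Union>i\<in>Zp p. ?U i) = snd ` S" using S(1) by force
  have "complete_partite r (Zp p) ?U (partite_sub H (Zp p) ?U)"
    using S(4) unfolding complete_partite_partite_sub un rainbow_complete_def by simp
  moreover have "disjoint_family_on ?U (Zp p)"
    using S(3) by (force simp: disjoint_family_on_def inj_on_def)
  moreover have "S `` {i} \<noteq> {}" if "i \<in> Zp p" for i
  proof -
    have "i \<in> fst ` S" using that assms(2) by simp
    then show ?thesis by force
  qed
  moreover have "S `` {i} \<subseteq> verts H" for i using S(1) by auto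
  ultimately show ?thesis unfolding hom_set_def by auto
qed

lemma translate_Sigma_hom:
  assumes "p > 0"
  shows "Sigma (Zp p) (hom_action p e U) = translate p (- e) ` Sigma (Zp p) U"
proof (rule Set.set_eqI)
  fix x :: "int \<times> 'a"
  have Z: "fst ` Sigma (Zp p) U \<subseteq> Zp p" by auto
  show "x \<in> Sigma (Zp p) (hom_action p e U) \<longleftrightarrow> x \<in> translate p (- e) ` Sigma (Zp p) U"
    unfolding translate_image_mem_iff[OF assms Z] using translate_in[OF assms, of e x]
    by (cases x) (auto simp: hom_action_def translate_def add.commute)
qed

lemma hom_action_sections:
  assumes "p > 0" "fst ` S \<subseteq> Zp p"
  shows "(\<lambda>i\<in>Zp p. (translate p e ` S) `` {i}) = hom_action p (- e) (\<lambda>i\<in>Zp p. S `` {i})"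
proof
  fix i
  have "(i - e) mod int p \<in> Zp p" using assms(1) by (simp add: mem_Zp)
  then show "(\<lambda>i\<in>Zp p. (translate p e ` S) `` {i}) i = hom_action p (- e) (\<lambda>i\<in>Zp p. S `` {i}) i"
    using translate_image_section[OF assms, of i e] by (simp add: hom_action_def)
qed

lemma hom_action_mod [simp]: "hom_action p (e mod int p) = hom_action p e"
  by (simp add: hom_action_def fun_eq_iff mod_simps)

lemma hom_le_Sigma: "hom_le p U U' \<Longrightarrow> Sigma (Zp p) U \<subseteq> Sigma (Zp p) U'"
  by (auto simp: hom_le_def)

definition Xind_witness :: "nat \<Rightarrow> nat \<Rightarrow> 'a hypergraph \<Rightarrow> int \<Rightarrow> ((int \<Rightarrow> 'a set) \<Rightarrow> int \<times> int) \<Rightarrow> bool" where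
  "Xind_witness r p H n f \<longleftrightarrow> f \<in> hom_set r p H \<rightarrow> Q_set p n \<and> monotone_on (hom_set r p H) (hom_le p) Q_le f \<and>
    equivariant_on p (hom_set r p H) (hom_action p) (translate p) f"

lemma reflect_in_Q_set: "p > 0 \<Longrightarrow> x \<in> Q_set p n \<Longrightarrow> reflect p x \<in> Q_set p n"
  by (auto simp: reflect_def Q_set_def mem_Zp)

lemma Q_le_reflect: "Q_le x y \<Longrightarrow> Q_le (reflect p x) (reflect p y)"
  by (auto simp: Q_le_def reflect_def)

lemma Xind_hom_attained:
  assumes "p > 0" "finite (verts H)"
  obtains f where "-1 \<le> Xind_hom r p H" "Xind_witness r p H (Xind_hom r p H) f"
proof -
  let ?m = "int (p * card (verts H)) - 1"
  let ?f = "\<lambda>U. reflect p (size_label (Sigma (Zp p) U))"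
  have "Xind_witness r p H ?m ?f"
    unfolding Xind_witness_def
  proof (intro conjI)
    show "?f \<in> hom_set r p H \<rightarrow> Q_set p ?m"
      using size_label_range[OF hom_set_box(1)[OF assms(1)] assms(2,1)] reflect_in_Q_set[OF assms(1)] by blast
    show "monotone_on (hom_set r p H) (hom_le p) Q_le ?f"
    proof (rule monotone_onI)
      fix U U' assume U: "U \<in> hom_set r p H" "U' \<in> hom_set r p H" "hom_le p U U'"
      then show "Q_le (?f U) (?f U')"
        using finite_Union_box_complex(2)[OF assms hom_set_box(1)[OF assms(1)]] hom_le_Sigma
        by (intro Q_le_reflect size_label_mono) blast+
    qed
    show "equivariant_on p (hom_set r p H) (hom_action p) (translate p) ?f"
      unfolding equivariant_on_def
    proof (intro ballI)
      fix e U assume "U \<in> hom_set r p H"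
      note size_label_translate[OF assms(1) hom_set_box(1)[OF assms(1) this], of "- e"]
      then show "?f (hom_action p e U) = translate p e (?f U)"
        by (simp add: translate_Sigma_hom[OF assms(1)] reflect_translate)
    qed
  qed
  moreover have "Xind_hom r p H = (LEAST n. -1 \<le> n \<and> (\<exists>f. Xind_witness r p H n f))"
    by (simp add: Xind_def Xind_witness_def Bex_def)
  moreover have "-1 \<le> ?m" by (simp del: of_nat_mult)
  ultimately have "-1 \<le> Xind_hom r p H \<and> (\<exists>f. Xind_witness r p H (Xind_hom r p H) f)"
    using Least_int(2,3)[of ?m "\<lambda>n. \<exists>f. Xind_witness r p H n f"] by metis
  then show ?thesis using that by blast
qed

text \<open>
  The average modulo \<open>p\<close>. The chosen inverse depends on the cardinality of \<open>I\<close> only, hence it is the same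
  for all translates of \<open>I\<close>.
\<close>

definition cyclic_mean :: "nat \<Rightarrow> int set \<Rightarrow> int" where
  "cyclic_mean p I = ((SOME c. (c * int (card I)) mod int p = 1) * \<Sum>I) mod int p"

text \<open>
  As \<open>p\<close> is prime, the cardinality of a proper nonempty subset is invertible modulo \<open>p\<close>. The mean is
  therefore an equivariant choice of a colour for such subsets.
\<close>

lemma cyclic_mean_translate:
  assumes p: "prime p" and I: "I \<subseteq> Zp p" "I \<noteq> {}" "I \<noteq> Zp p"
  shows "cyclic_mean p ((\<lambda>i. (e + i) mod int p) ` I) = (e + cyclic_mean p I) mod int p"
proof -
  have p0: "p > 0" and p1: "p > 1" using p prime_gt_0_nat prime_gt_1_nat by auto
  have fin: "finite I" using I(1) finite_Zp[OF p0] by (rule finite_subset)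
  have "card I < p" using I psubset_card_mono[OF finite_Zp[OF p0], of I] card_Zp[OF p0] by auto
  moreover have "0 < card I" using I fin by (simp add: card_gt_0_iff)
  ultimately have "coprime (card I) p"
    using p by (metis coprime_commute nat_dvd_not_less prime_imp_coprime)
  then have "gcd (int (card I)) (int p) = 1" by (simp add: coprime_iff_gcd_eq_1)
  then obtain u v where uv: "u * int (card I) + v * int p = 1" using bezout_int by metis
  have "u * int (card I) = 1 + (- v) * int p" using uv by (simp add: algebra_simps)
  then have "(u * int (card I)) mod int p = 1 mod int p" by (simp only: mod_mult_self1)
  then have "(u * int (card I)) mod int p = 1" using p1 by simp
  define c where "c = (SOME c. (c * int (card I)) mod int p = 1)"
  have c: "(c * int (card I)) mod int p = 1" unfolding c_def by (rule someI) fact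
  have inj: "inj_on (\<lambda>i. (e + i) mod int p) I"
    using inj_on_add_mod[OF p0] I(1) by (rule inj_on_subset)
  have "cyclic_mean p ((\<lambda>i. (e + i) mod int p) ` I) = (c * (\<Sum>i\<in>I. (e + i) mod int p)) mod int p"
    using inj by (simp add: cyclic_mean_def card_image c_def sum.reindex)
  also have "\<dots> = (c * (\<Sum>i\<in>I. e + i)) mod int p"
    by (metis mod_mult_right_eq mod_sum_eq)
  also have "c * (\<Sum>i\<in>I. e + i) = (c * int (card I)) * e + c * \<Sum>I"
    by (simp add: sum.distrib algebra_simps)
  also have "\<dots> mod int p = (((c * int (card I)) mod int p) * e + c * \<Sum>I) mod int p"
    by (metis mod_add_left_eq mod_mult_left_eq)
  also have "\<dots> = (e + cyclic_mean p I) mod int p"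
    unfolding c by (simp add: cyclic_mean_def c_def mod_simps)
  finally show ?thesis .
qed

text \<open>
  Simplices that miss a colour occupy the levels \<open>1, \<dots>, p - 1\<close>. The simplices with all colours are
  elements of the Hom complex; their levels under \<open>f\<close> start at \<open>1\<close> and are moved above the others.
\<close>

definition glued_label :: "nat \<Rightarrow> ((int \<Rightarrow> 'a set) \<Rightarrow> int \<times> int) \<Rightarrow> (int \<times> 'a) set \<Rightarrow> int \<times> int" where
  "glued_label p f S =
    (if fst ` S = Zp p
     then (fst (reflect p (f (\<lambda>i\<in>Zp p. S `` {i}))), snd (f (\<lambda>i\<in>Zp p. S `` {i})) + int p - 1)
     else (cyclic_mean p (fst ` S), int (card (fst ` S))))"

theorem ind_box_le_Xind_hom:
  assumes p: "prime p" and H: "finite (verts H)"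
  shows "ind_box r p H + 1 \<le> Xind_hom r p H + int p"
proof -
  let ?B = "box_complex r p H"
  have p0: "p > 0" using p by (simp add: prime_gt_0_nat)
  obtain f where m: "-1 \<le> Xind_hom r p H" and f: "Xind_witness r p H (Xind_hom r p H) f"
    by (rule Xind_hom_attained[OF p0 H])
  let ?n = "Xind_hom r p H + int p - 1"
  let ?U = "\<lambda>S. \<lambda>i\<in>Zp p. S `` {i}"
  have B: "fst ` S \<subseteq> Zp p" "S \<noteq> {}" if "S \<in> ?B" for S using that by (auto simp: box_complex_iff)
  have fQ: "f (?U S) \<in> Q_set p (Xind_hom r p H)" if "S \<in> ?B" "fst ` S = Zp p" for S
    using f box_hom_set[OF that] unfolding Xind_witness_def by blast
  have card: "0 < card (fst ` S) \<and> (fst ` S \<noteq> Zp p \<longrightarrow> card (fst ` S) < p)" if "S \<in> ?B" for S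
  proof -
    have "finite (fst ` S)" using B(1)[OF that] finite_Zp[OF p0] by (rule finite_subset)
    then show ?thesis
      using B[OF that] psubset_card_mono[OF finite_Zp[OF p0], of "fst ` S"] card_Zp[OF p0]
      by (auto simp: card_gt_0_iff)
  qed
  have full: "f (?U S) \<in> Zp p \<times> {1..Xind_hom r p H + 1}" if "S \<in> ?B" "fst ` S = Zp p" for S
    using fQ[OF that] by (simp add: Q_set_def)
  have "index_witness p ?B ?n (carrier_map (\<Union>?B) ?B (\<lambda>S. {glued_label p f S}))"
  proof (rule index_witness_of_poset_map[OF p0 finite_Union_box_complex(1)[OF p0 H] translation_closed_box_complex[OF p0]])
    fix S assume S: "S \<in> ?B"
    show "glued_label p f S \<in> Q_set p ?n"
    proof (cases "fst ` S = Zp p")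
      case True
      then show ?thesis using full[OF S True] p0
        by (auto simp: glued_label_def Q_set_def reflect_def mem_Zp)
    next
      case False
      then show ?thesis using card[OF S] m p0
        by (auto simp: glued_label_def Q_set_def cyclic_mean_def mem_Zp)
    qed
    fix e
    show "glued_label p f (translate p e ` S) = translate p e (glued_label p f S)"
    proof (cases "fst ` S = Zp p")
      case True
      have "fst ` translate p e ` S = Zp p"
      proof
        show "fst ` translate p e ` S \<subseteq> Zp p" using translate_in[OF p0] by auto
        show "Zp p \<subseteq> fst ` translate p e ` S"
        proof
          fix i assume "i \<in> Zp p"
          then have "(e + (i - e) mod int p) mod int p = i" by (simp add: mod_simps mem_Zp[OF p0])
          moreover have "(i - e) mod int p \<in> fst ` S" unfolding True using p0 by (simp add: mem_Zp)
          ultimately show "i \<in> fst ` translate p e ` S" unfolding fst_image_translate by (metis imageI)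
        qed
      qed
      moreover have "f (?U (translate p e ` S)) = translate p (- e) (f (?U S))"
      proof -
        have "(- e) mod int p \<in> Zp p" using p0 by (simp add: mem_Zp)
        then have "f (hom_action p ((- e) mod int p) (?U S)) = translate p ((- e) mod int p) (f (?U S))"
          using f box_hom_set[OF S True] unfolding Xind_witness_def equivariant_on_def by blast
        then show ?thesis unfolding hom_action_mod translate_mod hom_action_sections[OF p0 B(1)[OF S]] .
      qed
      ultimately show ?thesis using True
        by (simp add: glued_label_def reflect_translate fst_translate) (simp add: translate_def)
    next
      case False
      then have "fst ` translate p e ` S \<noteq> Zp p"
      proof -
        have "card (fst ` translate p e ` S) \<le> card (fst ` S)"
          unfolding fst_image_translate using B(1)[OF S] finite_Zp[OF p0] by (intro card_image_le) (rule finite_subset)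
        then show ?thesis using card[OF S] False card_Zp[OF p0] by auto
      qed
      moreover have "cyclic_mean p (fst ` translate p e ` S) = (e + cyclic_mean p (fst ` S)) mod int p"
        unfolding fst_image_translate using B[OF S] False by (intro cyclic_mean_translate[OF p]) auto
      moreover have "card (fst ` translate p e ` S) = card (fst ` S)"
        unfolding fst_image_translate
        by (intro card_image inj_on_subset[OF inj_on_add_mod[OF p0] B(1)[OF S]])
      ultimately show ?thesis using False by (simp add: glued_label_def translate_def)
    qed
  next
    fix S T assume ST: "S \<in> ?B" "T \<in> ?B" "S \<subseteq> T"
    have sub: "fst ` S \<subseteq> fst ` T" using ST(3) by (rule image_mono)
    show "Q_le (glued_label p f S) (glued_label p f T)"
    proof (cases "fst ` T = Zp p")
      case T: True
      show ?thesis
      proof (cases "fst ` S = Zp p")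
        case True
        have "hom_le p (?U S) (?U T)" using ST(3) by (auto simp: hom_le_def)
        then have "Q_le (f (?U S)) (f (?U T))"
          using f box_hom_set[OF ST(1) True] box_hom_set[OF ST(2) T]
          unfolding Xind_witness_def monotone_on_def by blast
        then show ?thesis using True T by (auto simp: glued_label_def Q_le_def reflect_def)
      next
        case False
        then show ?thesis using T full[OF ST(2) T] card[OF ST(1)]
          by (auto simp: glued_label_def Q_le_def)
      qed
    next
      case False
      then have S: "fst ` S \<noteq> Zp p" using sub B(1)[OF ST(2)] by blast
      have "finite (fst ` T)" using B(1)[OF ST(2)] finite_Zp[OF p0] by (rule finite_subset)
      then show ?thesis using S False psubset_card_mono[of "fst ` T" "fst ` S"] sub
        by (cases "fst ` S = fst ` T") (auto simp: glued_label_def Q_le_def)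
    qed
  qed
  then have "ind_box r p H \<le> ?n"
    unfolding ind_complex_alt using m p0 by (intro Least_int(1)) auto
  then show ?thesis by simp
qed

section \<open>Alternation\<close>

lemma finite_alternations:
  "finite {length ys |ys. subseq ys X \<and> None \<notin> set ys \<and> distinct_adj ys}"
proof (rule finite_subset)
  show "{length ys |ys. subseq ys X \<and> None \<notin> set ys \<and> distinct_adj ys} \<subseteq> {..length X}"
    by (auto dest: list_emb_length)
qed simp

lemma length_le_alt:
  assumes "subseq ys X" "None \<notin> set ys" "distinct_adj ys"
  shows "length ys \<le> alt X"
  unfolding alt_def using assms by (intro Max_ge finite_alternations) blast

lemma alt_attained:
  obtains ys where "subseq ys X" "None \<notin> set ys" "distinct_adj ys" "length ys = alt X"
proof -
  have "alt X \<in> {length ys |ys. subseq ys X \<and> None \<notin> set ys \<and> distinct_adj ys}"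
    unfolding alt_def
  proof (rule Max_in[OF finite_alternations])
    have "subseq [] X \<and> None \<notin> set [] \<and> distinct_adj ([] :: int option list)" by simp
    then show "{length ys |ys. subseq ys X \<and> None \<notin> set ys \<and> distinct_adj ys} \<noteq> {}" by blast
  qed
  then show ?thesis using that by auto
qed

lemma alt_le_card: "alt X \<le> card {i. i < length X \<and> X ! i \<noteq> None}"
proof -
  obtain ys where ys: "subseq ys X" "None \<notin> set ys" "length ys = alt X" by (rule alt_attained)
  have "filter (\<lambda>x. x \<noteq> None) ys = ys" using ys(2) by (metis (mono_tags, lifting) filter_True)
  then have "subseq ys (filter (\<lambda>x. x \<noteq> None) X)" using subseq_filter[OF ys(1)] by metis
  then have "length ys \<le> length (filter (\<lambda>x. x \<noteq> None) X)" by (rule list_emb_length)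
  then show ?thesis using ys(3) by (simp add: length_filter_conv_card)
qed

text \<open>
  The order on sign vectors in which the face relation of simplices becomes componentwise:
  entries may only be changed from zero to a sign.
\<close>

definition sign_le :: "int option \<Rightarrow> int option \<Rightarrow> bool" where
  "sign_le a b \<longleftrightarrow> a = None \<or> a = b"

lemma subseq_sign_le:
  assumes "list_all2 sign_le X Y" "subseq ys X" "None \<notin> set ys"
  shows "subseq ys Y"
  using assms
proof (induction X Y arbitrary: ys rule: list_all2_induct)
  case (Cons x X y Y)
  show ?case
  proof (cases ys)
    case (Cons z zs)
    show ?thesis
    proof (cases "x = z")
      case True
      then have "y = z" using Cons.hyps Cons.prems Cons by (auto simp: sign_le_def)
      moreover have "subseq zs Y" using Cons.IH[of zs] Cons.prems Cons True by simp
      ultimately show ?thesis using Cons by simp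
    next
      case False
      then have "subseq ys Y" using Cons.IH[of ys] Cons.prems Cons by simp
      then show ?thesis by (rule list_emb_Cons)
    qed
  qed simp
qed simp

definition first_sign :: "int option list \<Rightarrow> int" where
  "first_sign X = the (hd (filter (\<lambda>x. x \<noteq> None) X))"

text \<open>
  A subsequence that does not start with the first sign avoids the first nonzero entry, which can then
  be put in front of it.
\<close>

lemma subseq_Cons_first_sign:
  assumes "subseq ys X" "None \<notin> set ys" "set X \<noteq> {None}" "X \<noteq> []" "ys = [] \<or> hd ys \<noteq> Some (first_sign X)"
  shows "subseq (Some (first_sign X) # ys) X"
  using assms
proof (induction X rule: list.induct)
  case (Cons x X)
  show ?case
  proof (cases x)
    case None
    have "subseq ys X" using Cons.prems(1,2) None by (cases ys) (auto split: if_splits)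
    moreover have "set X \<noteq> {None}" "X \<noteq> []" using Cons.prems(3) None by auto
    moreover have "first_sign (x # X) = first_sign X" by (simp add: first_sign_def None)
    ultimately have "subseq (Some (first_sign (x # X)) # ys) X" using Cons.IH Cons.prems by simp
    then show ?thesis by (rule list_emb_Cons)
  next
    case (Some a)
    then have "first_sign (x # X) = a" by (simp add: first_sign_def)
    then show ?thesis using Cons.prems Some by (cases ys) (auto split: if_splits)
  qed
qed simp

text \<open>
  An alternating subsequence of maximal length starts with the first sign, as it could be prolonged
  otherwise. One that is optimal for \<open>X\<close> is also a subsequence of \<open>Y\<close>, and optimal there because
  the alternations are equal. So it starts with both first signs.
\<close>

lemma first_sign_eq:
  assumes le: "list_all2 sign_le X Y" and ne: "\<exists>x\<in>set X. x \<noteq> None" and eq: "alt X = alt Y"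
  shows "first_sign X = first_sign Y"
proof -
  have ne': "set Z \<noteq> {None} \<and> Z \<noteq> []" if "\<exists>x\<in>set Z. x \<noteq> None" for Z :: "int option list"
    using that by auto
  have neY: "\<exists>y\<in>set Y. y \<noteq> None"
    using le ne by (induction rule: list_all2_induct) (auto simp: sign_le_def)
  have opt: "ys \<noteq> [] \<and> hd ys = Some (first_sign Z)"
    if "subseq ys Z" "None \<notin> set ys" "distinct_adj ys" "length ys = alt Z" "\<exists>z\<in>set Z. z \<noteq> None"
    for ys Z
  proof (rule ccontr)
    assume *: "\<not> (ys \<noteq> [] \<and> hd ys = Some (first_sign Z))"
    then have "subseq (Some (first_sign Z) # ys) Z"
      using subseq_Cons_first_sign that(1,2) ne'[OF that(5)] by blast
    moreover have "distinct_adj (Some (first_sign Z) # ys)"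
      using * that(3) by (cases ys) auto
    ultimately have "length (Some (first_sign Z) # ys) \<le> alt Z"
      using that(2) by (intro length_le_alt) auto
    then show False using that(4) by simp
  qed
  obtain ys where ys: "subseq ys X" "None \<notin> set ys" "distinct_adj ys" "length ys = alt X"
    by (rule alt_attained)
  have "subseq ys Y" using subseq_sign_le[OF le ys(1,2)] .
  then show ?thesis using opt[OF ys ne] opt[of ys Y] ys eq neY by simp
qed

lemma alt_le_alt_map:
  assumes "inj_on g (set X)" "None \<notin> g ` (set X - {None})"
  shows "alt X \<le> alt (map g X)"
proof -
  obtain ys where ys: "subseq ys X" "None \<notin> set ys" "distinct_adj ys" "length ys = alt X"
    by (rule alt_attained)
  have sub: "set ys \<subseteq> set X" using list_emb_set[OF ys(1)] by auto
  have "distinct_adj (map g ys)"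
    using ys(3) assms(1) sub by (intro distinct_adj_mapI) (auto intro: inj_on_subset)
  moreover have "None \<notin> set (map g ys)" using assms(2) sub ys(2) by auto
  ultimately have "length (map g ys) \<le> alt (map g X)"
    using subseq_map[OF ys(1)] by (intro length_le_alt)
  then show ?thesis using ys(4) by simp
qed

section \<open>Sign vectors of simplices\<close>

text \<open>
  The sign vector of a simplex. Positions start at \<open>0\<close> and levels at \<open>1\<close>, so position \<open>i\<close> corresponds to
  level \<open>i + 1\<close>. The simplices of \<open>EZp p (int N - 1)\<close> correspond to the nonzero vectors of length \<open>N\<close>.
\<close>

definition signs :: "nat \<Rightarrow> (int \<times> int) set \<Rightarrow> int option list" where
  "signs N S = map (\<lambda>i. if \<exists>e. (e, int i + 1) \<in> S then Some (THE e. (e, int i + 1) \<in> S) else None) [0..<N]"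

lemma length_signs [simp]: "length (signs N S) = N"
  by (simp add: signs_def)

lemma signs_nth:
  assumes "inj_on snd S" "i < N"
  shows "signs N S ! i = Some e \<longleftrightarrow> (e, int i + 1) \<in> S"
proof -
  have un: "a = b" if "(a, int i + 1) \<in> S" "(b, int i + 1) \<in> S" for a b
    using inj_onD[OF assms(1) _ that] by simp
  have "(THE e. (e, int i + 1) \<in> S) = a" if "(a, int i + 1) \<in> S" for a
    using that un by blast
  then show ?thesis using assms(2) un by (auto simp: signs_def)
qed

lemma signs_nth_None:
  assumes "i < N"
  shows "signs N S ! i = None \<longleftrightarrow> (\<nexists>e. (e, int i + 1) \<in> S)"
  using assms by (simp add: signs_def)

lemma sign_class_signs:
  assumes "inj_on snd S"
  shows "sign_class (signs N S) e = {i. i < N \<and> (e, int i + 1) \<in> S}"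
  unfolding sign_class_def using signs_nth[OF assms] by auto

lemma signs_mono:
  assumes "inj_on snd T" "S \<subseteq> T"
  shows "list_all2 sign_le (signs N S) (signs N T)"
proof (rule list_all2_all_nthI)
  fix i assume "i < length (signs N S)"
  then have i: "i < N" by simp
  have S: "inj_on snd S" using assms by (rule inj_on_subset)
  show "sign_le (signs N S ! i) (signs N T ! i)"
  proof (cases "signs N S ! i")
    case (Some e)
    then have "signs N T ! i = Some e" using signs_nth[OF S i] signs_nth[OF assms(1) i] assms(2) by blast
    then show ?thesis by (simp add: sign_le_def Some)
  qed (simp add: sign_le_def)
qed simp

lemma set_signs_subset:
  assumes "inj_on snd S" "fst ` S \<subseteq> Zp p"
  shows "set (signs N S) \<subseteq> insert None (Some ` Zp p)"
proof
  fix x assume "x \<in> set (signs N S)"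
  then obtain i where i: "i < N" "x = signs N S ! i" by (metis in_set_conv_nth length_signs)
  show "x \<in> insert None (Some ` Zp p)"
  proof (cases x)
    case (Some e)
    then have "(e, int i + 1) \<in> S" using signs_nth[OF assms(1) i(1)] i(2) by simp
    then have "e \<in> Zp p" using assms(2) by force
    then show ?thesis using Some by simp
  qed simp
qed

lemma signs_nonempty:
  assumes "S \<in> EZp p (int N - 1)"
  shows "\<exists>x\<in>set (signs N S). x \<noteq> None"
proof -
  have S: "S \<subseteq> Zp p \<times> {1..int N}" "S \<noteq> {}" "inj_on snd S" using assms by (auto simp: EZp_def)
  obtain e j where ej: "(e, j) \<in> S" using S(2) by auto
  then have j: "1 \<le> j" "j \<le> int N" using S(1) by auto
  define i where "i = nat (j - 1)"
  have i: "i < N" "int i + 1 = j" using j by (auto simp: i_def)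
  have "signs N S ! i = Some e" using signs_nth[OF S(3) i(1)] ej i(2) by simp
  then have "Some e \<in> set (signs N S)" using i(1) by (metis length_signs nth_mem)
  then show ?thesis by blast
qed

lemma alt_signs_pos:
  assumes "S \<in> EZp p (int N - 1)"
  shows "1 \<le> alt (signs N S)"
proof -
  obtain x where "x \<in> set (signs N S)" "x \<noteq> None" using signs_nonempty[OF assms] by blast
  then have "length [x] \<le> alt (signs N S)" by (intro length_le_alt) (auto simp: subseq_singleton_left)
  then show ?thesis by simp
qed

lemma signs_translate:
  assumes "p > 0" "inj_on snd S" "fst ` S \<subseteq> Zp p"
  shows "signs N (translate p e ` S) = map (map_option (\<lambda>i. (e + i) mod int p)) (signs N S)"
proof (rule nth_equalityI)
  fix i assume "i < length (signs N (translate p e ` S))"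
  then have i: "i < N" by simp
  note inj = inj_on_snd_translate[OF assms(2), of p e]
  show "signs N (translate p e ` S) ! i = map (map_option (\<lambda>i. (e + i) mod int p)) (signs N S) ! i"
  proof (cases "signs N S ! i")
    case None
    then have "\<nexists>a. (a, int i + 1) \<in> S" using signs_nth_None[OF i] by blast
    then have "\<nexists>a. (a, int i + 1) \<in> translate p e ` S"
    proof (intro notI)
      assume "\<exists>a. (a, int i + 1) \<in> translate p e ` S"
      then obtain a x where x: "x \<in> S" "(a, int i + 1) = translate p e x" by blast
      from arg_cong[OF x(2), of snd] have "snd x = int i + 1" by simp
      then have "(fst x, int i + 1) \<in> S" using x(1) by (metis prod.collapse)
      then show False using \<open>\<nexists>a. (a, int i + 1) \<in> S\<close> by blast
    qed
    then have "signs N (translate p e ` S) ! i = None" using signs_nth_None[OF i] by blast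
    then show ?thesis using None i by simp
  next
    case (Some a)
    then have "(a, int i + 1) \<in> S" using signs_nth[OF assms(2) i] by blast
    from imageI[OF this, of "translate p e"]
    have "((e + a) mod int p, int i + 1) \<in> translate p e ` S" by (simp add: translate_def)
    then show ?thesis using Some i signs_nth[OF inj i] by simp
  qed
qed simp

lemma first_sign_signs_translate:
  assumes "p > 0" "S \<in> EZp p (int N - 1)"
  shows "first_sign (signs N (translate p e ` S)) = (e + first_sign (signs N S)) mod int p"
proof -
  have S: "inj_on snd S" "fst ` S \<subseteq> Zp p" using assms(2) EZp_fst by (auto simp: EZp_def)
  let ?g = "map_option (\<lambda>i. (e + i) mod int p)"
  have "filter (\<lambda>x. x \<noteq> None) (map ?g X) = map ?g (filter (\<lambda>x. x \<noteq> None) X)" for X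
    by (induction X) auto
  moreover have ne: "filter (\<lambda>x. x \<noteq> None) (signs N S) \<noteq> []"
    using signs_nonempty[OF assms(2)] by (simp add: filter_empty_conv)
  moreover have "hd (filter (\<lambda>x. x \<noteq> None) (signs N S)) \<noteq> None"
    using hd_in_set[OF ne] by auto
  ultimately show ?thesis
    unfolding signs_translate[OF assms(1) S] first_sign_def by (auto simp: hd_map)
qed

lemma first_sign_in_Zp:
  assumes "S \<in> EZp p (int N - 1)"
  shows "first_sign (signs N S) \<in> Zp p"
proof -
  have S: "inj_on snd S" "fst ` S \<subseteq> Zp p" using assms EZp_fst by (auto simp: EZp_def)
  have ne: "filter (\<lambda>x. x \<noteq> None) (signs N S) \<noteq> []"
    using signs_nonempty[OF assms] by (simp add: filter_empty_conv)
  from hd_in_set[OF ne] show ?thesis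
    using set_signs_subset[OF S, of N] unfolding first_sign_def by auto
qed

lemma alt_signs_translate:
  assumes "p > 0" "S \<in> EZp p (int N - 1)"
  shows "alt (signs N (translate p e ` S)) = alt (signs N S)"
proof -
  have le: "alt (signs N T) \<le> alt (signs N (translate p d ` T))" if T: "T \<in> EZp p (int N - 1)" for T d
  proof -
    have T': "inj_on snd T" "fst ` T \<subseteq> Zp p" using T EZp_fst by (auto simp: EZp_def)
    have "inj_on (map_option (\<lambda>i. (d + i) mod int p)) (insert None (Some ` Zp p))"
      using inj_on_add_mod[OF assms(1), of d] by (auto simp: inj_on_def)
    then show ?thesis
      unfolding signs_translate[OF assms(1) T']
      by (intro alt_le_alt_map inj_on_subset[OF _ set_signs_subset[OF T']]) auto
  qed
  have "alt (signs N (translate p e ` S)) \<le> alt (signs N (translate p (- e) ` translate p e ` S))"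
    by (intro le translate_EZp assms)
  also have "translate p (- e) ` translate p e ` S = S"
    using translate_image_inverse(1)[OF assms(1) EZp_fst[OF assms(2)]] .
  finally show ?thesis using le[OF assms(2), of e] by simp
qed

section \<open>The alternation number\<close>

lemma finite_alt_wrt:
  assumes "p > 0"
  shows "finite {alt X |X. length X = n \<and> set X \<subseteq> insert None (Some ` Zp p) \<and> Q X}"
proof -
  have "finite {X. set X \<subseteq> insert None (Some ` Zp p) \<and> length X = n}"
    using finite_Zp[OF assms] by (intro finite_lists_length_eq) simp
  then have "finite (alt ` {X. set X \<subseteq> insert None (Some ` Zp p) \<and> length X = n})" by simp
  then show ?thesis by (rule rev_finite_subset) auto
qed

lemma alt_le_alt_wrt:
  assumes "p > 0" "length X = card (verts F)" "set X \<subseteq> insert None (Some ` Zp p)"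
    and "\<And>e. e \<in> Zp p \<Longrightarrow> edges (induced_sub F (\<sigma> ` sign_class X e)) = {}"
  shows "alt X \<le> alt_wrt p F \<sigma>"
  unfolding alt_wrt_def using assms by (intro Max_ge finite_alt_wrt) auto

lemma alt_wrt_attained:
  assumes "p > 0" "hypergraph F"
  obtains X where "alt_wrt p F \<sigma> = alt X" "length X = card (verts F)" "set X \<subseteq> insert None (Some ` Zp p)"
    "\<forall>e\<in>Zp p. edges (induced_sub F (\<sigma> ` sign_class X e)) = {}"
proof -
  let ?A = "{alt X |X. length X = card (verts F) \<and> set X \<subseteq> insert None (Some ` Zp p) \<and>
                    (\<forall>e\<in>Zp p. edges (induced_sub F (\<sigma> ` sign_class X e)) = {})}"
  have "sign_class (replicate (card (verts F)) None) e = {}" for e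
    by (auto simp: sign_class_def)
  then have "\<forall>e\<in>Zp p. edges (induced_sub F (\<sigma> ` sign_class (replicate (card (verts F)) None) e)) = {}"
    using assms(2) by (auto simp: induced_sub_def hypergraph_def)
  then have "alt (replicate (card (verts F)) None) \<in> ?A"
    by (intro CollectI exI[of _ "replicate (card (verts F)) None"] conjI) auto
  then have "alt_wrt p F \<sigma> \<in> ?A"
    unfolding alt_wrt_def by (intro Max_in finite_alt_wrt[OF assms(1)]) blast
  then show ?thesis using that by blast
qed

lemma alt_wrt_le:
  assumes "p > 0" "hypergraph F"
  shows "alt_wrt p F \<sigma> \<le> card (verts F)"
proof -
  obtain X where X: "alt_wrt p F \<sigma> = alt X" "length X = card (verts F)"
    using alt_wrt_attained[OF assms] by metis
  have "card {i. i < length X \<and> X ! i \<noteq> None} \<le> card {..<length X}" by (intro card_mono) auto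
  then show ?thesis using alt_le_card[of X] X by simp
qed

lemma alt_number_attained:
  assumes "p > 0" "hypergraph F"
  obtains \<sigma> where "bij_betw \<sigma> {..<card (verts F)} (verts F)" "alt_number p F = alt_wrt p F \<sigma>"
proof -
  let ?A = "{alt_wrt p F \<sigma> |\<sigma>. bij_betw \<sigma> {..<card (verts F)} (verts F)}"
  have "?A \<subseteq> {..card (verts F)}" using alt_wrt_le[OF assms] by auto
  then have "finite ?A" by (rule finite_subset) simp
  moreover have "?A \<noteq> {}"
    using ex_bij_betw_nat_finite[of "verts F"] assms(2) by (auto simp: hypergraph_def lessThan_atLeast0)
  ultimately have "alt_number p F \<in> ?A" unfolding alt_number_def by (rule Min_in)
  then show ?thesis using that by blast
qed

text \<open>
  Take a sign vector that attains the alternation for an optimal ordering \<open>\<sigma>\<close>. The vertices at its zero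
  positions are removed, and the others are coloured by their signs. No sign class contains an edge, so
  this is a colouring; and there are at least as many nonzero positions as the alternation.
\<close>

theorem colorability_defect_le:
  assumes p: "p > 0" and F: "hypergraph F"
  shows "colorability_defect p F + alt_number p F \<le> card (verts F)"
proof -
  obtain \<sigma> where \<sigma>: "bij_betw \<sigma> {..<card (verts F)} (verts F)" "alt_number p F = alt_wrt p F \<sigma>"
    by (rule alt_number_attained[OF p F])
  obtain X where X: "alt_wrt p F \<sigma> = alt X" "length X = card (verts F)" "set X \<subseteq> insert None (Some ` Zp p)"
    "\<forall>e\<in>Zp p. edges (induced_sub F (\<sigma> ` sign_class X e)) = {}"
    by (rule alt_wrt_attained[OF p F])
  let ?n = "card (verts F)"
  let ?I = "{i. i < ?n \<and> X ! i \<noteq> None}" and ?J = "{i. i < ?n \<and> X ! i = None}"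
  define U where "U = \<sigma> ` ?J"
  have inj: "inj_on \<sigma> {..<?n}" using \<sigma>(1) by (rule bij_betw_imp_inj_on)
  have img: "\<sigma> ` {..<?n} = verts F" using \<sigma>(1) by (rule bij_betw_imp_surj_on)
  have finV: "finite (verts F)" using F by (simp add: hypergraph_def)
  have "{..<?n} = ?I \<union> ?J" by auto
  then have VU: "verts F - U = \<sigma> ` ?I"
  proof -
    have "verts F - U = \<sigma> ` {..<?n} - \<sigma> ` ?J" unfolding U_def img ..
    also have "\<dots> = \<sigma> ` ({..<?n} - ?J)"
      by (rule inj_on_image_set_diff[OF inj, symmetric]) auto
    also have "{..<?n} - ?J = ?I" by auto
    finally show ?thesis .
  qed
  have idx: "inv_into {..<?n} \<sigma> v \<in> ?I \<and> \<sigma> (inv_into {..<?n} \<sigma> v) = v" if "v \<in> verts F - U" for v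
  proof -
    have "v \<in> \<sigma> ` ?I" using that unfolding VU .
    then obtain i where "v = \<sigma> i" "i \<in> ?I" by (rule imageE)
    moreover from this have "inv_into {..<?n} \<sigma> v = i" using inv_into_f_f[OF inj, of i] by blast
    ultimately show ?thesis by simp
  qed
  \<comment> \<open>Colours are counted from \<open>1\<close>, signs from \<open>0\<close>.\<close>
  let ?c = "\<lambda>v. nat (the (X ! inv_into {..<?n} \<sigma> v)) + 1"
  have sgn: "\<exists>a\<in>Zp p. X ! i = Some a" if "i \<in> ?I" for i
  proof -
    have "X ! i \<in> set X" using that X(2) by simp
    then show ?thesis using X(3) that by auto
  qed
  have col: "\<exists>a\<in>Zp p. X ! inv_into {..<?n} \<sigma> v = Some a" if "v \<in> verts F - U" for v
    using sgn idx[OF that] by blast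
  have "colorable p (induced_sub F (verts F - U))"
    unfolding colorable_def
  proof (intro bexI[of _ ?c] ballI notI)
    fix A assume A: "A \<in> edges (induced_sub F (verts F - U))" "\<exists>i. \<forall>v\<in>A. ?c v = i"
    from A(2) obtain k where "\<forall>v\<in>A. ?c v = k" by (rule exE)
    then have k: "?c v = k" if "v \<in> A" for v using that by (rule bspec)
    have AF: "A \<in> edges F" "A \<subseteq> verts F - U" using A(1) by (auto simp: induced_sub_def)
    have "A \<noteq> {}" using F AF(1) by (auto simp: hypergraph_def)
    then obtain v0 where v0: "v0 \<in> A" by blast
    let ?e = "the (X ! inv_into {..<?n} \<sigma> v0)"
    have AU: "v \<in> verts F - U" if "v \<in> A" for v using AF(2) that by blast
    obtain a0 where a0: "a0 \<in> Zp p" "X ! inv_into {..<?n} \<sigma> v0 = Some a0"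
      using col[OF AU[OF v0]] by (rule bexE)
    then have "?e \<in> Zp p" by simp
    have "A \<subseteq> \<sigma> ` sign_class X ?e"
    proof
      fix v assume v: "v \<in> A"
      let ?i = "inv_into {..<?n} \<sigma> v"
      obtain a where a: "a \<in> Zp p" "X ! ?i = Some a" using col[OF AU[OF v]] by (rule bexE)
      have "nat a = nat a0" using k[OF v] k[OF v0] a a0 by simp
      then have "a = a0" using a(1) a0(1) unfolding mem_Zp[OF p] by linarith
      then have "?i \<in> sign_class X ?e" using a a0 idx[OF AU[OF v]] X(2) by (simp add: sign_class_def)
      then have "\<sigma> ?i \<in> \<sigma> ` sign_class X ?e" by (rule imageI)
      then show "v \<in> \<sigma> ` sign_class X ?e" using idx[OF AU[OF v]] by simp
    qed
    then have "A \<in> edges (induced_sub F (\<sigma> ` sign_class X ?e))" using AF by (simp add: induced_sub_def)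
    then show False using X(4) \<open>?e \<in> Zp p\<close> by blast
  next
    show "?c \<in> verts (induced_sub F (verts F - U)) \<rightarrow> {1..p}"
    proof
      fix v assume "v \<in> verts (induced_sub F (verts F - U))"
      then have "v \<in> verts F - U" by (simp add: induced_sub_def)
      from col[OF this] obtain a where a: "a \<in> Zp p" "X ! inv_into {..<?n} \<sigma> v = Some a"
        by (rule bexE)
      from a(1) have "nat a < p" unfolding mem_Zp[OF p] by linarith
      then show "?c v \<in> {1..p}" unfolding a(2) by simp
    qed
  qed
  moreover have UV: "U \<subseteq> verts F" unfolding U_def using img by blast
  moreover have "finite {card U |U. U \<subseteq> verts F \<and> colorable p (induced_sub F (verts F - U))}"
    by (rule finite_subset[of _ "card ` Pow (verts F)"]) (use finV in auto)
  ultimately have "colorability_defect p F \<le> card U"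
    unfolding colorability_defect_def by (intro Min_le) auto
  moreover have "card U + alt X \<le> ?n"
  proof -
    have "card U \<le> card ?J" unfolding U_def by (intro card_image_le) simp
    moreover have "card ?I + card ?J = card {..<?n}"
      unfolding \<open>{..<?n} = ?I \<union> ?J\<close> by (intro card_Un_disjoint[symmetric]) auto
    ultimately show ?thesis using alt_le_card[of X] X(2) by simp
  qed
  ultimately show ?thesis using X(1) \<sigma>(2) by simp
qed

section \<open>The dominating simplex of a point\<close>

text \<open>
  The largest face of maximal weight. Faces of maximal weight form a chain, so their union is one of
  them; taking the union makes the choice equivariant.
\<close>

definition dominating_simplex :: "'v set set \<Rightarrow> ('v \<Rightarrow> real) \<Rightarrow> 'v set" where
  "dominating_simplex K x =
    \<Union>{S \<in> K. 0 < weight (\<Union>K) x S \<and> (\<forall>T\<in>K. weight (\<Union>K) x T \<le> weight (\<Union>K) x S)}"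

lemma Union_weight_chain_in:
  assumes "finite V" "\<And>v. 0 \<le> x v" "C \<noteq> {}"
    and "\<And>S. S \<in> C \<Longrightarrow> S \<subseteq> V \<and> 0 < weight V x S"
  shows "\<Union>C \<in> C"
proof (rule Union_in_chain)
  show "finite C" using assms(1,4) by (intro finite_subset[of C "Pow V"]) auto
  show "subset.chain C C"
    unfolding subset_chain_def
  proof (intro conjI ballI)
    fix S T assume "S \<in> C" "T \<in> C"
    then show "S \<subseteq> T \<or> T \<subseteq> S"
      using assms by (intro weight_pos_chain[where V = V and x = x]) auto
  qed simp
qed (rule assms(3))

lemma dominating_simplex:
  assumes "finite (\<Union>K)" "x \<in> topspace (realization K)"
  shows "dominating_simplex K x \<in> K" "0 < weight (\<Union>K) x (dominating_simplex K x)"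
    "\<And>T. T \<in> K \<Longrightarrow> weight (\<Union>K) x T \<le> weight (\<Union>K) x (dominating_simplex K x)"
proof -
  let ?w = "weight (\<Union>K) x"
  let ?C = "{S \<in> K. 0 < ?w S \<and> (\<forall>T\<in>K. ?w T \<le> ?w S)}"
  have x: "\<And>v. 0 \<le> x v" "{v. x v \<noteq> 0} \<in> K" using assms(2) unfolding topspace_realization by blast+
  have finK: "finite K" using assms(1) by (rule finite_UnionD)
  have ne: "K \<noteq> {}" using x(2) by blast
  have "Max (?w ` K) \<in> ?w ` K" using finK ne by (intro Max_in) auto
  then obtain S where S: "S \<in> K" "?w S = Max (?w ` K)" by (metis imageE)
  have le: "?w T \<le> ?w S" if "T \<in> K" for T using that finK S(2) by simp
  have "0 < ?w {v. x v \<noteq> 0}" by (rule weight_support_pos[OF assms(1)]) (use x in auto)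
  then have "0 < ?w S" using le[OF x(2)] by linarith
  then have "?C \<noteq> {}" using S(1) le by blast
  then have "\<Union>?C \<in> ?C" by (intro Union_weight_chain_in[OF assms(1) x(1)]) auto
  then show "dominating_simplex K x \<in> K" "0 < ?w (dominating_simplex K x)"
    "\<And>T. T \<in> K \<Longrightarrow> ?w T \<le> ?w (dominating_simplex K x)"
    unfolding dominating_simplex_def by blast+
qed

lemma dominating_simplex_rotate:
  assumes p: "p > 0" and fin: "finite (\<Union>K)" and K: "translation_closed p K"
  shows "dominating_simplex K (rotate_point p e x) = translate p e ` dominating_simplex K x"
proof -
  let ?w = "weight (\<Union>K) x" and ?w' = "weight (\<Union>K) (rotate_point p e x)"
  note KZ = translation_closedD(1)[OF K] and cl = translation_closedD(2)[OF K]
    and VZ = translation_closedD(3)[OF K] and VT = translation_closedD(4)[OF K]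
  have inv: "translate p e ` translate p (- e) ` S = S" if "S \<in> K" for S
    by (rule translate_image_inverse(2)[OF p KZ[OF that]])
  have w: "?w' (translate p e ` S) = ?w S" if "S \<in> K" for S
    by (rule weight_rotate[OF p VZ VT fin]) (use that in auto)
  have K': "K = image (translate p e) ` K"
  proof
    show "K \<subseteq> image (translate p e) ` K"
    proof
      fix S assume S: "S \<in> K"
      show "S \<in> image (translate p e) ` K"
        by (rule image_eqI[of _ _ "translate p (- e) ` S"]) (simp_all only: inv[OF S] cl[OF S])
    qed
    show "image (translate p e) ` K \<subseteq> K" using cl by (intro image_subsetI)
  qed
  have "{S \<in> K. 0 < ?w' S \<and> (\<forall>T\<in>K. ?w' T \<le> ?w' S)}
      = image (translate p e) ` {S \<in> K. 0 < ?w S \<and> (\<forall>T\<in>K. ?w T \<le> ?w S)}" (is "?L = ?R")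
  proof (rule Set.set_eqI)
    fix S
    have all: "(\<forall>T\<in>K. ?w' T \<le> c) \<longleftrightarrow> (\<forall>T\<in>K. ?w T \<le> c)" for c
    proof -
      have "(\<forall>T\<in>K. ?w' T \<le> c) \<longleftrightarrow> (\<forall>T\<in>image (translate p e) ` K. ?w' T \<le> c)" using K' by simp
      also have "\<dots> \<longleftrightarrow> (\<forall>T\<in>K. ?w T \<le> c)" using w by simp
      finally show ?thesis .
    qed
    show "S \<in> ?L \<longleftrightarrow> S \<in> ?R"
    proof
      assume S: "S \<in> ?L"
      let ?S = "translate p (- e) ` S"
      have S': "?S \<in> K" "translate p e ` ?S = S" using S cl inv by blast+
      have "?w ?S = ?w' S" using w[OF S'(1)] unfolding S'(2) by (rule sym)
      then have "?S \<in> {S \<in> K. 0 < ?w S \<and> (\<forall>T\<in>K. ?w T \<le> ?w S)}"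
        using S S'(1) unfolding all by simp
      then show "S \<in> ?R" using S'(2) by (metis (no_types, lifting) imageI)
    next
      assume "S \<in> ?R"
      then obtain T where T: "S = translate p e ` T" "T \<in> {S \<in> K. 0 < ?w S \<and> (\<forall>T\<in>K. ?w T \<le> ?w S)}"
        by (rule imageE)
      then show "S \<in> ?L" unfolding all T(1) using cl w by simp
    qed
  qed
  then show ?thesis unfolding dominating_simplex_def by (simp add: image_Union)
qed

lemma dominating_simplex_nearby:
  assumes "finite (\<Union>K)" "x \<in> topspace (realization K)"
  obtains U where "openin (realization K) U" "x \<in> U"
    "\<And>y. y \<in> U \<Longrightarrow> 0 < weight (\<Union>K) x (dominating_simplex K y)"
proof -
  have finK: "finite K" using assms(1) by (rule finite_UnionD)
  have "\<exists>S\<in>K. 0 < weight (\<Union>K) x S" using dominating_simplex[OF assms] by blast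
  moreover have "continuous_map (realization K) euclideanreal (\<lambda>x. weight (\<Union>K) x S)" if "S \<in> K" for S
    using that by (intro continuous_map_weight assms continuous_map_realization_coordinate) auto
  ultimately obtain U where U: "openin (realization K) U" "x \<in> U"
    "\<And>y S. y \<in> U \<Longrightarrow> S \<in> K \<Longrightarrow> (\<And>T. T \<in> K \<Longrightarrow> weight (\<Union>K) y T \<le> weight (\<Union>K) y S) \<Longrightarrow>
      0 < weight (\<Union>K) x S"
    using dominant_nearby[OF finK, of "realization K" "weight (\<Union>K)" x] assms(2) by blast
  show ?thesis
  proof (rule that[OF U(1,2)])
    fix y assume y: "y \<in> U"
    then have "y \<in> topspace (realization K)" using openin_subset[OF U(1)] by blast
    note d = dominating_simplex[OF assms(1) this]
    show "0 < weight (\<Union>K) x (dominating_simplex K y)"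
      by (rule U(3)[OF y d(1) d(3)])
  qed
qed

section \<open>Kneser hypergraphs\<close>

lemma finite_edges:
  assumes "hypergraph F"
  shows "finite (edges F)"
  using assms unfolding hypergraph_def by (meson finite_Diff finite_Pow_iff rev_finite_subset)

text \<open>
  The simplex of the box complex that belongs to a sign vector: the part of colour \<open>e\<close> consists of the
  edges of \<open>F\<close> inside the sign class of \<open>e\<close>.
\<close>

definition contained_edges :: "nat \<Rightarrow> 'b hypergraph \<Rightarrow> (nat \<Rightarrow> 'b) \<Rightarrow> (int \<times> int) set \<Rightarrow> (int \<times> 'b set) set" where
  "contained_edges p F \<sigma> S =
    {(e, A). e \<in> Zp p \<and> A \<in> edges F \<and> A \<subseteq> \<sigma> ` {i. i < card (verts F) \<and> (e, int i + 1) \<in> S}}"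

lemma contained_edges_mono: "S \<subseteq> T \<Longrightarrow> contained_edges p F \<sigma> S \<subseteq> contained_edges p F \<sigma> T"
  unfolding contained_edges_def by blast

lemma contained_edges_translate:
  assumes "p > 0" "fst ` S \<subseteq> Zp p"
  shows "contained_edges p F \<sigma> (translate p e ` S) = translate p e ` contained_edges p F \<sigma> S"
proof (rule Set.set_eqI)
  fix x :: "int \<times> 'a set"
  obtain a A where x: "x = (a, A)" by (cases x)
  have Z: "fst ` contained_edges p F \<sigma> S \<subseteq> Zp p" by (auto simp: contained_edges_def)
  have "(a, int i + 1) \<in> translate p e ` S \<longleftrightarrow> ((a - e) mod int p, int i + 1) \<in> S" if "a \<in> Zp p" for i
    unfolding translate_image_mem_iff[OF assms] using that by (simp add: translate_def)
  moreover have "(a - e) mod int p \<in> Zp p" using assms(1) by (simp add: mem_Zp)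
  ultimately show "x \<in> contained_edges p F \<sigma> (translate p e ` S) \<longleftrightarrow> x \<in> translate p e ` contained_edges p F \<sigma> S"
    unfolding translate_image_mem_iff[OF assms(1) Z] x by (auto simp: contained_edges_def translate_def)
qed

text \<open>
  Edges inside different sign classes are disjoint. So a set of edges with at most one in each part is
  pairwise disjoint, which makes it an edge of the Kneser hypergraph.
\<close>

lemma contained_edges_box_complex:
  assumes "r > 0" "hypergraph F" "inj_on \<sigma> {..<card (verts F)}" "inj_on snd S"
    and "contained_edges p F \<sigma> S \<noteq> {}"
  shows "contained_edges p F \<sigma> S \<in> box_complex r p (kneser r F)"
proof -
  let ?h = "contained_edges p F \<sigma> S"
  have disj: "A \<inter> B = {}" if AB: "(a, A) \<in> ?h" "(b, B) \<in> ?h" "a \<noteq> b" for a b A B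
  proof (rule ccontr)
    assume "A \<inter> B \<noteq> {}"
    then obtain v where v: "v \<in> A" "v \<in> B" by blast
    have "v \<in> \<sigma> ` {i. i < card (verts F) \<and> (a, int i + 1) \<in> S}"
      using AB(1) v(1) unfolding contained_edges_def by blast
    moreover have "v \<in> \<sigma> ` {i. i < card (verts F) \<and> (b, int i + 1) \<in> S}"
      using AB(2) v(2) unfolding contained_edges_def by blast
    ultimately obtain i j where ij: "i < card (verts F)" "(a, int i + 1) \<in> S" "\<sigma> i = v"
      "j < card (verts F)" "(b, int j + 1) \<in> S" "\<sigma> j = v" by (auto simp: image_iff)
    then have "i = j" using inj_onD[OF assms(3), of i j] by simp
    then show False using inj_onD[OF assms(4) _ ij(2,5)] AB(3) by simp
  qed
  have ne: "A \<noteq> {}" if "(a, A) \<in> ?h" for a A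
    using that assms(2) by (auto simp: contained_edges_def hypergraph_def)
  have "inj_on snd ?h"
  proof (rule inj_onI)
    fix x y assume xy: "x \<in> ?h" "y \<in> ?h" "snd x = snd y"
    then show "x = y" using disj[of "fst x" "snd x" "fst y" "snd y"] ne[of "fst x" "snd x"]
      by (cases x; cases y) auto
  qed
  moreover have "rainbow_complete r p (kneser r F) ?h"
    unfolding rainbow_complete_def
  proof (intro allI impI)
    fix \<A> assume *: "\<A> \<subseteq> snd ` ?h \<and> card \<A> = r \<and> (\<forall>i\<in>Zp p. card (\<A> \<inter> ?h `` {i}) \<le> 1)"
    have AE: "\<A> \<subseteq> edges F" using * by (auto simp: contained_edges_def)
    have finA: "finite \<A>" using AE finite_edges[OF assms(2)] by (rule finite_subset)
    have "pairwise disjnt \<A>"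
    proof (rule pairwiseI)
      fix A B assume AB: "A \<in> \<A>" "B \<in> \<A>" "A \<noteq> B"
      have "\<exists>c. (c, C) \<in> ?h" if "C \<in> \<A>" for C
      proof -
        have "C \<in> snd ` ?h" using * that by blast
        then show ?thesis by force
      qed
      from this[OF AB(1)] this[OF AB(2)] obtain a b where ab: "(a, A) \<in> ?h" "(b, B) \<in> ?h" by blast
      have "a \<noteq> b"
      proof
        assume "a = b"
        then have "{A, B} \<subseteq> \<A> \<inter> ?h `` {a}" using AB ab by auto
        then have "card {A, B} \<le> card (\<A> \<inter> ?h `` {a})" using finA by (intro card_mono) auto
        moreover have "a \<in> Zp p" using ab(1) by (simp add: contained_edges_def)
        then have "card (\<A> \<inter> ?h `` {a}) \<le> 1" using * by blast
        ultimately show False using AB(3) by simp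
      qed
      then show "disjnt A B" using disj[OF ab] by (simp add: disjnt_def)
    qed
    then show "\<A> \<in> edges (kneser r F)" using * AE by (simp add: kneser_def)
  qed
  moreover have "?h \<subseteq> Zp p \<times> verts (kneser r F)" by (auto simp: contained_edges_def kneser_def)
  ultimately show ?thesis using assms(5) by (simp add: box_complex_iff)
qed

lemma inj_on_snd_imageI:
  assumes "\<And>y z. y \<in> W \<Longrightarrow> z \<in> W \<Longrightarrow> snd (f y) = snd (f z) \<Longrightarrow> f y = f z"
  shows "inj_on snd (f ` W)"
proof (rule inj_onI)
  fix a b assume "a \<in> f ` W" "b \<in> f ` W" and ab: "snd a = snd b"
  then obtain y z where "a = f y" "b = f z" "y \<in> W" "z \<in> W" by (elim imageE)
  then show "a = b" using assms[of y z] ab by simp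
qed

text \<open>
  Let \<open>N\<close> be the number of vertices of \<open>F\<close>, and \<open>a\<close> its alternation number, attained by \<open>\<sigma>\<close>. A point
  of \<open>EZp p (int N - 1)\<close> is labelled by means of its dominating simplex, seen as a sign vector. If the
  alternation of the vector is at most \<open>a\<close>, the label is the first sign on the level given by the
  alternation. Otherwise, by the choice of \<open>\<sigma>\<close>, some sign class contains an edge. Such vectors form the
  set \<open>P\<close>; where they have positive weight, \<open>contained_edges\<close> induces a map into the box complex. A map
  that realizes the index of the box complex turns this into labels on the levels above \<open>a\<close>. The labels
  are coherent, so \<open>no_coherent_labelling\<close> bounds the number \<open>N\<close> of levels of the join.
\<close>

theorem ind_box_kneser_ge:
  fixes F :: "'b hypergraph"
  assumes p: "p \<ge> 2" and r: "r > 0" and F: "hypergraph F"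
  shows "int (card (verts F)) \<le> ind_box r p (kneser r F) + 1 + int (alt_number p F)"
proof (rule ccontr)
  assume contra: "\<not> ?thesis"
  have p0: "p > 0" using p by simp
  let ?N = "card (verts F)" and ?B = "box_complex r p (kneser r F)" and ?m = "ind_box r p (kneser r F)"
  let ?a = "alt_number p F"
  have finH: "finite (verts (kneser r F))" using finite_edges[OF F] by (simp add: kneser_def)
  obtain g where m: "-1 \<le> ?m" and g: "index_witness p ?B ?m g"
    by (rule ind_box_attained[OF p0 finH])
  obtain \<sigma> where \<sigma>: "bij_betw \<sigma> {..<?N} (verts F)" "?a = alt_wrt p F \<sigma>"
    by (rule alt_number_attained[OF p0 F])
  define n where "n = ?N - 1"
  have n: "int n = int ?N - 1" "int ?a + ?m + 1 \<le> int n" using contra m by (auto simp: n_def)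
  let ?E = "EZp p (int ?N - 1)"
  let ?V = "\<Union>?E" and ?X = "realization ?E"
  let ?M = "dominating_simplex ?E" and ?h = "contained_edges p F \<sigma>"
  define P where "P = {S \<in> ?E. ?a < alt (signs ?N S)}"
  let ?r = "carrier_map ?V P ?h"
  let ?O = "{x. \<exists>S\<in>P. 0 < weight ?V x S}"
  have finV: "finite ?V" using finite_EZp[OF p0] finite_EZp_simplex[OF p0] by blast
  have finP: "finite P" using finite_EZp[OF p0] by (simp add: P_def)
  have E: "inj_on snd S" "fst ` S \<subseteq> Zp p" "S \<noteq> {}" if "S \<in> ?E" for S using that by (auto simp: EZp_def)
  note EC = translation_closed_EZp[OF p0, of "int ?N - 1"]
  note VZ = translation_closedD(3)[OF EC] and VT = translation_closedD(4)[OF EC]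
  have P: "S \<in> ?E" "S \<subseteq> ?V" if "S \<in> P" for S using that by (auto simp: P_def)
  have PT: "translate p e ` S \<in> P" if "S \<in> P" for S e
    using that translate_EZp[OF p0] alt_signs_translate[OF p0] by (simp add: P_def)
  have hB: "?h S \<in> ?B" if S: "S \<in> P" for S
  proof -
    have "?h S \<noteq> {}"
    proof
      assume "?h S = {}"
      \<comment> \<open>If no sign class contains an edge, the vector competes in the maximum that defines \<open>alt_wrt p F \<sigma>\<close>.\<close>
      then have "edges (induced_sub F (\<sigma> ` sign_class (signs ?N S) e)) = {}" if "e \<in> Zp p" for e
        using that unfolding sign_class_signs[OF E(1)[OF P(1)[OF S]]]
        by (auto simp: induced_sub_def contained_edges_def)
      then have "alt (signs ?N S) \<le> alt_wrt p F \<sigma>"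
        by (intro alt_le_alt_wrt[OF p0 length_signs set_signs_subset[OF E(1,2)[OF P(1)[OF S]]]])
      then show False using S \<sigma>(2) by (simp add: P_def)
    qed
    then show ?thesis
      using contained_edges_box_complex[OF r F bij_betw_imp_inj_on[OF \<sigma>(1)] E(1)[OF P(1)[OF S]]] by blast
  qed
  have hne: "finite (?h S) \<and> ?h S \<noteq> {}" if "S \<in> P" for S
    using finite_Union_box_complex(2)[OF p0 finH hB[OF that]] hB[OF that] by (simp add: box_complex_iff)
  have X0: "0 \<le> x v" if "x \<in> topspace ?X" for x v using that unfolding topspace_realization by blast
  have M: "?M x \<in> ?E" "0 < weight ?V x (?M x)" if "x \<in> topspace ?X" for x
    using dominating_simplex[OF finV that] by blast+
  have cont: "continuous_map (subtopology ?X ?O) (realization ?B) ?r"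
  proof (rule continuous_carrier_map[OF finV finP])
    show "S \<subseteq> ?V \<and> finite (?h S) \<and> ?h S \<noteq> {}" if "S \<in> P" for S using P(2)[OF that] hne[OF that] by blast
    fix x assume x: "x \<in> topspace ?X" "\<exists>S\<in>P. 0 < weight ?V x S"
    let ?C = "{S \<in> P. 0 < weight ?V x S}"
    \<comment> \<open>The faces in \<open>P\<close> of positive weight form a chain; its largest element determines the support.\<close>
    have top: "\<Union>?C \<in> ?C"
      using x(2) P(2) by (intro Union_weight_chain_in[OF finV X0[OF x(1)]]) auto
    have "\<Union>{?h S |S. S \<in> P \<and> 0 < weight ?V x S} = ?h (\<Union>?C)"
    proof
      show "\<Union>{?h S |S. S \<in> P \<and> 0 < weight ?V x S} \<subseteq> ?h (\<Union>?C)"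
        using contained_edges_mono[of _ "\<Union>?C" p F \<sigma>] by blast
      show "?h (\<Union>?C) \<subseteq> \<Union>{?h S |S. S \<in> P \<and> 0 < weight ?V x S}" using top by blast
    qed
    then show "\<Union>{?h S |S. S \<in> P \<and> 0 < weight ?V x S} \<in> ?B" using top hB by simp
  qed
  have gcont: "continuous_map (realization ?B) (realization (EZp p ?m)) g"
    and gequi: "equivariant_on p (topspace (realization ?B)) (\<lambda>e. realization_map (translate p e))
       (\<lambda>e. realization_map (translate p e)) g"
    using g by (simp_all add: index_witness_def)
  have rX: "?r x \<in> topspace (realization ?B)" if "x \<in> topspace ?X" "?M x \<in> P" for x
  proof -
    have "x \<in> topspace (subtopology ?X ?O)" using that M(2) by auto
    then show ?thesis using cont unfolding continuous_map_into_realization by blast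
  qed
  have grX: "g (?r x) \<in> topspace (realization (EZp p ?m))" if "x \<in> topspace ?X" "?M x \<in> P" for x
    using rX[OF that] gcont unfolding continuous_map_into_realization by blast
  define high where "high x = point_label (g (?r x))" for x
  define lab where "lab x =
    (if ?M x \<in> P then (fst (high x), snd (high x) + int ?a)
     else (first_sign (signs ?N (?M x)), int (alt (signs ?N (?M x)))))" for x
  have high_range: "high x \<in> Zp p \<times> {1..?m + 1}" if "x \<in> topspace ?X" "?M x \<in> P" for x
    unfolding high_def by (rule point_label_range[OF p0 grX[OF that]])
  have low_le: "1 \<le> alt (signs ?N (?M x)) \<and> alt (signs ?N (?M x)) \<le> ?a" if "x \<in> topspace ?X" "?M x \<notin> P" for x
    using alt_signs_pos[OF M(1)[OF that(1)]] M(1)[OF that(1)] that(2) by (simp add: P_def)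
  show False
  proof (rule no_coherent_labelling[OF p, where n = n and lab = lab])
    fix x assume "x \<in> topspace (realization (EZp p (int n)))"
    then have x: "x \<in> topspace ?X" unfolding n(1) .
    show "lab x \<in> Zp p \<times> {1..int n}"
    proof (cases "?M x \<in> P")
      case True
      then show ?thesis using high_range[OF x True] n(2) by (auto simp: lab_def mem_Times_iff)
    next
      case False
      then show ?thesis using low_le[OF x False] first_sign_in_Zp[OF M(1)[OF x]] n(2) m by (simp add: lab_def)
    qed
  next
    show "equivariant_on p (topspace (realization (EZp p (int n))))
      (\<lambda>e. realization_map (translate p e)) (translate p) lab"
      unfolding equivariant_on_def n(1)
    proof (intro ballI)
      fix e x assume e: "e \<in> Zp p" and x: "x \<in> topspace ?X"
      have rot: "realization_map (translate p e) x = rotate_point p e x"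
        by (rule realization_map_translate[OF p0 support_in_Zp[OF x EZp_fst]])
      have Mrot: "?M (rotate_point p e x) = translate p e ` ?M x"
        by (rule dominating_simplex_rotate[OF p0 finV EC])
      have MP: "?M (rotate_point p e x) \<in> P \<longleftrightarrow> ?M x \<in> P"
        unfolding Mrot using M(1)[OF x] translate_EZp[OF p0] alt_signs_translate[OF p0 M(1)[OF x]]
        by (simp add: P_def)
      show "lab (realization_map (translate p e) x) = translate p e (lab x)"
      proof (cases "?M x \<in> P")
        case True
        have "?r (rotate_point p e x) = rotate_point p e (?r x)"
        proof (rule carrier_map_rotate[OF p0 finV VZ VT P(2) PT])
          show "fst ` ?h S \<subseteq> Zp p \<and> finite (?h S)" if "S \<in> P" for S
            using hne[OF that] by (auto simp: contained_edges_def)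
          show "?h (translate p e ` S) = translate p e ` ?h S" if "S \<in> P" for S e
            using contained_edges_translate[OF p0 E(2)[OF P(1)[OF that]]] .
        qed
        also have "\<dots> = realization_map (translate p e) (?r x)"
          using translation_closed_box_complex[OF p0, of r "kneser r F"] unfolding translation_closed_def
          by (intro realization_map_translate[OF p0, symmetric] support_in_Zp[OF rX[OF x True]]) auto
        finally have "g (?r (rotate_point p e x)) = realization_map (translate p e) (g (?r x))"
          using gequi e rX[OF x True] unfolding equivariant_on_def by simp
        also have "\<dots> = rotate_point p e (g (?r x))"
          by (rule realization_map_translate[OF p0 support_in_Zp[OF grX[OF x True] EZp_fst]])
        finally have "high (rotate_point p e x) = translate p e (high x)"
          unfolding high_def using point_label_rotate[OF p0 grX[OF x True]] by simp
        then show ?thesis using True MP unfolding rot lab_def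
          by (simp add: translate_def split_beta)
      next
        case False
        then show ?thesis
          using MP first_sign_signs_translate[OF p0 M(1)[OF x], of e] alt_signs_translate[OF p0 M(1)[OF x], of e]
          unfolding rot lab_def Mrot by (simp add: translate_def)
      qed
    qed
  next
    show "coherent (realization (EZp p (int n))) lab"
      unfolding coherent_def n(1)
    proof
      fix x assume x: "x \<in> topspace ?X"
      obtain U where U: "openin ?X U" "x \<in> U" "\<And>y. y \<in> U \<Longrightarrow> 0 < weight ?V x (?M y)"
        using dominating_simplex_nearby[OF finV x] by blast
      have UX: "y \<in> topspace ?X" if "y \<in> U" for y using openin_subset[OF U(1)] that by blast
      \<comment> \<open>Two dominating simplices that occur near \<open>x\<close> have positive weight at \<open>x\<close>, so they are
          comparable, and equal alternations force equal first signs.\<close>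
      have low: "lab y = lab z" if yz: "y \<in> U" "z \<in> U" "?M y \<notin> P" "?M z \<notin> P" "snd (lab y) = snd (lab z)" for y z
      proof -
        note My = M(1)[OF UX[OF yz(1)]] and Mz = M(1)[OF UX[OF yz(2)]]
        have eq: "alt (signs ?N (?M y)) = alt (signs ?N (?M z))" using yz by (simp add: lab_def)
        have "?M y \<subseteq> ?M z \<or> ?M z \<subseteq> ?M y"
          using My Mz by (intro weight_pos_chain[OF finV _ _ X0[OF x] U(3)[OF yz(1)] U(3)[OF yz(2)]]) auto
        then have "first_sign (signs ?N (?M y)) = first_sign (signs ?N (?M z))"
        proof
          assume "?M y \<subseteq> ?M z"
          then show ?thesis
            using first_sign_eq[OF signs_mono[OF E(1)[OF Mz]] signs_nonempty[OF My] eq] by blast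
        next
          assume "?M z \<subseteq> ?M y"
          then show ?thesis
            using first_sign_eq[OF signs_mono[OF E(1)[OF My]] signs_nonempty[OF Mz] eq[symmetric]] by simp
        qed
        then show ?thesis using yz eq by (simp add: lab_def)
      qed
      show "\<exists>U. openin ?X U \<and> x \<in> U \<and> inj_on snd (lab ` U)"
      proof (cases "x \<in> ?O")
        case False
        have nP: "?M y \<notin> P" if "y \<in> U" for y using U(3)[OF that] False by blast
        have "inj_on snd (lab ` U)"
          by (rule inj_on_snd_imageI) (rule low[OF _ _ nP nP])
        then show ?thesis using U by blast
      next
        case True
        have "openin ?X (\<Union>S\<in>P. {y \<in> topspace ?X. 0 < weight ?V y S})"
        proof (intro openin_Union ballI)
          fix T assume "T \<in> (\<lambda>S. {y \<in> topspace ?X. 0 < weight ?V y S}) ` P"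
          then obtain S where S: "T = {y \<in> topspace ?X. 0 < weight ?V y S}" "S \<in> P" by blast
          have "continuous_map ?X euclideanreal (\<lambda>y. weight ?V y S)"
            by (rule continuous_map_weight[OF finV P(2)[OF S(2)] continuous_map_realization_coordinate])
          then show "openin ?X T" unfolding S(1) by (intro openin_less) simp_all
        qed
        also have "(\<Union>S\<in>P. {y \<in> topspace ?X. 0 < weight ?V y S}) = topspace ?X \<inter> ?O" by blast
        finally have openO: "openin ?X (topspace ?X \<inter> ?O)" .
        have "coherent (subtopology ?X ?O) (\<lambda>x. point_label ((g \<circ> ?r) x))"
          by (rule coherent_point_label[OF p0 continuous_map_compose[OF cont gcont]])
        moreover have "x \<in> topspace (subtopology ?X ?O)" using x True by simp
        ultimately obtain W where W: "openin (subtopology ?X ?O) W" "x \<in> W"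
          "inj_on snd ((\<lambda>x. point_label ((g \<circ> ?r) x)) ` W)"
          unfolding coherent_def by blast
        have "openin ?X W"
        proof -
          obtain T where T: "openin ?X T" "W = T \<inter> ?O" using W(1) unfolding openin_subtopology by blast
          then have "W = T \<inter> (topspace ?X \<inter> ?O)" using openin_subset[OF T(1)] by blast
          then show ?thesis using openin_Int[OF T(1) openO] by simp
        qed
        then have "openin ?X (U \<inter> W)" using U(1) by (rule openin_Int[rotated])
        moreover have "inj_on snd (lab ` (U \<inter> W))"
        proof -
          have hi: "lab y = lab z" if "y \<in> U \<inter> W" "z \<in> U \<inter> W" "?M y \<in> P" "?M z \<in> P" "snd (lab y) = snd (lab z)" for y z
          proof -
            have "snd (high y) = snd (high z)" using that by (simp add: lab_def)
            moreover have "high y \<in> (\<lambda>x. point_label ((g \<circ> ?r) x)) ` W" "high z \<in> (\<lambda>x. point_label ((g \<circ> ?r) x)) ` W"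
              using that by (auto simp: high_def)
            ultimately have "high y = high z" using inj_onD[OF W(3)] by blast
            then show ?thesis using that by (simp add: lab_def)
          qed
          \<comment> \<open>Low labels have levels up to \<open>a\<close>, and high labels have levels above \<open>a\<close>.\<close>
          have mixed: "snd (lab y) \<noteq> snd (lab z)" if "y \<in> U" "z \<in> U" "?M y \<in> P" "?M z \<notin> P" for y z
          proof -
            have "int ?a < snd (lab y)" using high_range[OF UX[OF that(1)] that(3)] that(3) by (auto simp: lab_def)
            moreover have "snd (lab z) \<le> int ?a" using low_le[OF UX[OF that(2)] that(4)] that(4) by (simp add: lab_def)
            ultimately show ?thesis by simp
          qed
          have "lab y = lab z" if yz: "y \<in> U \<inter> W" "z \<in> U \<inter> W" "snd (lab y) = snd (lab z)" for y z
          proof (cases "?M y \<in> P")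
            case True
            then have "?M z \<in> P" using mixed[of y z] yz by blast
            then show ?thesis using hi[OF yz(1,2) True _ yz(3)] by blast
          next
            case False
            then have "?M z \<notin> P" using mixed[of z y] yz by auto
            then show ?thesis using low[OF _ _ False _ yz(3)] yz by blast
          qed
          then show ?thesis by (rule inj_on_snd_imageI)
        qed
        ultimately show ?thesis using U(2) W(2) by blast
      qed
    qed
  qed
qed

theorem theorem2:
  fixes r p :: nat
  assumes "r \<ge> 2" and "prime p" and "p \<ge> r"
  shows "(\<forall>H :: 'a hypergraph.
            hypergraph H \<and> uniform r H \<and> p \<le> clique_number r H \<longrightarrow>
            Xind_hom r p H + int p \<ge> ind_box r p H + 1) \<and>
         (\<forall>(H :: 'b set hypergraph) (F :: 'b hypergraph).
            hypergraph H \<and> uniform r H \<and> hypergraph F \<and> H = kneser r F \<longrightarrow>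
            ind_box r p H + 1 \<ge> int (card (verts F)) - int (alt_number p F) \<and>
            int (card (verts F)) - int (alt_number p F) \<ge> int (colorability_defect p F))"
proof (intro conjI allI impI)
  have p: "p \<ge> 2" "p > 0" using assms by auto
  show "ind_box r p H + 1 \<le> Xind_hom r p H + int p"
    if "hypergraph H \<and> uniform r H \<and> p \<le> clique_number r H" for H :: "'a hypergraph"
    using that by (intro ind_box_le_Xind_hom[OF assms(2)]) (simp add: hypergraph_def)
  fix H :: "'b set hypergraph" and F :: "'b hypergraph"
  assume H: "hypergraph H \<and> uniform r H \<and> hypergraph F \<and> H = kneser r F"
  show "int (card (verts F)) - int (alt_number p F) \<le> ind_box r p H + 1"
    using ind_box_kneser_ge[OF p(1), of r F] H assms(1) by simp
  show "int (colorability_defect p F) \<le> int (card (verts F)) - int (alt_number p F)"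
    using colorability_defect_le[OF p(2), of F] H by simp
qed

end
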